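(* Let $u'''=f(x,u,p,q)$ (with $p=u'$, $q=u''$) be a third-order ODE. It is equivalent under a point transformation to one of the canonical forms (each having four point symmetries) (i) $u'''=3\frac{(u'')^2}{u'}+\alpha\frac{(2xu''+u')^{3/2}}{x^2\sqrt{u'}}$ for some $\alpha\neq0$, (ii) $u'''=(u'')^{3/2}$, (iii) $u'''=(u'')^3$, if and only if $I_4=0$, $I_6\neq0$, $I_7\neq0$ and the coframe $$ \begin{pmatrix}\theta^{1}\\ \theta^{2}\\ \theta^{3}\\ \theta^4\end{pmatrix}= \begin{pmatrix} \frac{I_7^3}{I_6} & 0 & 0&0 \\ \frac{I_5I_7}{I_6} &I_7& 0 &0 \\ \frac{I_2I_6^2+I_5^2}{2I_6I_7}&\frac{I_1I_6+3I_5}{3I_7} &\frac{I_6}{I_7}&0\\ \frac{I_3I_7^2}{I_6}&0&0&\frac{I_7^2}{I_6} \end{pmatrix} \begin{pmatrix}\omega^{1}\\ \omega^{2}\\ \omega^{3}\\ \omega^{4}\end{pmatrix} $$ has constant structure functions identical to those of the coframe constructed by the same formulas from the canonical form (i) for some $\alpha\ne0$, respectively from (ii), respectively from (iii). Moreover, in case (i), the parameter $\alpha$ can be evaluated by the invariant relation $T^2_{12}=\lambda$, where $\lambda=\frac{3\alpha^2+4}{16\alpha^2}$.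
   Context: Everything is local and over the complex numbers. $(x,u,p,q)$, with $p=u'$, $q=u''$, are local coordinates on the second-order jet space. Two third-order ODEs $u'''=f(x,u,u',u'')$ and $\bar u'''=\bar f(\bar x,\bar u,\bar u',\bar u'')$ are equivalent under a point transformation if there is a transformation $\bar x=\varphi(x,u)$, $\bar u=\psi(x,u)$ with $\varphi_x\psi_u-\varphi_u\psi_x\ne0$ mapping one to the other. For an ODE with right-hand side $f(x,u,p,q)$ put $\hat D_x=\partial_x+p\,\partial_u+q\,\partial_p+f\,\partial_q$; letter subscripts denote partial derivatives (e.g. $I_{1_q}=\partial I_1/\partial q$). The base coframe is $\omega^1=du-p\,dx$, $\omega^2=dp-q\,dx$, $\omega^3=dq-f\,dx$, $\omega^4=dx$. Define $$I_1=-f_q,\qquad I_2=-\tfrac29 I_1^2-f_p-\tfrac13\hat D_xI_1,\qquad I_3=-\tfrac16 I_{1_q},$$ $$I_4=-\tfrac13I_1I_2-f_u-\tfrac12\hat D_xI_2,\qquad I_5=\tfrac13I_1I_{3_q}-I_3^2-I_{3_p},\qquad I_6=-I_{3_q},$$ $$I_7=-I_3-\left(\frac{I_5}{I_6}\right)_q.$$ The structure functions $T^i_{jk}$ of a coframe $\theta^1,\dots,\theta^4$ are defined by $d\theta^i=\sum_{j<k}T^i_{jk}\,\theta^j\wedge\theta^k$. *)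

theory Defs
  imports "HOL-Analysis.Analysis"
begin

text \<open>
  A point of the second-order jet space is \<open>z :: complex^4\<close> with
  \<open>z$1 = x\<close>, \<open>z$2 = u\<close>, \<open>z$3 = p\<close>, \<open>z$4 = q\<close>; a point of the \<open>(x,u)\<close>-plane is a
  \<open>complex^2\<close>. In the index type \<open>4\<close> the numeral \<open>4\<close> equals \<open>0\<close>, so the order of that type is
  never used below.
\<close>

definition holo_on :: "(complex^'n::finite \<Rightarrow> complex) \<Rightarrow> (complex^'n) set \<Rightarrow> bool" where
  "holo_on g U \<longleftrightarrow> open U \<and>
     (\<forall>z\<in>U. \<exists>D. (g has_derivative D) (at z) \<and> (\<forall>c v. D (c *s v) = c * D v))"

definition pd :: "'n::finite \<Rightarrow> (complex^'n \<Rightarrow> complex) \<Rightarrow> complex^'n \<Rightarrow> complex" where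
  "pd i g z = deriv (\<lambda>t. g (z + axis i t)) 0"

definition total_deriv :: "(complex^4 \<Rightarrow> complex) \<Rightarrow> (complex^4 \<Rightarrow> complex) \<Rightarrow> complex^4 \<Rightarrow> complex" where
  "total_deriv f g z = pd 1 g z + z$3 * pd 2 g z + z$4 * pd 3 g z + f z * pd 4 g z"


definition base_pt :: "complex^4 \<Rightarrow> complex^2" where
  "base_pt z = vector [z$1, z$2]"

definition lift :: "(complex^2 \<Rightarrow> complex) \<Rightarrow> complex^4 \<Rightarrow> complex" where
  "lift g z = g (base_pt z)"

text \<open>
  Prolongation of \<open>(\<phi>, \<psi>)\<close> to derivatives along solutions of \<open>u''' = f\<close>. Since \<open>prol_p\<close> does not
  depend on \<open>q\<close>, the first two prolongations do not depend on \<open>f\<close>; \<open>prol_r\<close> is the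
  third derivative of the transformed solution.
\<close>

definition prol_p where
  "prol_p f \<phi> \<psi> z = total_deriv f (lift \<psi>) z / total_deriv f (lift \<phi>) z"

definition prol_q where
  "prol_q f \<phi> \<psi> z = total_deriv f (prol_p f \<phi> \<psi>) z / total_deriv f (lift \<phi>) z"

definition prol_r where
  "prol_r f \<phi> \<psi> z = total_deriv f (prol_q f \<phi> \<psi>) z / total_deriv f (lift \<phi>) z"

definition prolong ::
  "(complex^4 \<Rightarrow> complex) \<Rightarrow> (complex^2 \<Rightarrow> complex) \<Rightarrow> (complex^2 \<Rightarrow> complex) \<Rightarrow> complex^4 \<Rightarrow> complex^4" where
  "prolong f \<phi> \<psi> z = vector [lift \<phi> z, lift \<psi> z, prol_p f \<phi> \<psi> z, prol_q f \<phi> \<psi> z]"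

text \<open>
  Local equivalence of the ODE \<open>u''' = f\<close> near \<open>z0\<close> with the ODE \<open>u''' = F\<close> near \<open>w\<close>.
  The condition \<open>total_deriv f (lift \<phi>) z0 \<noteq> 0\<close> says that the transformed curves are still graphs.
\<close>

definition point_equivalent_at ::
  "(complex^4 \<Rightarrow> complex) \<Rightarrow> complex^4 \<Rightarrow> (complex^4 \<Rightarrow> complex) \<Rightarrow> complex^4 \<Rightarrow> bool" where
  "point_equivalent_at f z0 F w \<longleftrightarrow>
     (\<exists>\<phi> \<psi> W. base_pt z0 \<in> W \<and> holo_on \<phi> W \<and> holo_on \<psi> W \<and>
        (\<forall>y\<in>W. pd 1 \<phi> y * pd 2 \<psi> y - pd 2 \<phi> y * pd 1 \<psi> y \<noteq> 0) \<and>
        total_deriv f (lift \<phi>) z0 \<noteq> 0 \<and>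
        prolong f \<phi> \<psi> z0 = w \<and>
        (\<forall>\<^sub>F z in nhds z0. F (prolong f \<phi> \<psi> z) = prol_r f \<phi> \<psi> z))"


definition I1 :: "(complex^4 \<Rightarrow> complex) \<Rightarrow> complex^4 \<Rightarrow> complex" where
  "I1 f z = - pd 4 f z"

definition I2 :: "(complex^4 \<Rightarrow> complex) \<Rightarrow> complex^4 \<Rightarrow> complex" where
  "I2 f z = - (2/9) * (I1 f z)\<^sup>2 - pd 3 f z - (1/3) * total_deriv f (I1 f) z"

definition I3 :: "(complex^4 \<Rightarrow> complex) \<Rightarrow> complex^4 \<Rightarrow> complex" where
  "I3 f z = - (1/6) * pd 4 (I1 f) z"

definition I4 :: "(complex^4 \<Rightarrow> complex) \<Rightarrow> complex^4 \<Rightarrow> complex" where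
  "I4 f z = - (1/3) * I1 f z * I2 f z - pd 2 f z - (1/2) * total_deriv f (I2 f) z"

definition I5 :: "(complex^4 \<Rightarrow> complex) \<Rightarrow> complex^4 \<Rightarrow> complex" where
  "I5 f z = (1/3) * I1 f z * pd 4 (I3 f) z - (I3 f z)\<^sup>2 - pd 3 (I3 f) z"

definition I6 :: "(complex^4 \<Rightarrow> complex) \<Rightarrow> complex^4 \<Rightarrow> complex" where
  "I6 f z = - pd 4 (I3 f) z"

definition I7 :: "(complex^4 \<Rightarrow> complex) \<Rightarrow> complex^4 \<Rightarrow> complex" where
  "I7 f z = - I3 f z - pd 4 (\<lambda>y. I5 f y / I6 f y) z"

text \<open>
  A coframe is given by the matrix whose \<open>i\<close>-th row lists the coefficients of the \<open>i\<close>-th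
  one-form with respect to \<open>dx, du, dp, dq\<close>.
\<close>

definition base_coframe :: "(complex^4 \<Rightarrow> complex) \<Rightarrow> complex^4 \<Rightarrow> complex^4^4" where
  "base_coframe f z = vector
     [vector [- z$3, 1, 0, 0],
      vector [- z$4, 0, 1, 0],
      vector [- f z, 0, 0, 1],
      vector [1, 0, 0, 0]]"

definition coframe :: "(complex^4 \<Rightarrow> complex) \<Rightarrow> complex^4 \<Rightarrow> complex^4^4" where
  "coframe f z =
     (let i1 = I1 f z; i2 = I2 f z; i3 = I3 f z; i5 = I5 f z; i6 = I6 f z; i7 = I7 f z in
      (vector
        [vector [i7^3 / i6, 0, 0, 0],
         vector [i5 * i7 / i6, i7, 0, 0],
         vector [(i2 * i6\<^sup>2 + i5\<^sup>2) / (2 * i6 * i7), (i1 * i6 + 3 * i5) / (3 * i7), i6 / i7, 0],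
         vector [i3 * i7\<^sup>2 / i6, 0, 0, i7\<^sup>2 / i6]] :: complex^4^4)
      ** base_coframe f z)"

text \<open>
  \<open>ext_deriv \<theta> i a b z\<close> is the value of the two-form \<open>d\<theta>\<^sup>i\<close> on the pair \<open>(\<partial>\<^sub>a, \<partial>\<^sub>b)\<close> of coordinate
  fields, and \<open>wedge \<theta> j k a b z\<close> that of the two-form \<open>\<theta>\<^sup>j \<and> \<theta>\<^sup>k\<close>. Only the values \<open>T i j k\<close>
  with \<open>(j,k)\<close> in \<open>index_pairs\<close> are meaningful.
\<close>

definition ext_deriv :: "(complex^4 \<Rightarrow> complex^4^4) \<Rightarrow> 4 \<Rightarrow> 4 \<Rightarrow> 4 \<Rightarrow> complex^4 \<Rightarrow> complex" where
  "ext_deriv \<theta> i a b z = pd a (\<lambda>y. \<theta> y $ i $ b) z - pd b (\<lambda>y. \<theta> y $ i $ a) z"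

definition wedge :: "(complex^4 \<Rightarrow> complex^4^4) \<Rightarrow> 4 \<Rightarrow> 4 \<Rightarrow> 4 \<Rightarrow> 4 \<Rightarrow> complex^4 \<Rightarrow> complex" where
  "wedge \<theta> j k a b z = \<theta> z $ j $ a * \<theta> z $ k $ b - \<theta> z $ j $ b * \<theta> z $ k $ a"

definition index_pairs :: "(4 \<times> 4) set" where
  "index_pairs = {(1,2), (1,3), (1,4), (2,3), (2,4), (3,4)}"

definition structure_functions_at ::
  "(complex^4 \<Rightarrow> complex^4^4) \<Rightarrow> complex^4 \<Rightarrow> (4 \<Rightarrow> 4 \<Rightarrow> 4 \<Rightarrow> complex) \<Rightarrow> bool" where
  "structure_functions_at \<theta> z T \<longleftrightarrow>
     (\<forall>i a b. ext_deriv \<theta> i a b z = (\<Sum>(j,k)\<in>index_pairs. T i j k * wedge \<theta> j k a b z))"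


text \<open>
  The canonical forms, as functions \<open>F\<close> on an open set \<open>V\<close> of the jet space. The half-integer powers are
  taken with respect to an arbitrary holomorphic branch on \<open>V\<close> (a continuous square root of a
  nowhere vanishing holomorphic function is holomorphic). On the third form the set \<open>q = 0\<close> is
  removed: there \<open>I7 = - 5 q\<close>, so its coframe is defined only where \<open>q \<noteq> 0\<close>. On the first two forms
  \<open>I6\<close> and \<open>I7\<close> have no zeros where the right-hand side is holomorphic.
\<close>

definition canonical1 :: "complex \<Rightarrow> (complex^4 \<Rightarrow> complex) \<Rightarrow> (complex^4) set \<Rightarrow> bool" where
  "canonical1 \<alpha> F V \<longleftrightarrow> open V \<and>
     (\<exists>r s. continuous_on V r \<and> continuous_on V s \<and>
        (\<forall>z\<in>V. z$1 \<noteq> 0 \<and> z$3 \<noteq> 0 \<and> 2 * z$1 * z$4 + z$3 \<noteq> 0 \<and>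
           (r z)\<^sup>2 = 2 * z$1 * z$4 + z$3 \<and> (s z)\<^sup>2 = z$3 \<and>
           F z = 3 * ((z$4)\<^sup>2 / z$3) + \<alpha> * ((r z)^3 / ((z$1)\<^sup>2 * s z))))"

definition canonical2 :: "(complex^4 \<Rightarrow> complex) \<Rightarrow> (complex^4) set \<Rightarrow> bool" where
  "canonical2 F V \<longleftrightarrow> open V \<and>
     (\<exists>r. continuous_on V r \<and> (\<forall>z\<in>V. z$4 \<noteq> 0 \<and> (r z)\<^sup>2 = z$4 \<and> F z = (r z)^3))"

definition canonical3 :: "(complex^4 \<Rightarrow> complex) \<Rightarrow> (complex^4) set \<Rightarrow> bool" where
  "canonical3 F V \<longleftrightarrow> open V \<and> (\<forall>z\<in>V. z$4 \<noteq> 0 \<and> F z = (z$4)^3)"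

definition equivalent_to ::
  "((complex^4 \<Rightarrow> complex) \<Rightarrow> (complex^4) set \<Rightarrow> bool) \<Rightarrow> (complex^4 \<Rightarrow> complex) \<Rightarrow> complex^4 \<Rightarrow> bool" where
  "equivalent_to C f z0 \<longleftrightarrow> (\<exists>F V w. C F V \<and> w \<in> V \<and> point_equivalent_at f z0 F w)"

definition canonical_structure ::
  "((complex^4 \<Rightarrow> complex) \<Rightarrow> (complex^4) set \<Rightarrow> bool) \<Rightarrow> (4 \<Rightarrow> 4 \<Rightarrow> 4 \<Rightarrow> complex) \<Rightarrow> bool" where
  "canonical_structure C T \<longleftrightarrow> (\<forall>F V. C F V \<longrightarrow> (\<forall>z\<in>V. structure_functions_at (coframe F) z T))"

definition constant_structure_near ::
  "(complex^4 \<Rightarrow> complex) \<Rightarrow> complex^4 \<Rightarrow> (4 \<Rightarrow> 4 \<Rightarrow> 4 \<Rightarrow> complex) \<Rightarrow> bool" where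
  "constant_structure_near f z0 T \<longleftrightarrow> (\<forall>\<^sub>F z in nhds z0. structure_functions_at (coframe f) z T)"

definition invariants_near :: "(complex^4 \<Rightarrow> complex) \<Rightarrow> complex^4 \<Rightarrow> bool" where
  "invariants_near f z0 \<longleftrightarrow> (\<forall>\<^sub>F z in nhds z0. I4 f z = 0 \<and> I6 f z \<noteq> 0 \<and> I7 f z \<noteq> 0)"


text \<open>
  Infinitesimal point symmetries \<open>X = \<xi> \<partial>\<^sub>x + \<eta> \<partial>\<^sub>u\<close> of \<open>u''' = f\<close> near \<open>w\<close>, with \<open>\<xi> y = X y $ 1\<close> and
  \<open>\<eta> y = X y $ 2\<close>: the third prolongation of \<open>X\<close> annihilates \<open>u''' - f\<close> on the equation.
  Having four point symmetries means that the vector space of germs of symmetries has dimension four,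
  that is, has a basis indexed by the type \<open>4\<close>.
\<close>

definition point_symmetry_at ::
  "(complex^4 \<Rightarrow> complex) \<Rightarrow> complex^4 \<Rightarrow> (complex^2 \<Rightarrow> complex^2) \<Rightarrow> bool" where
  "point_symmetry_at f w X \<longleftrightarrow>
     (let \<xi> = lift (\<lambda>y. X y $ 1);
          \<eta>0 = lift (\<lambda>y. X y $ 2);
          \<eta>1 = (\<lambda>z. total_deriv f \<eta>0 z - z$3 * total_deriv f \<xi> z);
          \<eta>2 = (\<lambda>z. total_deriv f \<eta>1 z - z$4 * total_deriv f \<xi> z);
          \<eta>3 = (\<lambda>z. total_deriv f \<eta>2 z - f z * total_deriv f \<xi> z)
      in (\<exists>W. base_pt w \<in> W \<and> holo_on (\<lambda>y. X y $ 1) W \<and> holo_on (\<lambda>y. X y $ 2) W) \<and>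
         (\<forall>\<^sub>F z in nhds w.
            \<eta>3 z = \<xi> z * pd 1 f z + \<eta>0 z * pd 2 f z + \<eta>1 z * pd 3 f z + \<eta>2 z * pd 4 f z))"

definition four_point_symmetries_at :: "(complex^4 \<Rightarrow> complex) \<Rightarrow> complex^4 \<Rightarrow> bool" where
  "four_point_symmetries_at f w \<longleftrightarrow>
     (\<exists>B :: 4 \<Rightarrow> complex^2 \<Rightarrow> complex^2.
        (\<forall>k. point_symmetry_at f w (B k)) \<and>
        (\<forall>X. point_symmetry_at f w X \<longrightarrow>
           (\<exists>!c :: complex^4. \<forall>\<^sub>F y in nhds (base_pt w). X y = (\<Sum>k\<in>UNIV. c $ k *s B k y))))"

definition has_four_point_symmetries ::
  "((complex^4 \<Rightarrow> complex) \<Rightarrow> (complex^4) set \<Rightarrow> bool) \<Rightarrow> bool" where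
  "has_four_point_symmetries C \<longleftrightarrow> (\<forall>F V. C F V \<longrightarrow> (\<forall>w\<in>V. four_point_symmetries_at F w))"

end

theory Submission
  imports Defs "HOL-Complex_Analysis.Cauchy_Integral_Formula"
begin

text \<open>
  The coframe of the theorem is singled out among all coframes \<open>\<theta> = C \<omega>\<close> with \<open>C\<close> of the
  triangular pattern \<open>adapted_shape\<close> by a few affine conditions on its structure functions, collected
  in \<open>normalized\<close>. Write \<open>l\<close>, \<open>h\<close>, \<open>B\<close>, \<open>G\<close>, \<open>E\<close>, \<open>K\<close> for the free entries of \<open>C\<close> that remain after
  \<open>T 1 2 4 = T 2 3 4 = -1\<close> has been used. If the structure functions are constant and normalized, the
  structure equations express enough derivatives of \<open>f\<close> and of these entries to compute
  \<open>I1 = 3 (G - B)\<close>, \<open>I2 = 2 E - B\<^sup>2\<close>, \<open>I3 = K\<close>, \<open>I4 = 0\<close>, \<open>I5 = B l h\<^sup>2\<close>, \<open>I6 = l h\<^sup>2\<close> and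
  \<open>I7 = l h\<close>. Solving for the entries gives exactly the matrix of the theorem
  (\<open>normalized_adapted_coframe\<close>). So \<open>I4 = 0\<close> is a consequence, and an adapted coframe with
  normalized structure functions is unique.

  For each canonical form the entries are explicit functions, and a direct computation shows that
  the structure functions are constant and normalized. They are \<open>structure_radical c\<close> with
  \<open>c = (3 \<alpha>\<^sup>2 + 4) / (16 \<alpha>\<^sup>2)\<close> for the form (i), with \<open>c = 3/16\<close> for (ii), and \<open>structure_cubic\<close> for
  (iii). Here \<open>c\<close> is \<open>T 2 1 2\<close>. It determines \<open>\<alpha>\<close> up to sign, and the sign is only the
  choice of a branch of the square root, which yields the statement about the parameter.

  If \<open>f\<close> is point equivalent to a canonical form \<open>F\<close>, the prolonged transformation pulls the coframe
  of \<open>F\<close> back to an adapted coframe with the same structure functions. By uniqueness this is the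
  coframe of \<open>f\<close> (\<open>structure_if_point_equivalent\<close>).

  Conversely, two coframes with the same constant structure functions are locally equivalent, by a
  theorem of Cartan (\<open>coframe_equivalence\<close>). Its proof here is direct: along each ray from \<open>z0\<close> the
  required map \<open>\<Phi>\<close> solves an ordinary differential equation; Picard iteration solves
  all of them at once with holomorphic dependence on the end point (\<open>radial_Picard\<close>), and the
  difference between the pulled back coframe and the given one satisfies a linear homogeneous
  differential equation along each ray, so it vanishes (\<open>coframes_agree\<close>). Comparing the two coframes
  entry by entry shows that \<open>\<Phi>\<close> preserves the contact forms and that its first two components do
  not depend on \<open>p\<close> and \<open>q\<close>; hence \<open>\<Phi>\<close> is a prolonged point transformation
  (\<open>point_equivalent_if_structure\<close>).

  The four symmetries of each canonical form come from its determining equation. At a fixed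
  \<open>(x, u, p)\<close> it is a polynomial identity in the root that occurs in the equation (or in \<open>q\<close>), valid
  for infinitely many values, so all coefficients vanish. The resulting differential equations for
  the components of the vector field are solved explicitly.
\<close>

section \<open>Partial derivatives of holomorphic functions\<close>

definition holo_at :: "(complex^'n::finite \<Rightarrow> complex) \<Rightarrow> complex^'n \<Rightarrow> bool" where
  "holo_at g z \<longleftrightarrow> (\<exists>D. (g has_derivative D) (at z) \<and> (\<forall>c v. D (c *s v) = c * D v))"

lemma holo_on_iff: "holo_on g U \<longleftrightarrow> open U \<and> (\<forall>z\<in>U. holo_at g z)"
  by (simp add: holo_on_def holo_at_def)

lemma axis_smult: "axis i (t::complex) = t *s axis i 1"
  by (simp add: vec_eq_iff axis_def)

lemma has_derivative_line:
  fixes g :: "complex^'n::finite \<Rightarrow> complex"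
  assumes "(g has_derivative D) (at (z + t *s v))" "\<forall>c v. D (c *s v) = c * D v"
  shows "((\<lambda>t. g (z + t *s v)) has_field_derivative D v) (at t)"
proof -
  have bl: "bounded_linear (\<lambda>t::complex. t *s v)"
    by (rule linear_conv_bounded_linear[THEN iffD1], rule linearI)
       (auto simp: vec_eq_iff algebra_simps)
  have "((\<lambda>t. z + t *s v) has_derivative (\<lambda>t. t *s v)) (at t)"
    by (rule has_derivative_add_const[OF bounded_linear.has_derivative[OF bl has_derivative_ident], of z, simplified add.commute]
       | auto intro!: derivative_eq_intros bounded_linear.has_derivative[OF bl])+
  from diff_chain_at[OF this, of g D] assms(1)
  have "((\<lambda>t. g (z + t *s v)) has_derivative (\<lambda>t. D (t *s v))) (at t)"
    by (simp add: o_def)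
  moreover have "(\<lambda>t. D (t *s v)) = (*) (D v)"
    using assms(2) by (simp add: fun_eq_iff mult.commute)
  ultimately show ?thesis unfolding has_field_derivative_def by simp
qed

lemma pd_has_derivative:
  fixes g :: "complex^'n::finite \<Rightarrow> complex"
  assumes "(g has_derivative D) (at z)" "\<forall>c v. D (c *s v) = c * D v"
  shows "pd i g z = D (axis i 1)"
proof -
  have "((\<lambda>t. g (z + t *s axis i 1)) has_field_derivative D (axis i 1)) (at 0)"
    by (rule has_derivative_line) (use assms in auto)
  moreover have "(\<lambda>t. g (z + axis i t)) = (\<lambda>t. g (z + t *s axis i 1))"
    by (rule ext, subst axis_smult) (rule refl)
  ultimately show ?thesis by (simp add: pd_def DERIV_imp_deriv)
qed

lemma linear_eq_sum_axis:
  fixes D :: "complex^'n::finite \<Rightarrow> complex"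
  assumes "linear D" "\<forall>c v. D (c *s v) = c * D v"
  shows "D v = (\<Sum>i\<in>UNIV. v$i * D (axis i 1))"
proof -
  have "v = (\<Sum>i\<in>UNIV. v$i *s axis i 1)"
    by (simp add: vec_eq_iff axis_def mult_delta_right)
  then have "D v = D (\<Sum>i\<in>UNIV. v$i *s axis i 1)" by simp
  also have "\<dots> = (\<Sum>i\<in>UNIV. v$i * D (axis i 1))"
    using assms by (simp add: linear_sum)
  finally show ?thesis .
qed

lemma holo_at_has_derivative:
  fixes g :: "complex^'n::finite \<Rightarrow> complex"
  assumes "holo_at g z"
  shows "(g has_derivative (\<lambda>v. \<Sum>i\<in>UNIV. v$i * pd i g z)) (at z)"
proof -
  obtain D where D: "(g has_derivative D) (at z)" "\<forall>c v. D (c *s v) = c * D v"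
    using assms unfolding holo_at_def by blast
  have "D = (\<lambda>v. \<Sum>i\<in>UNIV. v$i * pd i g z)"
    unfolding pd_has_derivative[OF D]
    by (rule ext, rule linear_eq_sum_axis[OF has_derivative_linear[OF D(1)] D(2)])
  with D(1) show ?thesis by simp
qed

text \<open>
  The basic derivative rules below are obtained by exhibiting the real derivative in the form of a
  sum over the coordinates, which yields complex linearity and the partial derivatives together.
\<close>

lemma holo_atI:
  fixes g :: "complex^'n::finite \<Rightarrow> complex"
  assumes "(g has_derivative (\<lambda>v. \<Sum>i\<in>UNIV. v$i * d i)) (at z)"
  shows "holo_at g z" "pd i g z = d i"
proof -
  have lin: "\<forall>c v. (\<Sum>i\<in>UNIV. (c *s v)$i * d i) = c * (\<Sum>i\<in>UNIV. v$i * d i)"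
    by (simp add: sum_distrib_left mult.assoc)
  show "holo_at g z" unfolding holo_at_def using assms lin by blast
  show "pd i g z = d i"
    unfolding pd_has_derivative[OF assms lin, of i]
    by (simp add: axis_def mult_delta_left)
qed

lemma holo_at_line:
  assumes "holo_at g (z + t *s v)"
  shows "((\<lambda>t. g (z + t *s v)) has_field_derivative (\<Sum>i\<in>UNIV. v$i * pd i g (z + t *s v))) (at t)"
  by (rule has_derivative_line[OF holo_at_has_derivative[OF assms]])
     (simp add: sum_distrib_left mult.assoc)

lemma holo_at_const [simp, intro]: "holo_at (\<lambda>z. c) z" and pd_const [simp]: "pd i (\<lambda>z. c) z = 0"
proof -
  have "((\<lambda>z. c) has_derivative (\<lambda>v. \<Sum>i\<in>UNIV. v$i * 0)) (at z)" by simp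
  from holo_atI[OF this] show "holo_at (\<lambda>z. c) z" "pd i (\<lambda>z. c) z = 0" by auto
qed

lemma holo_at_nth [simp, intro]: "holo_at (\<lambda>z. z $ j) z"
  and pd_nth [simp]: "pd i (\<lambda>z. z $ j) z = (if i = j then 1 else 0)"
proof -
  have "((\<lambda>z. z $ j) has_derivative (\<lambda>v. \<Sum>i\<in>UNIV. v$i * (if i = j then 1 else 0))) (at z)"
    by (simp add: mult_delta_right bounded_linear.has_derivative[OF bounded_linear_vec_nth])
  from holo_atI[OF this] show "holo_at (\<lambda>z. z $ j) z" "pd i (\<lambda>z. z $ j) z = (if i = j then 1 else 0)"
    by auto
qed

context
  fixes g h :: "complex^'n::finite \<Rightarrow> complex" and z
  assumes g: "holo_at g z" and h: "holo_at h z"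
begin

lemma holo_at_add [simp, intro]: "holo_at (\<lambda>z. g z + h z) z"
  and pd_add [simp]: "pd i (\<lambda>z. g z + h z) z = pd i g z + pd i h z"
proof -
  have "((\<lambda>z. g z + h z) has_derivative (\<lambda>v. \<Sum>i\<in>UNIV. v$i * (pd i g z + pd i h z))) (at z)"
    using has_derivative_add[OF holo_at_has_derivative[OF g] holo_at_has_derivative[OF h]]
    by (simp add: sum.distrib algebra_simps)
  from holo_atI[OF this] show "holo_at (\<lambda>z. g z + h z) z" "pd i (\<lambda>z. g z + h z) z = pd i g z + pd i h z"
    by auto
qed

lemma holo_at_diff [simp, intro]: "holo_at (\<lambda>z. g z - h z) z"
  and pd_diff [simp]: "pd i (\<lambda>z. g z - h z) z = pd i g z - pd i h z"
proof -
  have "((\<lambda>z. g z - h z) has_derivative (\<lambda>v. \<Sum>i\<in>UNIV. v$i * (pd i g z - pd i h z))) (at z)"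
    using has_derivative_diff[OF holo_at_has_derivative[OF g] holo_at_has_derivative[OF h]]
    by (simp add: sum_subtractf algebra_simps)
  from holo_atI[OF this] show "holo_at (\<lambda>z. g z - h z) z" "pd i (\<lambda>z. g z - h z) z = pd i g z - pd i h z"
    by auto
qed

lemma holo_at_mult [simp, intro]: "holo_at (\<lambda>z. g z * h z) z"
  and pd_mult [simp]: "pd i (\<lambda>z. g z * h z) z = g z * pd i h z + pd i g z * h z"
proof -
  have "((\<lambda>z. g z * h z) has_derivative (\<lambda>v. \<Sum>i\<in>UNIV. v$i * (g z * pd i h z + pd i g z * h z))) (at z)"
    using has_derivative_mult[OF holo_at_has_derivative[OF g] holo_at_has_derivative[OF h]]
    by (simp add: sum.distrib algebra_simps sum_distrib_left)
  from holo_atI[OF this] show "holo_at (\<lambda>z. g z * h z) z"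
    "pd i (\<lambda>z. g z * h z) z = g z * pd i h z + pd i g z * h z"
    by auto
qed

lemma holo_at_divide [simp, intro]: "h z \<noteq> 0 \<Longrightarrow> holo_at (\<lambda>z. g z / h z) z"
  and pd_divide [simp]: "h z \<noteq> 0 \<Longrightarrow> pd i (\<lambda>z. g z / h z) z = (pd i g z * h z - g z * pd i h z) / (h z)\<^sup>2"
proof -
  assume nz: "h z \<noteq> 0"
  have "((\<lambda>z. g z / h z) has_derivative (\<lambda>v. \<Sum>i\<in>UNIV. v$i * ((pd i g z * h z - g z * pd i h z) / (h z)\<^sup>2))) (at z)"
    by (rule has_derivative_eq_rhs[OF has_derivative_divide'[OF holo_at_has_derivative[OF g] holo_at_has_derivative[OF h] nz]])
       (auto simp: fun_eq_iff power2_eq_square sum_subtractf[symmetric] algebra_simps sum_distrib_left sum_divide_distrib)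
  from holo_atI[OF this] show "holo_at (\<lambda>z. g z / h z) z"
    "pd i (\<lambda>z. g z / h z) z = (pd i g z * h z - g z * pd i h z) / (h z)\<^sup>2"
    by auto
qed

end

lemma holo_at_uminus [simp, intro]: "holo_at g z \<Longrightarrow> holo_at (\<lambda>z. - g z) z"
  and pd_uminus [simp]: "holo_at g z \<Longrightarrow> pd i (\<lambda>z. - g z) z = - pd i g z"
  using holo_at_diff[of "\<lambda>z. 0" z g] pd_diff[of "\<lambda>z. 0" z g] by auto

lemma holo_at_power [simp, intro]: "holo_at g z \<Longrightarrow> holo_at (\<lambda>z. g z ^ n) z"
  and pd_power [simp]: "holo_at g z \<Longrightarrow> pd i (\<lambda>z. g z ^ n) z = of_nat n * g z ^ (n - 1) * pd i g z"
proof -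
  assume g: "holo_at g z"
  have "holo_at (\<lambda>z. g z ^ n) z \<and> pd i (\<lambda>z. g z ^ n) z = of_nat n * g z ^ (n - 1) * pd i g z"
  proof (induction n)
    case (Suc n)
    then show ?case using g by (cases n) (auto simp: algebra_simps)
  qed simp
  then show "holo_at (\<lambda>z. g z ^ n) z" "pd i (\<lambda>z. g z ^ n) z = of_nat n * g z ^ (n - 1) * pd i g z" by auto
qed

lemma holo_at_sum [intro]: "(\<And>k. k \<in> A \<Longrightarrow> holo_at (g k) z) \<Longrightarrow> holo_at (\<lambda>z. \<Sum>k\<in>A. g k z) z"
  and pd_sum: "(\<And>k. k \<in> A \<Longrightarrow> holo_at (g k) z) \<Longrightarrow> pd i (\<lambda>z. \<Sum>k\<in>A. g k z) z = (\<Sum>k\<in>A. pd i (g k) z)"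
proof -
  assume g: "\<And>k. k \<in> A \<Longrightarrow> holo_at (g k) z"
  have "holo_at (\<lambda>z. \<Sum>k\<in>A. g k z) z \<and> pd i (\<lambda>z. \<Sum>k\<in>A. g k z) z = (\<Sum>k\<in>A. pd i (g k) z)"
    using g by (induction A rule: infinite_finite_induct) auto
  then show "holo_at (\<lambda>z. \<Sum>k\<in>A. g k z) z" "pd i (\<lambda>z. \<Sum>k\<in>A. g k z) z = (\<Sum>k\<in>A. pd i (g k) z)" by auto
qed

lemma holo_at_prod [intro]: "(\<And>k. k \<in> A \<Longrightarrow> holo_at (g k) z) \<Longrightarrow> holo_at (\<lambda>z. \<Prod>k\<in>A. g k z) z"
  by (induction A rule: infinite_finite_induct) auto

lemma has_derivative_vecI:
  fixes \<Phi> :: "'a::real_normed_vector \<Rightarrow> complex^'m::finite"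
  assumes "\<And>m. ((\<lambda>z. \<Phi> z $ m) has_derivative (\<lambda>v. D v $ m)) (at z)"
  shows "(\<Phi> has_derivative D) (at z)"
  unfolding has_derivative_componentwise_within[of \<Phi>]
proof
  fix b :: "complex^'m" assume "b \<in> Basis"
  then obtain m u where "b = axis m u" by (auto simp: Basis_vec_def)
  then show "((\<lambda>x. \<Phi> x \<bullet> b) has_derivative (\<lambda>x. D x \<bullet> b)) (at z)"
    by (simp add: inner_axis has_derivative_inner_left[OF assms])
qed

lemma holo_at_chain:
  fixes \<Phi> :: "complex^'n::finite \<Rightarrow> complex^'m::finite"
  assumes "holo_at g (\<Phi> z)" and \<Phi>: "\<And>m. holo_at (\<lambda>z. \<Phi> z $ m) z"
  shows "holo_at (\<lambda>z. g (\<Phi> z)) z"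
    and "pd i (\<lambda>z. g (\<Phi> z)) z = (\<Sum>m\<in>UNIV. pd m g (\<Phi> z) * pd i (\<lambda>z. \<Phi> z $ m) z)"
proof -
  have "(\<Phi> has_derivative (\<lambda>v. \<chi> m. \<Sum>i\<in>UNIV. v$i * pd i (\<lambda>z. \<Phi> z $ m) z)) (at z)"
    by (rule has_derivative_vecI) (simp add: holo_at_has_derivative[OF \<Phi>])
  from diff_chain_at[OF this holo_at_has_derivative[OF assms(1)]]
  have "((\<lambda>z. g (\<Phi> z)) has_derivative (\<lambda>v. \<Sum>m\<in>UNIV. (\<Sum>i\<in>UNIV. v$i * pd i (\<lambda>z. \<Phi> z $ m) z) * pd m g (\<Phi> z))) (at z)"
    by (simp add: o_def)
  moreover have "(\<Sum>m\<in>UNIV. (\<Sum>i\<in>UNIV. v$i * pd i (\<lambda>z. \<Phi> z $ m) z) * pd m g (\<Phi> z))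
      = (\<Sum>i\<in>UNIV. v$i * (\<Sum>m\<in>UNIV. pd m g (\<Phi> z) * pd i (\<lambda>z. \<Phi> z $ m) z))" for v
    unfolding sum_distrib_left sum_distrib_right by (subst sum.swap) (simp add: mult_ac)
  ultimately have *: "((\<lambda>z. g (\<Phi> z)) has_derivative
     (\<lambda>v. \<Sum>i\<in>UNIV. v$i * (\<Sum>m\<in>UNIV. pd m g (\<Phi> z) * pd i (\<lambda>z. \<Phi> z $ m) z))) (at z)" by simp
  show "holo_at (\<lambda>z. g (\<Phi> z)) z"
     "pd i (\<lambda>z. g (\<Phi> z)) z = (\<Sum>m\<in>UNIV. pd m g (\<Phi> z) * pd i (\<lambda>z. \<Phi> z $ m) z)"
    using holo_atI[OF *] by auto
qed

lemma holo_at_continuous: "holo_at g z \<Longrightarrow> isCont g z"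
  by (rule has_derivative_continuous[OF holo_at_has_derivative])

lemma holo_at_transform:
  assumes "holo_at g z" "\<forall>\<^sub>F y in nhds z. g y = h y"
  shows "holo_at h z" "pd i h z = pd i g z"
proof -
  have "((\<lambda>y. h y) has_derivative (\<lambda>v. \<Sum>i\<in>UNIV. v$i * pd i g z)) (at z)"
  proof (rule has_derivative_transform_eventually[OF holo_at_has_derivative[OF assms(1)]])
    show "\<forall>\<^sub>F x in at z. g x = h x"
      using assms(2) by (simp add: eventually_nhds_conv_at)
    show "g z = h z" using assms(2) by (simp add: eventually_nhds_conv_at)
  qed simp
  from holo_atI[OF this] show "holo_at h z" "pd i h z = pd i g z" by auto
qed


section \<open>Cauchy estimates and limits of holomorphic functions\<close>

lemma norm_smult_vec: "norm (c *s (v :: complex^'n::finite)) = cmod c * norm v"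
  by (simp add: norm_vec_def norm_mult L2_set_right_distrib)

lemma norm_axis_complex: "norm (axis i c :: complex^'n::finite) = cmod c"
proof -
  have "norm (axis i c :: complex^'n) = sqrt (\<Sum>j\<in>UNIV. if j = i then (cmod c)\<^sup>2 else 0)"
    unfolding norm_vec_def L2_set_def by (intro arg_cong[of _ _ sqrt] sum.cong) (auto simp: axis_def)
  then show ?thesis by simp
qed

text \<open>
  Cauchy's inequality in one variable, applied to the restriction of \<open>g\<close> to the complex
  line through \<open>z\<close> in direction \<open>v\<close>. The bound is uniform in the
  direction, as needed for operator norms.
\<close>

lemma directional_Cauchy_estimate:
  fixes g :: "complex^'n::finite \<Rightarrow> complex"
  assumes holo: "\<And>y. y \<in> cball z r \<Longrightarrow> holo_at g y"
    and bound: "\<And>y. y \<in> cball z r \<Longrightarrow> cmod (g y) \<le> M" and r: "r > 0"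
  shows "cmod (\<Sum>i\<in>UNIV. v$i * pd i g z) \<le> M / r * norm v"
proof (cases "v = 0")
  case False
  define s where "s = r / norm v"
  have s: "s > 0" using r False by (simp add: s_def)
  have mem: "z + t *s v \<in> cball z r" if "cmod t \<le> s" for t
    using that False by (simp add: dist_norm norm_smult_vec s_def field_simps)
  have der: "((\<lambda>t. g (z + t *s v)) has_field_derivative (\<Sum>i\<in>UNIV. v$i * pd i g (z + t *s v))) (at t)"
    if "cmod t \<le> s" for t
    by (rule holo_at_line, rule holo, rule mem[OF that])
  have "cmod ((deriv ^^ 1) (\<lambda>t. g (z + t *s v)) 0) \<le> fact 1 * M / s ^ 1"
  proof (rule Cauchy_inequality)
    show "(\<lambda>t. g (z + t *s v)) holomorphic_on ball 0 s"
      by (rule holomorphic_onI) (auto simp: field_differentiable_def intro!: exI has_field_derivative_at_within[OF der])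
    show "continuous_on (cball 0 s) (\<lambda>t. g (z + t *s v))"
      by (rule continuous_at_imp_continuous_on) (auto intro!: DERIV_isCont[OF der])
    show "cmod (g (z + t *s v)) \<le> M" if "cmod (0 - t) = s" for t
      using bound[OF mem, of t] that by simp
  qed (rule s)
  moreover have "deriv (\<lambda>t. g (z + t *s v)) 0 = (\<Sum>i\<in>UNIV. v$i * pd i g z)"
    using DERIV_imp_deriv[OF der[of 0]] s by simp
  ultimately show ?thesis by (simp add: s_def mult.commute)
qed simp

text \<open>
  Weierstrass' theorem in several variables: by the Cauchy estimates for the differences of two
  members of the sequence, the derivatives converge uniformly near each point, so differentiation
  commutes with the limit.
\<close>

lemma holo_uniform_limit:
  fixes g :: "nat \<Rightarrow> complex^'n::finite \<Rightarrow> complex"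
  assumes U: "open U" and g: "\<And>n. holo_on (g n) U" and lim: "uniform_limit U g G sequentially"
  shows "holo_on G U" and "z \<in> U \<Longrightarrow> (\<lambda>n. pd i (g n) z) \<longlonglongrightarrow> pd i G z"
proof -
  have *: "holo_at G z \<and> (\<forall>i. (\<lambda>n. pd i (g n) z) \<longlonglongrightarrow> pd i G z)" if "z \<in> U" for z
  proof -
    obtain R where R: "R > 0" "cball z R \<subseteq> U" using U \<open>z \<in> U\<close> open_contains_cball by blast
    define r where "r = R / 2"
    have r: "r > 0" using R by (simp add: r_def)
    have sub: "cball y r \<subseteq> U" if "y \<in> ball z r" for y
    proof
      fix w assume "w \<in> cball y r"
      then have "dist z w \<le> R"
        using that dist_triangle[of z w y] by (simp add: r_def field_simps)
      then show "w \<in> U" using R by auto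
    qed
    have close: "\<exists>N. \<forall>m\<ge>N. \<forall>n\<ge>N. \<forall>y\<in>ball z r. \<forall>v.
        cmod ((\<Sum>i\<in>UNIV. v$i * pd i (g m) y) - (\<Sum>i\<in>UNIV. v$i * pd i (g n) y)) \<le> e * norm v" if e: "e > 0" for e
    proof -
      have "e * r / 2 > 0" using e r by simp
      then obtain N where N: "\<forall>n\<ge>N. \<forall>x\<in>U. dist (g n x) (G x) < e * r / 2"
        using uniform_limitD[OF lim, of "e * r / 2"] unfolding eventually_sequentially by blast
      show ?thesis
      proof (intro exI[of _ N] allI impI ballI)
        fix m n y and v :: "complex^'n" assume mn: "m \<ge> N" "n \<ge> N" and y: "y \<in> ball z r"
        have ho: "holo_at (g k) x" if "x \<in> cball y r" for k x
          using g[of k] sub[OF y] that by (auto simp: holo_on_iff)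
        have "cmod (\<Sum>i\<in>UNIV. v$i * pd i (\<lambda>x. g m x - g n x) y) \<le> (e * r) / r * norm v"
        proof (rule directional_Cauchy_estimate[OF _ _ r])
          fix x assume x: "x \<in> cball y r"
          show "holo_at (\<lambda>x. g m x - g n x) x" using ho[OF x] by blast
          have "x \<in> U" using sub[OF y] x by blast
          then have "dist (g m x) (G x) < e * r / 2" "dist (g n x) (G x) < e * r / 2" using N mn by auto
          then show "cmod (g m x - g n x) \<le> e * r"
            using dist_triangle2[of "g m x" "g n x" "G x"] by (simp add: dist_norm)
        qed
        then show "cmod ((\<Sum>i\<in>UNIV. v$i * pd i (g m) y) - (\<Sum>i\<in>UNIV. v$i * pd i (g n) y)) \<le> e * norm v"
          using r ho[of y] by (simp add: pd_diff sum_subtractf algebra_simps)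
      qed
    qed
    define d where "d i y = lim (\<lambda>n. pd i (g n) y)" for i y
    have "convergent (\<lambda>n. pd i (g n) y)" if y: "y \<in> ball z r" for i y
      unfolding Cauchy_convergent_iff[symmetric]
    proof (rule metric_CauchyI)
      fix e :: real assume "e > 0"
      then obtain N where N: "\<forall>m\<ge>N. \<forall>n\<ge>N. \<forall>y\<in>ball z r. \<forall>v.
        cmod ((\<Sum>i\<in>UNIV. v$i * pd i (g m) y) - (\<Sum>i\<in>UNIV. v$i * pd i (g n) y)) \<le> (e/2) * norm v"
        using close[of "e/2"] by auto
      have nx: "norm (axis i 1 :: complex^'n) = 1" by (simp add: norm_axis_complex)
      have "dist (pd i (g m) y) (pd i (g n) y) < e" if "m \<ge> N" "n \<ge> N" for m n
        using N[rule_format, OF that y, of "axis i 1"] \<open>e > 0\<close> unfolding nx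
        by (simp add: axis_def mult_delta_left dist_norm)
      then show "\<exists>N. \<forall>m\<ge>N. \<forall>n\<ge>N. dist (pd i (g m) y) (pd i (g n) y) < e" by blast
    qed
    then have d: "(\<lambda>n. pd i (g n) y) \<longlonglongrightarrow> d i y" if "y \<in> ball z r" for i y
      using that by (simp add: convergent_LIMSEQ_iff d_def)
    have "\<exists>G'. \<forall>x\<in>ball z r. (\<lambda>n. g n x) \<longlonglongrightarrow> G' x \<and>
        (G' has_derivative (\<lambda>v. \<Sum>i\<in>UNIV. v$i * d i x)) (at x within ball z r)"
    proof (rule has_derivative_sequence)
      show "(g n has_derivative (\<lambda>v. \<Sum>i\<in>UNIV. v$i * pd i (g n) x)) (at x within ball z r)"
        if "x \<in> ball z r" for n x
      proof (rule has_derivative_at_withinI, rule holo_at_has_derivative)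
        have "x \<in> U" by (rule subsetD[OF sub[OF that]]) (use r in simp)
        then show "holo_at (g n) x" using g[of n] by (simp add: holo_on_iff)
      qed
      show "\<forall>\<^sub>F n in sequentially. \<forall>x\<in>ball z r. \<forall>h.
          norm ((\<Sum>i\<in>UNIV. h$i * pd i (g n) x) - (\<Sum>i\<in>UNIV. h$i * d i x)) \<le> e * norm h" if e: "e > 0" for e
      proof -
        obtain N where N: "\<forall>m\<ge>N. \<forall>n\<ge>N. \<forall>y\<in>ball z r. \<forall>v.
          cmod ((\<Sum>i\<in>UNIV. v$i * pd i (g m) y) - (\<Sum>i\<in>UNIV. v$i * pd i (g n) y)) \<le> e * norm v"
          using close[OF e] by auto
        show ?thesis unfolding eventually_sequentially
        proof (intro exI[of _ N] allI impI ballI)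
          fix n x and h :: "complex^'n" assume n: "n \<ge> N" and x: "x \<in> ball z r"
          have "(\<lambda>m. (\<Sum>i\<in>UNIV. h$i * pd i (g n) x) - (\<Sum>i\<in>UNIV. h$i * pd i (g m) x))
             \<longlonglongrightarrow> (\<Sum>i\<in>UNIV. h$i * pd i (g n) x) - (\<Sum>i\<in>UNIV. h$i * d i x)"
            by (intro tendsto_intros d x)
          moreover have "\<forall>\<^sub>F m in sequentially.
             norm ((\<Sum>i\<in>UNIV. h$i * pd i (g n) x) - (\<Sum>i\<in>UNIV. h$i * pd i (g m) x)) \<le> e * norm h"
            unfolding eventually_sequentially using N n x by blast
          ultimately show "norm ((\<Sum>i\<in>UNIV. h$i * pd i (g n) x) - (\<Sum>i\<in>UNIV. h$i * d i x)) \<le> e * norm h"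
            by (rule tendsto_upperbound[OF tendsto_norm]) simp
        qed
      qed
      show "(\<lambda>n. g n z) \<longlonglongrightarrow> G z"
        using tendsto_uniform_limitI[OF lim \<open>z \<in> U\<close>] .
    qed (use r in auto)
    then obtain G' where "\<forall>x\<in>ball z r. (\<lambda>n. g n x) \<longlonglongrightarrow> G' x \<and>
        (G' has_derivative (\<lambda>v. \<Sum>i\<in>UNIV. v$i * d i x)) (at x within ball z r)" ..
    then have G': "\<And>x. x \<in> ball z r \<Longrightarrow> (\<lambda>n. g n x) \<longlonglongrightarrow> G' x"
        "(G' has_derivative (\<lambda>v. \<Sum>i\<in>UNIV. v$i * d i z)) (at z within ball z r)"
      using centre_in_ball[of z r] r by auto
    have eq: "G' x = G x" if "x \<in> ball z r" for x
    proof -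
      have "x \<in> U" by (rule subsetD[OF sub[OF that]]) (use r in simp)
      then show ?thesis using LIMSEQ_unique[OF G'(1)[OF that] tendsto_uniform_limitI[OF lim]] by auto
    qed
    have "(G has_derivative (\<lambda>v. \<Sum>i\<in>UNIV. v$i * d i z)) (at z within ball z r)"
      by (rule has_derivative_transform[OF _ _ G'(2)]) (use r eq in auto)
    then have "(G has_derivative (\<lambda>v. \<Sum>i\<in>UNIV. v$i * d i z)) (at z)"
      using at_within_open[of z "ball z r"] r by simp
    from holo_atI[OF this] d[of z] r show ?thesis by simp
  qed
  show "holo_on G U" using * U by (auto simp: holo_on_iff)
  show "z \<in> U \<Longrightarrow> (\<lambda>n. pd i (g n) z) \<longlonglongrightarrow> pd i G z" using * by auto
qed


lemma holo_at_translate: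
  assumes "holo_at g (y + c)"
  shows "holo_at (\<lambda>y. g (y + c)) y" "pd j (\<lambda>y. g (y + c)) y = pd j g (y + c)"
proof -
  have h: "\<And>m. holo_at (\<lambda>y. (y + c) $ m) y" by simp
  show "holo_at (\<lambda>y. g (y + c)) y" by (rule holo_at_chain(1)[OF assms h])
  show "pd j (\<lambda>y. g (y + c)) y = pd j g (y + c)"
    by (subst holo_at_chain(2)[OF assms h]) (simp add: mult_delta_right)
qed

lemma uniform_limit_null_bound:
  fixes g :: "nat \<Rightarrow> 'a \<Rightarrow> complex"
  assumes "\<And>n y. y \<in> S \<Longrightarrow> cmod (g n y - G y) \<le> b n" "b \<longlonglongrightarrow> 0"
  shows "uniform_limit S g G sequentially"
proof (rule uniform_limitI)
  fix e :: real assume "e > 0"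
  from order_tendstoD(2)[OF assms(2) this]
  show "\<forall>\<^sub>F n in sequentially. \<forall>x\<in>S. dist (g n x) (G x) < e"
  proof eventually_elim
    case (elim n)
    then show ?case using assms(1)[of _ n] by (simp add: dist_norm) (meson le_less_trans)
  qed
qed

text \<open>
  The remainder of the first Taylor polynomial along the \<open>i\<close>-th coordinate is
  controlled by the second derivative, which Cauchy's inequality bounds by \<open>2 M /
  r\<^sup>2\<close> on the disc of radius \<open>r\<close>.
\<close>

lemma difference_quotient_estimate:
  fixes g :: "complex^'n::finite \<Rightarrow> complex"
  assumes holo: "\<And>y. y \<in> cball z (2 * r) \<Longrightarrow> holo_at g y"
    and bound: "\<And>y. y \<in> cball z (2 * r) \<Longrightarrow> cmod (g y) \<le> M" and r: "r > 0"
    and t: "t \<noteq> 0" "cmod t < r"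
  shows "cmod ((g (z + axis i t) - g z) / t - pd i g z) \<le> 2 * M / r\<^sup>2 * cmod t"
proof -
  define \<phi> where "\<phi> = (\<lambda>t. g (z + t *s axis i 1))"
  have ax: "norm (t *s axis i 1 :: complex^'n) = cmod t" for t
    by (simp add: axis_smult[symmetric] norm_axis_complex)
  have mem: "z + t *s axis i 1 \<in> cball z (2 * r)" if "cmod t \<le> 2 * r" for t
    using that by (simp add: dist_norm ax)
  have der: "(\<phi> has_field_derivative pd i g (z + t *s axis i 1)) (at t)" if "cmod t \<le> 2 * r" for t
    using holo_at_line[OF holo[OF mem[OF that]]] by (simp add: \<phi>_def axis_def mult_delta_left)
  have hol: "\<phi> holomorphic_on ball 0 (2 * r)"
    by (rule holomorphic_onI) (auto simp: field_differentiable_def intro!: exI has_field_derivative_at_within[OF der])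
  have cont: "continuous_on (cball 0 (2 * r)) \<phi>"
    by (rule continuous_at_imp_continuous_on) (auto intro!: DERIV_isCont[OF der])
  have "cmod (\<phi> t - (\<Sum>i\<le>1. (deriv ^^ i) \<phi> 0 * (t - 0) ^ i / fact i)) \<le> 2 * M / r\<^sup>2 * cmod (t - 0) ^ Suc 1 / fact 1"
  proof (rule complex_Taylor[where f = "\<lambda>i. (deriv ^^ i) \<phi>" and S = "ball 0 r" and n = 1 and B = "2 * M / r\<^sup>2", simplified funpow_0])
    fix k :: nat and x :: complex assume x: "x \<in> ball 0 r"
    have "(deriv ^^ k) \<phi> holomorphic_on ball 0 (2 * r)"
      by (rule holomorphic_higher_deriv[OF hol]) simp
    then have "((deriv ^^ k) \<phi> has_field_derivative deriv ((deriv ^^ k) \<phi>) x) (at x)"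
      by (rule holomorphic_derivI) (use x r in auto)
    then show "((deriv ^^ k) \<phi> has_field_derivative (deriv ^^ Suc k) \<phi> x) (at x within ball 0 r)"
      by (simp add: has_field_derivative_at_within)
  next
    fix x :: complex assume x: "x \<in> ball 0 r"
    have sub: "cball x r \<subseteq> cball 0 (2 * r)"
    proof
      fix y assume "y \<in> cball x r"
      then show "y \<in> cball 0 (2 * r)" using x norm_triangle_sub[of y x] by (simp add: dist_norm norm_minus_commute)
    qed
    have "cmod ((deriv ^^ 2) \<phi> x) \<le> fact 2 * M / r ^ 2"
    proof (rule Cauchy_inequality)
      show "\<phi> holomorphic_on ball x r"
      proof (rule holomorphic_on_subset[OF hol])
        show "ball x r \<subseteq> ball 0 (2 * r)"
        proof
          fix y assume "y \<in> ball x r"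
          then show "y \<in> ball 0 (2 * r)" using x norm_triangle_sub[of y x] by (simp add: dist_norm norm_minus_commute)
        qed
      qed
      show "continuous_on (cball x r) \<phi>" by (rule continuous_on_subset[OF cont sub])
      show "cmod (\<phi> y) \<le> M" if "cmod (x - y) = r" for y
      proof -
        have "y \<in> cball 0 (2 * r)" by (rule subsetD[OF sub]) (use that in \<open>simp add: dist_norm\<close>)
        then show ?thesis unfolding \<phi>_def using bound[OF mem] by simp
      qed
    qed (rule r)
    then show "cmod ((deriv ^^ Suc 1) \<phi> x) \<le> 2 * M / r\<^sup>2" by (simp add: numeral_2_eq_2)
  qed (use t r in auto)
  moreover have "deriv \<phi> 0 = pd i g z" using DERIV_imp_deriv[OF der[of 0]] r by simp
  moreover have "\<phi> t = g (z + axis i t)" by (simp add: \<phi>_def axis_smult[symmetric])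
  moreover have "\<phi> 0 = g z" by (simp add: \<phi>_def)
  ultimately have *: "cmod (g (z + axis i t) - (g z + pd i g z * t)) \<le> 2 * M / r\<^sup>2 * (cmod t * cmod t)"
    by (simp add: power2_eq_square)
  have "(g (z + axis i t) - g z) / t - pd i g z = (g (z + axis i t) - (g z + pd i g z * t)) / t"
    using t by (simp add: field_simps)
  then have "cmod ((g (z + axis i t) - g z) / t - pd i g z) = cmod (g (z + axis i t) - (g z + pd i g z * t)) / cmod t"
    by (simp add: norm_divide)
  also have "\<dots> \<le> 2 * M / r\<^sup>2 * (cmod t * cmod t) / cmod t"
    by (rule divide_right_mono[OF *]) simp
  finally show ?thesis using t by simp
qed

lemma holo_on_continuous: "holo_on g U \<Longrightarrow> continuous_on U g"
  by (auto simp: holo_on_iff intro!: continuous_at_imp_continuous_on holo_at_continuous)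

text \<open>
  The approximating functions \<open>h n\<close> are difference quotients. Being holomorphic and
  converging uniformly, they show that a partial derivative is holomorphic; since \<open>pd j (h
  n)\<close> is in turn a difference quotient of \<open>pd j g\<close>, they also show that partial
  derivatives commute.
\<close>

lemma pd_limit:
  fixes g :: "complex^'n::finite \<Rightarrow> complex"
  assumes g: "holo_on g U" and z: "z \<in> U"
  shows "\<exists>V h. open V \<and> z \<in> V \<and> (\<forall>n. holo_on (h n) V) \<and>
    uniform_limit V h (pd i g) sequentially \<and>
    ((\<forall>k. holo_on (pd k g) U) \<longrightarrow> (\<forall>j. \<forall>y\<in>V. (\<lambda>n. pd j (h n) y) \<longlonglongrightarrow> pd i (pd j g) y))"
proof -
  obtain R where R: "R > 0" "cball z R \<subseteq> U" using g z open_contains_cball by (metis holo_on_iff)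
  define r where "r = R / 3"
  have r: "r > 0" using R by (simp add: r_def)
  have sub: "cball y (2 * r) \<subseteq> cball z R" if "y \<in> ball z r" for y
  proof
    fix w assume "w \<in> cball y (2 * r)"
    then show "w \<in> cball z R" using that dist_triangle[of z w y] by (simp add: r_def field_simps)
  qed
  have "compact (g ` cball z R)"
    by (rule compact_continuous_image[OF continuous_on_subset[OF holo_on_continuous[OF g] R(2)]]) simp
  then obtain M where M: "\<And>y. y \<in> cball z R \<Longrightarrow> cmod (g y) \<le> M"
    using compact_imp_bounded bounded_iff by (metis (no_types, lifting) imageI)
  \<comment> \<open>The shift by 2 keeps every step strictly below \<open>r\<close>.\<close>
  define t where "t = (\<lambda>n. complex_of_real (r / real (n + 2)))"
  have t: "t n \<noteq> 0" "cmod (t n) < r" for n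
    using r by (auto simp: t_def norm_divide field_simps intro!: add_pos_nonneg simp flip: of_real_divide)
  have "(\<lambda>n. r / real (n + 2)) \<longlonglongrightarrow> 0"
    using LIMSEQ_ignore_initial_segment[OF tendsto_divide_0[OF tendsto_const filterlim_real_sequentially[THEN filterlim_at_top_imp_at_infinity]], of r 2] .
  from tendsto_of_real[OF this] have t0: "t \<longlonglongrightarrow> 0" unfolding t_def by (simp only: of_real_0)
  define h where "h n y = (g (y + axis i (t n)) - g y) / t n" for n y
  have mem: "y + axis i (t n) \<in> cball z R" if "y \<in> ball z r" for n y
    by (rule subsetD[OF sub[OF that]]) (use t(2)[of n] r in \<open>simp add: dist_norm norm_axis_complex\<close>)
  have mem': "y \<in> cball z R" if "y \<in> ball z r" for y
    by (rule subsetD[OF sub[OF that]]) (use r in simp)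
  have ho: "holo_at g y" if "y \<in> cball z R" for y
    using g R that by (auto simp: holo_on_iff)
  have hh: "holo_at (\<lambda>y. g (y + axis i (t n)) - g y) y" if "y \<in> ball z r" for n y
    by (intro holo_at_diff holo_at_translate ho mem mem' that)
  have "uniform_limit (ball z r) h (pd i g) sequentially"
  proof (rule uniform_limit_null_bound)
    show "cmod (h n y - pd i g y) \<le> 2 * M / r\<^sup>2 * cmod (t n)" if "y \<in> ball z r" for n y
      unfolding h_def
      by (rule difference_quotient_estimate) (use sub[OF that] ho M r t in auto)
    have "(\<lambda>n. 2 * M / r\<^sup>2 * cmod (t n)) \<longlonglongrightarrow> 2 * M / r\<^sup>2 * cmod 0" by (intro tendsto_intros t0)
    then show "(\<lambda>n. 2 * M / r\<^sup>2 * cmod (t n)) \<longlonglongrightarrow> 0" by simp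
  qed
  moreover have "holo_on (h n) (ball z r)" for n
    unfolding holo_on_iff h_def using hh t by (auto intro!: holo_at_divide)
  moreover have "(\<lambda>n. pd j (h n) y) \<longlonglongrightarrow> pd i (pd j g) y"
    if y: "y \<in> ball z r" and pdg: "\<And>k. holo_on (pd k g) U" for j y
  proof -
    have eq: "pd j (h n) y = (pd j g (y + axis i (t n)) - pd j g y) / t n" for n
      unfolding h_def using t(1)[of n] hh[OF y] ho[OF mem[OF y]] ho[OF mem'[OF y]]
      by (subst pd_divide) (auto simp: pd_diff holo_at_translate power2_eq_square)
    have "holo_at (pd j g) (y + 0 *s axis i 1)"
      using pdg[of j] R(2) mem'[OF y] by (auto simp: holo_on_iff)
    from holo_at_line[OF this]
    have "((\<lambda>t. pd j g (y + t *s axis i 1)) has_field_derivative pd i (pd j g) y) (at 0)"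
      by (simp add: axis_def mult_delta_left)
    then have lim: "((\<lambda>s. (pd j g (y + axis i s) - pd j g y) / s) \<longlongrightarrow> pd i (pd j g) y) (at 0)"
      by (simp add: DERIV_def axis_smult[symmetric] axis_eq_0_iff[THEN iffD2, OF refl])
    have "filterlim t (at 0) sequentially" using t t0 by (simp add: filterlim_at)
    from filterlim_compose[OF lim this] show ?thesis by (simp add: eq)
  qed
  ultimately show ?thesis using r by (intro exI[of _ "ball z r"] exI[of _ h]) auto
qed

lemma holo_on_pd:
  fixes g :: "complex^'n::finite \<Rightarrow> complex"
  assumes g: "holo_on g U"
  shows "holo_on (pd i g) U"
proof -
  have "holo_at (pd i g) z" if z: "z \<in> U" for z
  proof -
    obtain V h where V: "open V" "z \<in> V" "\<And>n. holo_on (h n) V" "uniform_limit V h (pd i g) sequentially"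
      using pd_limit[OF g z, of i] by auto
    from holo_uniform_limit(1)[OF V(1,3,4)] V(2) show ?thesis by (simp add: holo_on_iff)
  qed
  then show ?thesis using g by (simp add: holo_on_iff)
qed

lemma pd_commute:
  fixes g :: "complex^'n::finite \<Rightarrow> complex"
  assumes g: "holo_on g U" and z: "z \<in> U"
  shows "pd j (pd i g) z = pd i (pd j g) z"
proof -
  obtain V h where V: "open V" "z \<in> V" "\<And>n. holo_on (h n) V" "uniform_limit V h (pd i g) sequentially"
    "(\<forall>k. holo_on (pd k g) U) \<longrightarrow> (\<forall>j. \<forall>y\<in>V. (\<lambda>n. pd j (h n) y) \<longlonglongrightarrow> pd i (pd j g) y)"
    using pd_limit[OF g z, of i] by auto
  have "(\<lambda>n. pd j (h n) z) \<longlonglongrightarrow> pd i (pd j g) z" using V(2,5) holo_on_pd[OF g] by blast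
  then show ?thesis
    by (rule LIMSEQ_unique[OF holo_uniform_limit(2)[OF V(1,3,4,2)]])
qed

section \<open>Differential equations along rays\<close>

lemma holo_at_real_line:
  assumes "holo_at h (z + t *\<^sub>R v)"
  shows "((\<lambda>t. h (z + t *\<^sub>R v)) has_vector_derivative (\<Sum>i\<in>UNIV. v$i * pd i h (z + t *\<^sub>R v))) (at t within S)"
proof -
  have "((\<lambda>t. z + t *\<^sub>R v) has_derivative (\<lambda>t. t *\<^sub>R v)) (at t)"
    by (auto intro!: derivative_eq_intros)
  from diff_chain_at[OF this holo_at_has_derivative[OF assms]]
  have "((\<lambda>t. h (z + t *\<^sub>R v)) has_derivative (\<lambda>s. \<Sum>i\<in>UNIV. (s *\<^sub>R v)$i * pd i h (z + t *\<^sub>R v))) (at t)"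
    by (simp add: o_def)
  moreover have "(\<lambda>s. \<Sum>i\<in>UNIV. (s *\<^sub>R v)$i * pd i h (z + t *\<^sub>R v))
      = (\<lambda>s. s *\<^sub>R (\<Sum>i\<in>UNIV. v$i * pd i h (z + t *\<^sub>R v)))"
    by (simp add: fun_eq_iff scaleR_sum_right)
  ultimately have "((\<lambda>t. h (z + t *\<^sub>R v)) has_derivative (\<lambda>s. s *\<^sub>R (\<Sum>i\<in>UNIV. v$i * pd i h (z + t *\<^sub>R v)))) (at t)"
    by simp
  then show ?thesis unfolding has_vector_derivative_def by (rule has_derivative_at_withinI)
qed

definition radial_mean :: "complex^'n::finite \<Rightarrow> (complex^'n \<Rightarrow> complex) \<Rightarrow> complex^'n \<Rightarrow> complex" where
  "radial_mean z0 h z = integral {0..1} (\<lambda>t. h (z0 + t *\<^sub>R (z - z0)))"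

lemma segment_in_ball:
  fixes z0 :: "'a::real_normed_vector"
  assumes "z \<in> ball z0 \<rho>" "t \<in> {0..1}"
  shows "z0 + t *\<^sub>R (z - z0) \<in> ball z0 \<rho>"
proof -
  have "t * norm (z - z0) \<le> 1 * norm (z - z0)" using assms by (intro mult_right_mono) auto
  then show ?thesis using assms by (simp add: dist_norm norm_minus_commute)
qed

lemma continuous_on_segment:
  fixes z0 :: "complex^'n::finite"
  assumes "continuous_on (ball z0 \<rho>) h" "z \<in> ball z0 \<rho>"
  shows "continuous_on {0..1} (\<lambda>t. h (z0 + t *\<^sub>R (z - z0)))"
  by (rule continuous_on_compose2[OF assms(1)]) (auto intro!: continuous_intros segment_in_ball[OF assms(2)] simp del: mem_ball)

lemma radial_mean_bound:
  assumes "continuous_on (ball z0 \<rho>) h" "z \<in> ball z0 \<rho>" "\<And>y. y \<in> ball z0 \<rho> \<Longrightarrow> cmod (h y) \<le> M"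
  shows "cmod (radial_mean z0 h z) \<le> M"
  unfolding radial_mean_def
  using integral_bound[OF zero_le_one continuous_on_segment[OF assms(1,2)], of M]
    assms(3)[OF segment_in_ball[OF assms(2)]] by simp

lemma radial_mean_diff:
  assumes "continuous_on (ball z0 \<rho>) h" "continuous_on (ball z0 \<rho>) h'" "z \<in> ball z0 \<rho>"
  shows "radial_mean z0 (\<lambda>y. h y - h' y) z = radial_mean z0 h z - radial_mean z0 h' z"
  unfolding radial_mean_def
  by (rule integral_diff; rule integrable_continuous_interval; rule continuous_on_segment[OF _ assms(3)]; fact)

lemma radial_mean_has_derivative:
  fixes z0 :: "complex^'n::finite"
  assumes h: "holo_on h (ball z0 \<rho>)" and z: "z \<in> ball z0 \<rho>"
  shows "holo_at (radial_mean z0 h) z"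
    and "pd i (radial_mean z0 h) z = integral {0..1} (\<lambda>t. t * pd i h (z0 + t *\<^sub>R (z - z0)))"
proof -
  define D where "D x t v = (\<Sum>i\<in>UNIV. v$i * (complex_of_real t * pd i h (z0 + t *\<^sub>R (x - z0))))" for x t and v :: "complex^'n"
  have der: "((\<lambda>x. h (z0 + t *\<^sub>R (x - z0))) has_derivative D x t) (at x)" if "x \<in> ball z0 \<rho>" "t \<in> {0..1}" for x t
  proof -
    have "((\<lambda>x. z0 + t *\<^sub>R (x - z0)) has_derivative (\<lambda>v. t *\<^sub>R v)) (at x)"
      by (auto intro!: derivative_eq_intros)
    moreover have "holo_at h (z0 + t *\<^sub>R (x - z0))"
      using h segment_in_ball[OF that] by (simp add: holo_on_iff del: mem_ball)
    ultimately have "((\<lambda>x. h (z0 + t *\<^sub>R (x - z0))) has_derivative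
        (\<lambda>v. \<Sum>i\<in>UNIV. (t *\<^sub>R v)$i * pd i h (z0 + t *\<^sub>R (x - z0)))) (at x)"
      using diff_chain_at[OF _ holo_at_has_derivative] by (force simp: o_def)
    moreover have "(\<lambda>v. \<Sum>i\<in>UNIV. (t *\<^sub>R v)$i * pd i h (z0 + t *\<^sub>R (x - z0))) = D x t"
      by (simp add: fun_eq_iff D_def scaleR_conv_of_real[where 'a = complex] mult_ac)
    ultimately show ?thesis by simp
  qed
  define F where "F x t = Blinfun (D x t)" for x t
  have F: "blinfun_apply (F x t) = D x t" for x t
  proof -
    have "bounded_linear (D x t)" unfolding D_def
      by (intro bounded_linear_sum bounded_linear_mult_const[OF bounded_linear_vec_nth])
    then show ?thesis by (simp add: F_def bounded_linear_Blinfun_apply)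
  qed
  have cpd: "continuous_on (ball z0 \<rho>) (pd i h)" for i
    by (rule holo_on_continuous[OF holo_on_pd[OF h]])
  have contF: "continuous_on (ball z0 \<rho> \<times> cbox 0 1) (\<lambda>(x, t). F x t)"
  proof (rule continuous_on_blinfun_componentwise)
    fix b :: "complex^'n"
    have "continuous_on (ball z0 \<rho> \<times> {0..1}) (\<lambda>y. pd i h (z0 + snd y *\<^sub>R (fst y - z0)))" for i
      by (rule continuous_on_compose2[OF cpd]) (auto intro!: continuous_intros segment_in_ball simp del: mem_ball)
    then show "continuous_on (ball z0 \<rho> \<times> cbox 0 1) (\<lambda>x. blinfun_apply (case x of (x, t) \<Rightarrow> F x t) b)"
      by (auto simp: case_prod_unfold F D_def intro!: continuous_intros)
  qed
  have intF: "F z integrable_on {0..1}"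
  proof (rule integrable_continuous_interval)
    have "continuous_on {0..1} (\<lambda>t. case (z, t) of (x, t) \<Rightarrow> F x t)"
      by (rule continuous_on_compose2[OF contF]) (use z in \<open>auto intro!: continuous_on_Pair continuous_on_const continuous_on_id\<close>)
    then show "continuous_on {0..1} (F z)" by simp
  qed
  have "((\<lambda>x. integral (cbox 0 1) (\<lambda>t. h (z0 + t *\<^sub>R (x - z0)))) has_derivative integral (cbox 0 1) (F z)) (at z within ball z0 \<rho>)"
  proof (rule leibniz_rule)
    show "((\<lambda>x. h (z0 + t *\<^sub>R (x - z0))) has_derivative blinfun_apply (F x t)) (at x within ball z0 \<rho>)"
      if "x \<in> ball z0 \<rho>" "t \<in> cbox 0 1" for x t
      using has_derivative_at_withinI[OF der] that by (simp add: F)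
    show "(\<lambda>t. h (z0 + t *\<^sub>R (x - z0))) integrable_on cbox 0 1" if "x \<in> ball z0 \<rho>" for x
      using integrable_continuous_interval[OF continuous_on_segment[OF holo_on_continuous[OF h] that]] by simp
  qed (use contF z in auto)
  then have 1: "(radial_mean z0 h has_derivative blinfun_apply (integral {0..1} (F z))) (at z)"
    using z by (simp add: radial_mean_def[abs_def] at_within_open[OF _ open_ball])
  have int_pd: "(\<lambda>t. complex_of_real t * pd i h (z0 + t *\<^sub>R (z - z0))) integrable_on {0..1}" for i
    by (intro integrable_continuous_interval continuous_intros continuous_on_segment[OF cpd z])
  have "blinfun_apply (integral {0..1} (F z)) v
      = (\<Sum>i\<in>UNIV. v$i * integral {0..1} (\<lambda>t. complex_of_real t * pd i h (z0 + t *\<^sub>R (z - z0))))" for v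
  proof -
    have "blinfun_apply (integral {0..1} (F z)) v = integral {0..1} (\<lambda>t. D z t v)"
      by (simp add: blinfun_apply_integral[OF intF] F)
    also have "\<dots> = (\<Sum>i\<in>UNIV. integral {0..1} (\<lambda>t. v$i * (complex_of_real t * pd i h (z0 + t *\<^sub>R (z - z0)))))"
      unfolding D_def by (rule integral_sum) (auto intro!: integrable_on_mult_right int_pd)
    finally show ?thesis by simp
  qed
  then have "(radial_mean z0 h has_derivative
      (\<lambda>v. \<Sum>i\<in>UNIV. v$i * integral {0..1} (\<lambda>t. complex_of_real t * pd i h (z0 + t *\<^sub>R (z - z0))))) (at z)"
    using 1 by presburger
  from holo_atI[OF this] show "holo_at (radial_mean z0 h) z"
    "pd i (radial_mean z0 h) z = integral {0..1} (\<lambda>t. t * pd i h (z0 + t *\<^sub>R (z - z0)))" by auto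
qed

text \<open>
  This is the integral over the ray of the derivative of \<open>t * h (z0 + t *\<^sub>R (z -
  z0))\<close>. It makes the radial mean a right inverse of the operator \<open>g + (\<Sum>b. (z -
  z0)\<^sub>b * \<partial>\<^sub>b g)\<close>, so that differential equations in radial direction
  become fixed point equations.
\<close>

lemma radial_mean_Euler:
  fixes z0 :: "complex^'n::finite"
  assumes h: "holo_on h (ball z0 \<rho>)" and z: "z \<in> ball z0 \<rho>"
  shows "radial_mean z0 h z + (\<Sum>i\<in>UNIV. (z - z0)$i * pd i (radial_mean z0 h) z) = h z"
proof -
  let ?p = "\<lambda>t. z0 + t *\<^sub>R (z - z0)"
  have hs: "holo_at h (?p t)" if "t \<in> {0..1}" for t
    using h segment_in_ball[OF z that] by (simp add: holo_on_iff del: mem_ball)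
  have "((\<lambda>t. h (?p t) + complex_of_real t * (\<Sum>i\<in>UNIV. (z - z0)$i * pd i h (?p t))) has_integral
      (complex_of_real 1 * h (?p 1) - complex_of_real 0 * h (?p 0))) {0..1}"
  proof (rule fundamental_theorem_of_calculus)
    fix t :: real assume t: "t \<in> {0..1}"
    have 1: "((\<lambda>t. complex_of_real t) has_vector_derivative 1) (at t within {0..1})"
      by (auto intro!: derivative_eq_intros)
    show "((\<lambda>t. complex_of_real t * h (?p t)) has_vector_derivative
       h (?p t) + complex_of_real t * (\<Sum>i\<in>UNIV. (z - z0)$i * pd i h (?p t))) (at t within {0..1})"
      using has_vector_derivative_mult[OF 1 holo_at_real_line[OF hs[OF t]]] by (simp add: add.commute)
  qed simp
  then have tot: "integral {0..1} (\<lambda>t. h (?p t) + complex_of_real t * (\<Sum>i\<in>UNIV. (z - z0)$i * pd i h (?p t))) = h z"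
    by (simp add: integral_unique)
  have cpd: "continuous_on (ball z0 \<rho>) (pd i h)" for i
    by (rule holo_on_continuous[OF holo_on_pd[OF h]])
  have i1: "(\<lambda>t. h (?p t)) integrable_on {0..1}"
    by (rule integrable_continuous_interval[OF continuous_on_segment[OF holo_on_continuous[OF h] z]])
  have i2: "(\<lambda>t. complex_of_real t * pd i h (?p t)) integrable_on {0..1}" for i
    by (intro integrable_continuous_interval continuous_intros continuous_on_segment[OF cpd z])
  have i3: "(\<lambda>t. c * (complex_of_real t * pd i h (?p t))) integrable_on {0..1}" for i c
    by (rule integrable_on_mult_right[OF i2])
  have "integral {0..1} (\<lambda>t. h (?p t) + (\<Sum>i\<in>UNIV. (z - z0)$i * (complex_of_real t * pd i h (?p t))))
     = radial_mean z0 h z + (\<Sum>i\<in>UNIV. (z - z0)$i * pd i (radial_mean z0 h) z)"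
  proof -
    have "integral {0..1} (\<lambda>t. h (?p t) + (\<Sum>i\<in>UNIV. (z - z0)$i * (complex_of_real t * pd i h (?p t))))
      = integral {0..1} (\<lambda>t. h (?p t)) + integral {0..1} (\<lambda>t. \<Sum>i\<in>UNIV. (z - z0)$i * (complex_of_real t * pd i h (?p t)))"
      by (rule integral_add[OF i1 integrable_sum]) (auto intro: i3)
    also have "integral {0..1} (\<lambda>t. \<Sum>i\<in>UNIV. (z - z0)$i * (complex_of_real t * pd i h (?p t)))
      = (\<Sum>i\<in>UNIV. (z - z0)$i * pd i (radial_mean z0 h) z)"
      by (subst integral_sum) (auto intro: i3 simp: radial_mean_has_derivative(2)[OF h z] simp del: vector_minus_component)
    finally show ?thesis by (simp add: radial_mean_def)
  qed
  with tot show ?thesis by (simp add: sum_distrib_left mult_ac)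
qed


lemma norm_vec_le_sum: "norm (x :: complex^'n::finite) \<le> (\<Sum>i\<in>UNIV. cmod (x $ i))"
  unfolding norm_vec_def by (rule L2_set_le_sum) simp

lemma holo_bounded_Lipschitz:
  fixes K :: "complex^'m::finite \<Rightarrow> complex"
  assumes K: "holo_on K V" and V: "cball w0 (2 * s) \<subseteq> V" and s: "s > 0"
    and M: "\<And>w. w \<in> cball w0 (2 * s) \<Longrightarrow> cmod (K w) \<le> M"
    and w: "w \<in> cball w0 s" "w' \<in> cball w0 s"
  shows "cmod (K w - K w') \<le> M / s * norm (w - w')"
proof (rule differentiable_bound[where S = "cball w0 s"])
  fix x assume x: "x \<in> cball w0 s"
  have sub: "cball x s \<subseteq> cball w0 (2 * s)"
  proof
    fix y assume "y \<in> cball x s"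
    then show "y \<in> cball w0 (2 * s)" using x dist_triangle[of w0 y x] by simp
  qed
  have ho: "holo_at K y" if "y \<in> cball x s" for y
    using K subsetD[OF V subsetD[OF sub that]] by (simp add: holo_on_iff)
  show "(K has_derivative (\<lambda>v. \<Sum>i\<in>UNIV. v$i * pd i K x)) (at x within cball w0 s)"
    by (rule has_derivative_at_withinI, rule holo_at_has_derivative, rule ho) (use s in simp)
  have "M \<ge> 0" using order_trans[OF norm_ge_zero M[of w0]] s by simp
  then show "onorm (\<lambda>v. \<Sum>i\<in>UNIV. v$i * pd i K x) \<le> M / s"
    using s by (intro onorm_bound directional_Cauchy_estimate[OF ho M[OF subsetD[OF sub]]]) auto
qed (use w in auto)

lemma holo_family_bounded:
  fixes h :: "'i::finite \<Rightarrow> 'k::finite \<Rightarrow> complex^'n::finite \<Rightarrow> complex"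
  assumes "\<And>i k. holo_on (h i k) U" "cball z r \<subseteq> U"
  obtains M where "M > 0" "\<And>i k y. y \<in> cball z r \<Longrightarrow> cmod (h i k y) \<le> M"
proof -
  have "\<exists>M. \<forall>y\<in>cball z r. cmod (h i k y) \<le> M" for i k
  proof -
    have "compact (h i k ` cball z r)"
      by (rule compact_continuous_image[OF continuous_on_subset[OF holo_on_continuous[OF assms(1)] assms(2)]]) simp
    then show ?thesis using compact_imp_bounded bounded_iff by (metis (no_types, lifting) imageI)
  qed
  then obtain M where M: "\<And>i k y. y \<in> cball z r \<Longrightarrow> cmod (h i k y) \<le> M i k" by metis
  define N where "N = 1 + (\<Sum>i\<in>UNIV. \<Sum>k\<in>UNIV. \<bar>M i k\<bar>)"
  have "cmod (h i k y) \<le> N" if "y \<in> cball z r" for i k y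
  proof -
    have "\<bar>M i k\<bar> \<le> (\<Sum>k\<in>UNIV. \<bar>M i k\<bar>)" by (rule member_le_sum) auto
    also have "\<dots> \<le> (\<Sum>i\<in>UNIV. \<Sum>k\<in>UNIV. \<bar>M i k\<bar>)"
      by (rule member_le_sum) (auto intro: sum_nonneg)
    finally show ?thesis using M[OF that, of i k] by (simp add: N_def)
  qed
  moreover have "N > 0" unfolding N_def by (intro add_pos_nonneg sum_nonneg) auto
  ultimately show ?thesis using that by blast
qed

text \<open>
  Restricted to a ray \<open>z0 + t *\<^sub>R v\<close>, the equation is the ordinary differential
  equation \<open>dw/dt = K(w) \<theta>(v)\<close> with \<open>w = w0\<close> at \<open>t =
  0\<close>. By Euler's identity for radial means it is implied by the fixed point equation \<open>w
  = w0 + (\<Sum>b. (z - z0)\<^sub>b * R\<^sub>b)\<close>, where \<open>R\<^sub>b\<close> is the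
  radial mean of the \<open>b\<close>-th component of \<open>K(w) \<theta>\<close>. Iterating on
  functions of the end point \<open>z\<close>, rather than on each ray, keeps all iterates
  holomorphic on one ball, and the limit is holomorphic because the convergence is uniform.
\<close>

lemma radial_Picard:
  fixes K :: "'m::finite \<Rightarrow> 'j::finite \<Rightarrow> complex^'m \<Rightarrow> complex"
    and \<theta> :: "'j \<Rightarrow> 'n::finite \<Rightarrow> complex^'n \<Rightarrow> complex"
  assumes K: "\<And>i j. holo_on (K i j) V" and w0: "w0 \<in> V"
    and \<theta>: "\<And>j b. holo_on (\<theta> j b) U" and z0: "z0 \<in> U"
  shows "\<exists>\<rho>>0. \<exists>w. ball z0 \<rho> \<subseteq> U \<and> w z0 = w0 \<and> (\<forall>z\<in>ball z0 \<rho>. w z \<in> V) \<and>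
    (\<forall>i. holo_on (\<lambda>z. w z $ i) (ball z0 \<rho>)) \<and>
    (\<forall>z\<in>ball z0 \<rho>. \<forall>i. (\<Sum>b\<in>UNIV. (z - z0)$b * pd b (\<lambda>z. w z $ i) z)
        = (\<Sum>b\<in>UNIV. (z - z0)$b * (\<Sum>j\<in>UNIV. K i j (w z) * \<theta> j b z)))"
proof -
  have opn: "open U" "open V" using K \<theta> by (auto simp: holo_on_iff)
  obtain r where r: "r > 0" "cball z0 r \<subseteq> U" using opn z0 open_contains_cball by blast
  obtain s' where s': "s' > 0" "cball w0 s' \<subseteq> V" using opn w0 open_contains_cball by blast
  define s where "s = s' / 2"
  have s: "s > 0" "cball w0 (2 * s) \<subseteq> V" using s' by (auto simp: s_def)
  obtain M where M: "M > 0" "\<And>j b z. z \<in> cball z0 r \<Longrightarrow> cmod (\<theta> j b z) \<le> M"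
    using holo_family_bounded[where h = \<theta> and U = U, OF \<theta> r(2)] by blast
  obtain L where L: "L > 0" "\<And>i j w. w \<in> cball w0 (2 * s) \<Longrightarrow> cmod (K i j w) \<le> L"
    using holo_family_bounded[where h = K and U = V, OF K s(2)] by blast
  \<comment> \<open>\<open>D\<close> bounds the increment of \<open>T w\<close> per unit of radius. Since
    \<open>\<rho> * D \<le> s / 2\<close>, the operator \<open>T\<close> maps into the ball of radius
    \<open>s\<close> about \<open>w0\<close>; since the Lipschitz constant of \<open>K\<close> there is its
    bound divided by \<open>s\<close>, it also halves distances.\<close>
  define D where "D = real CARD('m) * (real CARD('n) * (real CARD('j) * (L * M)))"
  have D: "D > 0" using M L by (simp add: D_def)
  define \<rho> where "\<rho> = min r (s / (2 * D))"
  have \<rho>: "\<rho> > 0" "\<rho> \<le> r" "\<rho> * D \<le> s / 2" using r s D by (auto simp: \<rho>_def min_def field_simps)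
  let ?B = "ball z0 \<rho>"
  have B: "?B \<subseteq> cball z0 r" "?B \<subseteq> U" using \<rho> r by auto
  define A where "A w i b = (\<lambda>y. \<Sum>j\<in>UNIV. K i j (w y) * \<theta> j b y)" for w i b
  define T where "T w = (\<lambda>z. \<chi> i. w0$i + (\<Sum>b\<in>UNIV. (z - z0)$b * radial_mean z0 (A w i b) z))" for w
  define adm where "adm w \<longleftrightarrow> (\<forall>i. holo_on (\<lambda>z. w z $ i) ?B) \<and> (\<forall>z\<in>?B. w z \<in> cball w0 s)" for w
  have A_holo: "holo_on (A w i b) ?B" if "adm w" for w i b
    unfolding holo_on_iff
  proof (intro conjI ballI)
    fix z assume z: "z \<in> ?B"
    have "w z \<in> V" using that z s by (force simp: adm_def)
    then have Kw: "holo_at (K i j) (w z)" for j using K by (simp add: holo_on_iff)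
    have "holo_at (\<lambda>z. w z $ m) z" for m using that z by (simp add: adm_def holo_on_iff)
    from holo_at_chain(1)[OF Kw this] have "holo_at (\<lambda>y. K i j (w y)) z" for j .
    moreover have "holo_at (\<theta> j b) z" for j using \<theta> z B(2) by (auto simp: holo_on_iff)
    ultimately show "holo_at (A w i b) z" unfolding A_def
      by (intro holo_at_sum holo_at_mult)
  qed simp
  have small: "norm ((\<chi> i. \<Sum>b\<in>UNIV. (z - z0)$b * c i b) :: complex^'m) \<le> \<rho> * (real CARD('m) * (real CARD('n) * C))"
    if "z \<in> ?B" "\<And>i b. cmod (c i b) \<le> C" for z :: "complex^'n" and c C
  proof -
    have zb: "cmod ((z - z0)$b) \<le> \<rho>" for b
      using Finite_Cartesian_Product.norm_nth_le[of "z - z0" b] that(1) by (simp add: dist_norm norm_minus_commute del: vector_minus_component)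
    have "norm ((\<chi> i. \<Sum>b\<in>UNIV. (z - z0)$b * c i b) :: complex^'m) \<le> (\<Sum>i\<in>(UNIV::'m set). cmod (\<Sum>b\<in>UNIV. (z - z0)$b * c i b))"
      by (rule order_trans[OF norm_vec_le_sum]) (simp del: vector_minus_component)
    also have "\<dots> \<le> (\<Sum>i\<in>(UNIV::'m set). \<Sum>b\<in>(UNIV::'n set). \<rho> * C)"
    proof (intro sum_mono order_trans[OF norm_sum])
      fix i b
      show "cmod ((z - z0)$b * c i b) \<le> \<rho> * C" unfolding norm_mult
        using zb[of b] that(2)[of i b] \<rho>(1) by (intro mult_mono) auto
    qed
    finally show ?thesis by (simp add: mult_ac)
  qed
  have adm_T: "adm (T w)" if w: "adm w" for w
    unfolding adm_def
  proof (intro conjI allI ballI)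
    fix i
    show "holo_on (\<lambda>z. T w z $ i) ?B" unfolding holo_on_iff T_def
      by (auto intro!: holo_at_add holo_at_sum holo_at_mult radial_mean_has_derivative(1)[OF A_holo[OF w]] simp del: mem_ball)
  next
    fix z assume z: "z \<in> ?B"
    have "cmod (radial_mean z0 (A w i b) z) \<le> real CARD('j) * (L * M)" for i b
    proof (rule radial_mean_bound[OF holo_on_continuous[OF A_holo[OF w]] z])
      fix y assume y: "y \<in> ?B"
      have "cmod (A w i b y) \<le> (\<Sum>j\<in>(UNIV::'j set). L * M)" unfolding A_def
      proof (intro order_trans[OF norm_sum] sum_mono)
        fix j
        have "w y \<in> cball w0 (2 * s)" using w y s by (force simp: adm_def)
        then show "cmod (K i j (w y) * \<theta> j b y) \<le> L * M" unfolding norm_mult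
          using L M y B by (intro mult_mono) (auto simp del: mem_ball mem_cball)
      qed
      then show "cmod (A w i b y) \<le> real CARD('j) * (L * M)" by simp
    qed
    from small[OF z this] have "norm (T w z - w0) \<le> \<rho> * D"
      unfolding T_def D_def by (simp add: minus_vec_def del: vector_minus_component)
    then show "T w z \<in> cball w0 s" using \<rho>(3) s by (simp add: dist_norm norm_minus_commute)
  qed
  have contr: "norm (T w z - T w' z) \<le> \<delta> / 2"
    if w: "adm w" "adm w'" and \<delta>: "\<And>z. z \<in> ?B \<Longrightarrow> norm (w z - w' z) \<le> \<delta>" and z: "z \<in> ?B" for w w' \<delta> z
  proof -
    have "\<delta> \<ge> 0" using \<delta>[OF z] norm_ge_zero order_trans by blast
    have "cmod (radial_mean z0 (A w i b) z - radial_mean z0 (A w' i b) z) \<le> real CARD('j) * (L * M) / s * \<delta>" for i b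
      unfolding radial_mean_diff[OF holo_on_continuous[OF A_holo[OF w(1)]] holo_on_continuous[OF A_holo[OF w(2)]] z, symmetric]
    proof (rule radial_mean_bound[OF _ z])
      show "continuous_on ?B (\<lambda>y. A w i b y - A w' i b y)"
        by (intro continuous_on_diff holo_on_continuous A_holo w)
      fix y assume y: "y \<in> ?B"
      have "cmod (A w i b y - A w' i b y) = cmod (\<Sum>j\<in>UNIV. (K i j (w y) - K i j (w' y)) * \<theta> j b y)"
        unfolding A_def by (simp add: sum_subtractf algebra_simps)
      also have "\<dots> \<le> (\<Sum>j\<in>(UNIV::'j set). (L / s * \<delta>) * M)"
      proof (intro order_trans[OF norm_sum] sum_mono)
        fix j
        have "w y \<in> cball w0 s" "w' y \<in> cball w0 s" using w y by (auto simp: adm_def simp del: mem_ball mem_cball)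
        then have "cmod (K i j (w y) - K i j (w' y)) \<le> L / s * norm (w y - w' y)"
          using holo_bounded_Lipschitz[where K = "K i j" and M = L, OF K s(2,1) L(2)] by blast
        also have "\<dots> \<le> L / s * \<delta>" using \<delta>[OF y] L s by (intro mult_left_mono) auto
        finally show "cmod ((K i j (w y) - K i j (w' y)) * \<theta> j b y) \<le> (L / s * \<delta>) * M"
          unfolding norm_mult using M y B L s \<open>\<delta> \<ge> 0\<close> by (intro mult_mono) (auto simp del: mem_ball mem_cball)
      qed
      finally show "cmod (A w i b y - A w' i b y) \<le> real CARD('j) * (L * M) / s * \<delta>" by (simp add: mult_ac)
    qed
    from small[OF z this]
    have "norm ((\<chi> i. \<Sum>b\<in>UNIV. (z - z0)$b * (radial_mean z0 (A w i b) z - radial_mean z0 (A w' i b) z)) :: complex^'m)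
       \<le> \<rho> * (real CARD('m) * (real CARD('n) * (real CARD('j) * (L * M) / s * \<delta>)))" .
    also have "\<dots> = (\<rho> * D) * \<delta> / s" by (simp add: D_def)
    also have "\<dots> \<le> (s / 2) * \<delta> / s" using \<rho>(3) s \<open>\<delta> \<ge> 0\<close> by (intro divide_right_mono mult_right_mono) auto
    also have "\<dots> = \<delta> / 2" using s by simp
    finally show ?thesis unfolding T_def
      by (simp add: minus_vec_def right_diff_distrib sum_subtractf del: vector_minus_component)
  qed
  define W where "W n = (T ^^ n) (\<lambda>_. w0)" for n
  have W_Suc: "W (Suc n) = T (W n)" for n by (simp add: W_def)
  have admW: "adm (W n)" for n
  proof (induction n)
    case 0 then show ?case using s by (simp add: W_def adm_def holo_on_iff)
  qed (simp add: W_Suc adm_T)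
  have step: "norm (W (Suc n) z - W n z) \<le> s * (1/2)^n" if "z \<in> ?B" for n z
    using that
  proof (induction n arbitrary: z)
    case 0
    have "W (Suc 0) z \<in> cball w0 s" using admW[of "Suc 0"] 0 by (simp add: adm_def del: mem_ball mem_cball)
    then show ?case by (simp add: W_def dist_norm norm_minus_commute)
  next
    case (Suc n)
    show ?case using contr[OF admW admW Suc.IH Suc.prems] by (simp add: W_Suc)
  qed
  have tail: "norm (W (n + k) z - W n z) \<le> 2 * s * (1/2)^n * (1 - (1/2)^k)" if z: "z \<in> ?B" for n k z
  proof (induction k)
    case (Suc k)
    have "norm (W (n + Suc k) z - W n z) \<le> norm (W (Suc (n + k)) z - W (n + k) z) + norm (W (n + k) z - W n z)"
      using norm_triangle_ineq[of "W (Suc (n + k)) z - W (n + k) z" "W (n + k) z - W n z"] by simp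
    also have "\<dots> \<le> s * (1/2)^(n + k) + 2 * s * (1/2)^n * (1 - (1/2)^k)"
      by (intro add_mono step z Suc.IH)
    also have "\<dots> = 2 * s * (1/2)^n * (1 - (1/2)^Suc k)" by (simp add: power_add algebra_simps)
    finally show ?case .
  qed simp
  have tail': "norm (W m z - W n z) \<le> 2 * s * (1/2)^n" if z: "z \<in> ?B" "n \<le> m" for n m z
  proof -
    have "2 * s * (1/2)^n * (1 - (1/2)^(m - n)) \<le> 2 * s * (1/2)^n * 1" using s by (intro mult_left_mono) auto
    then show ?thesis using tail[OF z(1), of n "m - n"] z(2) by simp
  qed
  have null: "(\<lambda>n. 2 * s * (1/2::real)^n) \<longlonglongrightarrow> 0"
    by (rule tendsto_mult_right_zero) (rule LIMSEQ_realpow_zero; simp)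
  have "Cauchy (\<lambda>n. W n z)" if z: "z \<in> ?B" for z
  proof (rule metric_CauchyI)
    fix e :: real assume "e > 0"
    then obtain N where N: "2 * s * (1/2)^N < e / 2"
      using order_tendstoD(2)[OF null, of "e/2"] by (auto simp: eventually_sequentially)
    have "dist (W m z) (W n z) < e" if "m \<ge> N" "n \<ge> N" for m n
      using tail'[OF z that(1)] tail'[OF z that(2)] N dist_triangle2[of "W m z" "W n z" "W N z"]
      by (simp add: dist_norm)
    then show "\<exists>N. \<forall>m\<ge>N. \<forall>n\<ge>N. dist (W m z) (W n z) < e" by blast
  qed
  define w where "w z = lim (\<lambda>n. W n z)" for z
  have lim: "(\<lambda>n. W n z) \<longlonglongrightarrow> w z" if "z \<in> ?B" for z
    using \<open>\<And>z. z \<in> ?B \<Longrightarrow> Cauchy (\<lambda>n. W n z)\<close>[OF that] by (simp add: w_def Cauchy_convergent_iff convergent_LIMSEQ_iff)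
  have close: "norm (W n z - w z) \<le> 2 * s * (1/2)^n" if z: "z \<in> ?B" for n z
  proof -
    have "(\<lambda>m. norm (W m z - W n z)) \<longlonglongrightarrow> norm (w z - W n z)" by (intro tendsto_intros lim z)
    then have "norm (w z - W n z) \<le> 2 * s * (1/2)^n"
      by (rule LIMSEQ_le_const2) (use tail'[OF z] in blast)
    then show ?thesis by (simp add: norm_minus_commute)
  qed
  have w_adm: "adm w" unfolding adm_def
  proof (intro conjI allI ballI)
    fix i
    have "uniform_limit ?B (\<lambda>n z. W n z $ i) (\<lambda>z. w z $ i) sequentially"
    proof (rule uniform_limit_null_bound[OF _ null])
      show "cmod (W n z $ i - w z $ i) \<le> 2 * s * (1/2)^n" if "z \<in> ?B" for n z
        using order_trans[OF Finite_Cartesian_Product.norm_nth_le[of "W n z - w z" i] close[OF that]] by simp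
    qed
    then show "holo_on (\<lambda>z. w z $ i) ?B"
      by (rule holo_uniform_limit(1)[rotated 2]) (use admW in \<open>auto simp: adm_def\<close>)
  next
    fix z assume z: "z \<in> ?B"
    show "w z \<in> cball w0 s"
      by (rule closed_sequentially[OF closed_cball _ lim[OF z]]) (use admW z in \<open>simp add: adm_def del: mem_ball mem_cball\<close>)
  qed
  have fixp: "w z = T w z" if z: "z \<in> ?B" for z
  proof -
    have "(\<lambda>n. norm (W (Suc n) z - T w z)) \<longlonglongrightarrow> 0"
    proof (rule Lim_null_comparison[OF _ null], rule always_eventually, rule allI)
      fix n
      have "norm (W (Suc n) z - T w z) \<le> (2 * s * (1/2)^n) / 2"
        unfolding W_Suc by (rule contr[OF admW w_adm close z])
      also have "\<dots> \<le> 2 * s * (1/2)^n" using s by simp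
      finally show "norm (norm (W (Suc n) z - T w z)) \<le> 2 * s * (1/2)^n" by simp
    qed
    then have "(\<lambda>n. W (Suc n) z) \<longlonglongrightarrow> T w z" by (simp add: tendsto_norm_zero_iff LIM_zero_iff)
    moreover have "(\<lambda>n. W (Suc n) z) \<longlonglongrightarrow> w z" by (rule LIMSEQ_Suc[OF lim[OF z]])
    ultimately show ?thesis by (rule LIMSEQ_unique[rotated])
  qed
  have ode: "(\<Sum>a\<in>UNIV. (z - z0)$a * pd a (\<lambda>z. w z $ i) z)
        = (\<Sum>b\<in>UNIV. (z - z0)$b * (\<Sum>j\<in>UNIV. K i j (w z) * \<theta> j b z))" if z: "z \<in> ?B" for z i
  proof -
    let ?R = "\<lambda>b. radial_mean z0 (A w i b)"
    have hR: "holo_at (?R b) z" for b by (rule radial_mean_has_derivative(1)[OF A_holo[OF w_adm] z])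
    have hz: "holo_at (\<lambda>z. (z - z0)$b) z" for b :: 'n by simp
    have "pd a (\<lambda>z. w z $ i) z = ?R a z + (\<Sum>b\<in>UNIV. (z - z0)$b * pd a (?R b) z)" for a
    proof -
      have "pd a (\<lambda>z. w z $ i) z = pd a (\<lambda>z. w0$i + (\<Sum>b\<in>UNIV. (z - z0)$b * ?R b z)) z"
      proof (rule holo_at_transform(2))
        show "holo_at (\<lambda>z. w0$i + (\<Sum>b\<in>UNIV. (z - z0)$b * ?R b z)) z"
          by (intro holo_at_add holo_at_sum holo_at_mult hR hz holo_at_const)
        show "\<forall>\<^sub>F y in nhds z. w0$i + (\<Sum>b\<in>UNIV. (y - z0)$b * ?R b y) = w y $ i"
          using eventually_nhds_in_open[OF open_ball z]
        proof eventually_elim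
          case (elim y)
          show ?case using arg_cong[OF fixp[OF elim], of "\<lambda>v. v$i"] by (simp add: T_def)
        qed
      qed
      also have "\<dots> = (\<Sum>b\<in>UNIV. (z - z0)$b * pd a (?R b) z + (if a = b then 1 else 0) * ?R b z)"
        using hR by (subst pd_add) (auto simp: pd_sum holo_at_sum)
      also have "\<dots> = ?R a z + (\<Sum>b\<in>UNIV. (z - z0)$b * pd a (?R b) z)"
        by (simp add: sum.distrib mult_delta_left del: vector_minus_component)
      finally show ?thesis .
    qed
    then have "(\<Sum>a\<in>UNIV. (z - z0)$a * pd a (\<lambda>z. w z $ i) z)
      = (\<Sum>a\<in>UNIV. (z - z0)$a * ?R a z) + (\<Sum>a\<in>UNIV. \<Sum>b\<in>UNIV. (z - z0)$a * ((z - z0)$b * pd a (?R b) z))"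
      by (simp add: distrib_left sum.distrib sum_distrib_left del: vector_minus_component)
    also have "(\<Sum>a\<in>UNIV. \<Sum>b\<in>UNIV. (z - z0)$a * ((z - z0)$b * pd a (?R b) z))
      = (\<Sum>b\<in>UNIV. (z - z0)$b * (\<Sum>a\<in>UNIV. (z - z0)$a * pd a (?R b) z))"
      by (subst sum.swap) (simp add: sum_distrib_left mult_ac del: vector_minus_component)
    also have "(\<Sum>b\<in>UNIV. (z - z0)$b * ?R b z) + (\<Sum>b\<in>UNIV. (z - z0)$b * (\<Sum>a\<in>UNIV. (z - z0)$a * pd a (?R b) z))
      = (\<Sum>b\<in>UNIV. (z - z0)$b * A w i b z)"
      unfolding sum.distrib[symmetric] distrib_left[symmetric] radial_mean_Euler[OF A_holo[OF w_adm] z] ..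
    finally show ?thesis by (simp add: A_def)
  qed
  have "w z0 = w0" using fixp[of z0] \<rho> by (simp add: T_def vec_eq_iff)
  then show ?thesis using \<rho>(1) B(2) w_adm ode s
    by (intro exI[of _ \<rho>] conjI exI[of _ w]) (force simp: adm_def)+
qed

section \<open>Equivalence of coframes with equal structure functions\<close>

definition pullback :: "(complex^4 \<Rightarrow> complex^4) \<Rightarrow> (complex^4 \<Rightarrow> complex^4^4) \<Rightarrow> complex^4 \<Rightarrow> complex^4^4" where
  "pullback \<Phi> \<Theta> z = (\<chi> i b. \<Sum>m\<in>UNIV. \<Theta> (\<Phi> z) $ i $ m * pd b (\<lambda>y. \<Phi> y $ m) z)"

lemma holo_at_pullback:
  assumes \<Phi>: "\<And>m. holo_on (\<lambda>y. \<Phi> y $ m) U" and z: "z \<in> U"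
    and \<Theta>: "\<And>i b. holo_at (\<lambda>w. \<Theta> w $ i $ b) (\<Phi> z)"
  shows "holo_at (\<lambda>y. pullback \<Phi> \<Theta> y $ i $ b) z"
    and "pd a (\<lambda>y. pullback \<Phi> \<Theta> y $ i $ b) z =
      (\<Sum>m\<in>UNIV. \<Sum>l\<in>UNIV. pd l (\<lambda>w. \<Theta> w $ i $ m) (\<Phi> z) * pd a (\<lambda>y. \<Phi> y $ l) z * pd b (\<lambda>y. \<Phi> y $ m) z)
      + (\<Sum>m\<in>UNIV. \<Theta> (\<Phi> z) $ i $ m * pd a (pd b (\<lambda>y. \<Phi> y $ m)) z)"
proof -
  have \<Phi>z: "holo_at (\<lambda>y. \<Phi> y $ m) z" for m using \<Phi> z by (simp add: holo_on_iff)
  have h1: "holo_at (\<lambda>y. \<Theta> (\<Phi> y) $ i $ m) z" for m by (rule holo_at_chain(1)[OF \<Theta> \<Phi>z])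
  have h2: "holo_at (pd b (\<lambda>y. \<Phi> y $ m)) z" for m using holo_on_pd[OF \<Phi>] z by (simp add: holo_on_iff)
  have h3: "holo_at (\<lambda>y. \<Theta> (\<Phi> y) $ i $ m * pd b (\<lambda>y. \<Phi> y $ m) y) z" for m
    by (rule holo_at_mult[OF h1 h2])
  have eq: "(\<lambda>y. pullback \<Phi> \<Theta> y $ i $ b) = (\<lambda>y. \<Sum>m\<in>UNIV. \<Theta> (\<Phi> y) $ i $ m * pd b (\<lambda>y. \<Phi> y $ m) y)"
    by (simp add: pullback_def)
  show "holo_at (\<lambda>y. pullback \<Phi> \<Theta> y $ i $ b) z" unfolding eq by (rule holo_at_sum) (rule h3)
  show "pd a (\<lambda>y. pullback \<Phi> \<Theta> y $ i $ b) z =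
      (\<Sum>m\<in>UNIV. \<Sum>l\<in>UNIV. pd l (\<lambda>w. \<Theta> w $ i $ m) (\<Phi> z) * pd a (\<lambda>y. \<Phi> y $ l) z * pd b (\<lambda>y. \<Phi> y $ m) z)
      + (\<Sum>m\<in>UNIV. \<Theta> (\<Phi> z) $ i $ m * pd a (pd b (\<lambda>y. \<Phi> y $ m)) z)"
    unfolding eq pd_sum[OF h3] pd_mult[OF h1 h2] holo_at_chain(2)[OF \<Theta> \<Phi>z]
    by (simp add: sum.distrib sum_distrib_right add.commute)
qed

text \<open>
  The terms with second derivatives of \<open>\<Phi>\<close> are symmetric in \<open>a\<close> and
  \<open>b\<close> and cancel.
\<close>

lemma ext_deriv_pullback:
  assumes \<Phi>: "\<And>m. holo_on (\<lambda>y. \<Phi> y $ m) U" and z: "z \<in> U"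
    and \<Theta>: "\<And>i b. holo_at (\<lambda>w. \<Theta> w $ i $ b) (\<Phi> z)"
  shows "ext_deriv (pullback \<Phi> \<Theta>) i a b z =
    (\<Sum>m\<in>UNIV. \<Sum>l\<in>UNIV. ext_deriv \<Theta> i l m (\<Phi> z) * (pd a (\<lambda>y. \<Phi> y $ l) z * pd b (\<lambda>y. \<Phi> y $ m) z))"
proof -
  have sw: "(\<Sum>m\<in>UNIV. \<Sum>l\<in>UNIV. pd l (\<lambda>w. \<Theta> w $ i $ m) (\<Phi> z) * pd b (\<lambda>y. \<Phi> y $ l) z * pd a (\<lambda>y. \<Phi> y $ m) z)
    = (\<Sum>m\<in>UNIV. \<Sum>l\<in>UNIV. pd m (\<lambda>w. \<Theta> w $ i $ l) (\<Phi> z) * pd b (\<lambda>y. \<Phi> y $ m) z * pd a (\<lambda>y. \<Phi> y $ l) z)"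
    by (rule sum.swap)
  have "ext_deriv (pullback \<Phi> \<Theta>) i a b z =
     (\<Sum>m\<in>UNIV. \<Sum>l\<in>UNIV. pd l (\<lambda>w. \<Theta> w $ i $ m) (\<Phi> z) * pd a (\<lambda>y. \<Phi> y $ l) z * pd b (\<lambda>y. \<Phi> y $ m) z)
     - (\<Sum>m\<in>UNIV. \<Sum>l\<in>UNIV. pd l (\<lambda>w. \<Theta> w $ i $ m) (\<Phi> z) * pd b (\<lambda>y. \<Phi> y $ l) z * pd a (\<lambda>y. \<Phi> y $ m) z)"
    unfolding ext_deriv_def holo_at_pullback(2)[OF \<Phi> z \<Theta>]
    by (simp add: pd_commute[OF \<Phi> z, of a b])
  then show ?thesis unfolding sw
    by (simp add: ext_deriv_def sum_subtractf[symmetric] algebra_simps)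
qed

lemma wedge_pullback:
  "wedge (pullback \<Phi> \<Theta>) j k a b z =
    (\<Sum>m\<in>UNIV. \<Sum>l\<in>UNIV. wedge \<Theta> j k l m (\<Phi> z) * (pd a (\<lambda>y. \<Phi> y $ l) z * pd b (\<lambda>y. \<Phi> y $ m) z))"
proof -
  let ?J = "\<lambda>a l. pd a (\<lambda>y. \<Phi> y $ l) z" and ?T = "\<lambda>j l. \<Theta> (\<Phi> z) $ j $ l"
  have "wedge (pullback \<Phi> \<Theta>) j k a b z =
     (\<Sum>m\<in>UNIV. ?T k m * ?J b m) * (\<Sum>l\<in>UNIV. ?T j l * ?J a l) - (\<Sum>m\<in>UNIV. ?T j m * ?J b m) * (\<Sum>l\<in>UNIV. ?T k l * ?J a l)"
    by (simp add: wedge_def pullback_def mult.commute)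
  also have "\<dots> = (\<Sum>m\<in>UNIV. \<Sum>l\<in>UNIV. wedge \<Theta> j k l m (\<Phi> z) * (?J a l * ?J b m))"
    unfolding sum_product sum_subtractf[symmetric] wedge_def
    by (intro sum.cong refl) (simp add: algebra_simps)
  finally show ?thesis .
qed

lemma structure_functions_pullback:
  assumes \<Phi>: "\<And>m. holo_on (\<lambda>y. \<Phi> y $ m) U" and z: "z \<in> U"
    and \<Theta>: "\<And>i b. holo_at (\<lambda>w. \<Theta> w $ i $ b) (\<Phi> z)"
    and T: "structure_functions_at \<Theta> (\<Phi> z) T"
  shows "structure_functions_at (pullback \<Phi> \<Theta>) z T"
  unfolding structure_functions_at_def
proof (intro allI)
  fix i a b
  let ?J = "\<lambda>a l. pd a (\<lambda>y. \<Phi> y $ l) z"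
  have "ext_deriv (pullback \<Phi> \<Theta>) i a b z =
    (\<Sum>m\<in>UNIV. \<Sum>l\<in>UNIV. \<Sum>p\<in>index_pairs. T i (fst p) (snd p) * wedge \<Theta> (fst p) (snd p) l m (\<Phi> z) * (?J a l * ?J b m))"
    unfolding ext_deriv_pullback[OF \<Phi> z \<Theta>] T[unfolded structure_functions_at_def, rule_format]
    by (simp add: sum_distrib_right case_prod_unfold)
  also have "\<dots> = (\<Sum>m\<in>UNIV. \<Sum>p\<in>index_pairs. \<Sum>l\<in>UNIV. T i (fst p) (snd p) * wedge \<Theta> (fst p) (snd p) l m (\<Phi> z) * (?J a l * ?J b m))"
    by (intro sum.cong refl sum.swap)
  also have "\<dots> = (\<Sum>p\<in>index_pairs. \<Sum>m\<in>UNIV. \<Sum>l\<in>UNIV. T i (fst p) (snd p) * wedge \<Theta> (fst p) (snd p) l m (\<Phi> z) * (?J a l * ?J b m))"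
    by (rule sum.swap)
  also have "\<dots> = (\<Sum>(j,k)\<in>index_pairs. T i j k * wedge (pullback \<Phi> \<Theta>) j k a b z)"
    by (simp add: wedge_pullback sum_distrib_left case_prod_unfold mult.assoc)
  finally show "ext_deriv (pullback \<Phi> \<Theta>) i a b z = (\<Sum>(j,k)\<in>index_pairs. T i j k * wedge (pullback \<Phi> \<Theta>) j k a b z)" .
qed

text \<open>
  Put \<open>\<eta> = P - \<theta>\<close> and let \<open>R\<close> be the radial vector field. By
  hypothesis \<open>\<eta>(R) = 0\<close>, so Cartan's formula reduces the Lie derivative of
  \<open>\<eta>\<close> along \<open>R\<close>, which is the left-hand side, to the contraction of
  \<open>d\<eta>\<close> with \<open>R\<close>. The structure equations turn that contraction into
  an expression linear in \<open>\<eta>\<close>, because \<open>P(R) = \<theta>(R)\<close>.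
\<close>

lemma radial_difference_equation:
  fixes \<theta> P :: "complex^4 \<Rightarrow> complex^4^4"
  assumes \<theta>: "\<And>i b. holo_on (\<lambda>y. \<theta> y $ i $ b) (ball z0 \<rho>)"
    and P: "\<And>i b. holo_on (\<lambda>y. P y $ i $ b) (ball z0 \<rho>)"
    and T: "\<And>z. z \<in> ball z0 \<rho> \<Longrightarrow> structure_functions_at \<theta> z T"
      "\<And>z. z \<in> ball z0 \<rho> \<Longrightarrow> structure_functions_at P z T"
    and rad: "\<And>z i. z \<in> ball z0 \<rho> \<Longrightarrow> (\<Sum>b\<in>UNIV. (z - z0)$b * P z $ i $ b) = (\<Sum>b\<in>UNIV. (z - z0)$b * \<theta> z $ i $ b)"
    and z: "z \<in> ball z0 \<rho>"
  shows "P z $ i $ b - \<theta> z $ i $ b + (\<Sum>a\<in>UNIV. (z - z0)$a * pd a (\<lambda>y. P y $ i $ b - \<theta> y $ i $ b) z)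
    = (\<Sum>(j,k)\<in>index_pairs. T i j k *
        ((\<Sum>a\<in>UNIV. (z - z0)$a * \<theta> z $ j $ a) * (P z $ k $ b - \<theta> z $ k $ b)
          - (P z $ j $ b - \<theta> z $ j $ b) * (\<Sum>a\<in>UNIV. (z - z0)$a * \<theta> z $ k $ a)))"
proof -
  define R where "R a = (z - z0)$a" for a
  have hP: "holo_at (\<lambda>y. P y $ i $ b) z" and h\<theta>: "holo_at (\<lambda>y. \<theta> y $ i $ b) z" for i b
    using P \<theta> z by (auto simp: holo_on_iff)
  let ?\<eta> = "\<lambda>i b y. P y $ i $ b - \<theta> y $ i $ b"
  have h\<eta>: "holo_at (?\<eta> i b) z" for i b by (rule holo_at_diff[OF hP h\<theta>])
  have hc: "holo_at (\<lambda>y. (y - z0)$a) z" for a by simp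
  have hm: "holo_at (\<lambda>y. (y - z0)$a * ?\<eta> i a y) z" for a by (rule holo_at_mult[OF hc h\<eta>])
  have "pd b (\<lambda>y. \<Sum>a\<in>UNIV. (y - z0)$a * ?\<eta> i a y) z = pd b (\<lambda>y. 0) z"
  proof (rule holo_at_transform(2)[OF holo_at_const])
    show "\<forall>\<^sub>F y in nhds z. 0 = (\<Sum>a\<in>UNIV. (y - z0)$a * ?\<eta> i a y)"
      using eventually_nhds_in_open[OF open_ball z]
      by eventually_elim (simp only: right_diff_distrib sum_subtractf rad cancel_comm_monoid_add_class.diff_cancel)
  qed
  also have "pd b (\<lambda>y. \<Sum>a\<in>UNIV. (y - z0)$a * ?\<eta> i a y) z
      = (\<Sum>a\<in>UNIV. R a * pd b (?\<eta> i a) z + (if b = a then 1 else 0) * ?\<eta> i a z)"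
    unfolding pd_sum[OF hm] pd_mult[OF hc h\<eta>] by (simp add: R_def)
  finally have 1: "(\<Sum>a\<in>UNIV. R a * pd b (?\<eta> i a) z) + ?\<eta> i b z = 0"
    by (simp add: sum.distrib mult_delta_left)
  have rz: "(\<Sum>a\<in>UNIV. R a * P z $ j $ a) = (\<Sum>a\<in>UNIV. R a * \<theta> z $ j $ a)" for j
    using rad[OF z, of j] by (simp add: R_def)
  have w: "(\<Sum>a\<in>UNIV. R a * wedge Q j k a b z) = (\<Sum>a\<in>UNIV. R a * Q z $ j $ a) * Q z $ k $ b - Q z $ j $ b * (\<Sum>a\<in>UNIV. R a * Q z $ k $ a)"
    for Q :: "complex^4 \<Rightarrow> complex^4^4" and j k
    by (simp add: wedge_def sum_distrib_left sum_distrib_right right_diff_distrib sum_subtractf mult_ac)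
  have ex: "(\<Sum>a\<in>UNIV. R a * ext_deriv Q i a b z) = (\<Sum>(j,k)\<in>index_pairs. T i j k * (\<Sum>a\<in>UNIV. R a * wedge Q j k a b z))"
    if "structure_functions_at Q z T" for Q
  proof -
    have "(\<Sum>a\<in>UNIV. R a * ext_deriv Q i a b z) = (\<Sum>a\<in>UNIV. \<Sum>p\<in>index_pairs. T i (fst p) (snd p) * (R a * wedge Q (fst p) (snd p) a b z))"
      unfolding that[unfolded structure_functions_at_def, rule_format]
      by (simp add: sum_distrib_left case_prod_unfold mult_ac)
    also have "\<dots> = (\<Sum>p\<in>index_pairs. \<Sum>a\<in>UNIV. T i (fst p) (snd p) * (R a * wedge Q (fst p) (snd p) a b z))"
      by (rule sum.swap)
    finally show ?thesis by (simp add: sum_distrib_left case_prod_unfold)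
  qed
  have "?\<eta> i b z + (\<Sum>a\<in>UNIV. R a * pd a (?\<eta> i b) z)
     = (\<Sum>a\<in>UNIV. R a * pd a (?\<eta> i b) z) - (\<Sum>a\<in>UNIV. R a * pd b (?\<eta> i a) z)"
    using 1 by (simp add: eq_neg_iff_add_eq_0 add.commute algebra_simps)
  also have "\<dots> = (\<Sum>a\<in>UNIV. R a * ext_deriv P i a b z) - (\<Sum>a\<in>UNIV. R a * ext_deriv \<theta> i a b z)"
    unfolding ext_deriv_def pd_diff[OF hP h\<theta>] sum_subtractf[symmetric] right_diff_distrib[symmetric]
    by (intro sum.cong refl) (simp add: algebra_simps)
  also have "\<dots> = (\<Sum>(j,k)\<in>index_pairs. T i j k *
        ((\<Sum>a\<in>UNIV. R a * \<theta> z $ j $ a) * ?\<eta> k b z - ?\<eta> j b z * (\<Sum>a\<in>UNIV. R a * \<theta> z $ k $ a)))"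
    unfolding ex[OF T(1)[OF z]] ex[OF T(2)[OF z]] w rz sum_subtractf[symmetric] case_prod_unfold
    by (intro sum.cong refl) (simp add: algebra_simps)
  finally show ?thesis by (simp add: R_def)
qed

text \<open>
  Along a ray, \<open>t * \<eta>\<close> satisfies a linear homogeneous ordinary differential
  equation and is zero at \<open>t = 0\<close>. Close to \<open>z0\<close> the coefficients are so
  small that the mean value inequality bounds the maximum of the solution by half of itself.
\<close>

lemma coframes_agree:
  fixes \<theta> P :: "complex^4 \<Rightarrow> complex^4^4"
  assumes \<theta>: "\<And>i b. holo_on (\<lambda>y. \<theta> y $ i $ b) (ball z0 \<rho>)"
    and P: "\<And>i b. holo_on (\<lambda>y. P y $ i $ b) (ball z0 \<rho>)"
    and T: "\<And>z. z \<in> ball z0 \<rho> \<Longrightarrow> structure_functions_at \<theta> z T"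
      "\<And>z. z \<in> ball z0 \<rho> \<Longrightarrow> structure_functions_at P z T"
    and rad: "\<And>z i. z \<in> ball z0 \<rho> \<Longrightarrow> (\<Sum>b\<in>UNIV. (z - z0)$b * P z $ i $ b) = (\<Sum>b\<in>UNIV. (z - z0)$b * \<theta> z $ i $ b)"
    and \<rho>: "\<rho> > 0"
  shows "\<exists>\<epsilon>>0. \<epsilon> \<le> \<rho> \<and> (\<forall>z\<in>ball z0 \<epsilon>. P z = \<theta> z)"
proof -
  have "cball z0 (\<rho>/2) \<subseteq> ball z0 \<rho>" using \<rho> by auto
  then obtain M where M: "M > 0" "\<And>i b z. z \<in> cball z0 (\<rho>/2) \<Longrightarrow> cmod (\<theta> z $ i $ b) \<le> M"
    using holo_family_bounded[where h = "\<lambda>i b y. \<theta> y $ i $ b" and U = "ball z0 \<rho>", OF \<theta>] by blast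
  define N where "N = 1 + (\<Sum>i\<in>UNIV. \<Sum>j\<in>UNIV. \<Sum>k\<in>UNIV. cmod (T i j k))"
  have NT: "cmod (T i j k) \<le> N" for i j k
  proof -
    have "cmod (T i j k) \<le> (\<Sum>k\<in>UNIV. cmod (T i j k))" by (rule member_le_sum) auto
    also have "\<dots> \<le> (\<Sum>j\<in>UNIV. \<Sum>k\<in>UNIV. cmod (T i j k))" by (rule member_le_sum[of j]) (auto intro!: sum_nonneg)
    also have "\<dots> \<le> (\<Sum>i\<in>UNIV. \<Sum>j\<in>UNIV. \<Sum>k\<in>UNIV. cmod (T i j k))" by (rule member_le_sum[of i]) (auto intro!: sum_nonneg)
    finally show ?thesis by (simp add: N_def)
  qed
  have N: "N > 0" unfolding N_def by (intro add_pos_nonneg sum_nonneg) auto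
  \<comment> \<open>Sixteen entries are estimated, each by a sum over six index pairs of two products, whose
    factor \<open>\<tau>\<close> is itself a sum of four terms: this gives \<open>16 * 6 * 2 * 4 = 16 *
    48\<close>, and the factor 2 makes the total at most one half.\<close>
  define \<epsilon> where "\<epsilon> = min (\<rho>/2) (1 / (2 * 16 * 48 * N * M))"
  have \<epsilon>: "\<epsilon> > 0" "\<epsilon> \<le> \<rho>/2" using \<rho> N M by (auto simp: \<epsilon>_def)
  have \<epsilon>2: "16 * (6 * (N * (2 * (4 * \<epsilon> * M)))) \<le> 1/2"
  proof -
    have "\<epsilon> \<le> 1 / (2 * 16 * 48 * N * M)" by (simp add: \<epsilon>_def)
    then show ?thesis using N M by (simp add: field_simps)
  qed
  have "P z = \<theta> z" if z: "z \<in> ball z0 \<epsilon>" for z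
  proof -
    define v where "v = z - z0"
    have v: "norm v < \<epsilon>" using z by (simp add: v_def dist_norm norm_minus_commute)
    define p where "p t = z0 + t *\<^sub>R v" for t
    have p: "p t \<in> ball z0 \<epsilon>" if "t \<in> {0..1}" for t
      unfolding p_def v_def by (rule segment_in_ball[OF z that])
    have p\<rho>: "p t \<in> ball z0 \<rho>" "p t \<in> cball z0 (\<rho>/2)" if "t \<in> {0..1}" for t using p[OF that] \<epsilon> by auto
    define \<eta> where "\<eta> i b = (\<lambda>y. P y $ i $ b - \<theta> y $ i $ b)" for i b
    have h\<eta>: "holo_at (\<eta> i b) y" if "y \<in> ball z0 \<rho>" for i b y
      unfolding \<eta>_def using P \<theta> that by (intro holo_at_diff) (auto simp: holo_on_iff simp del: mem_ball)
    define Y where "Y i b t = complex_of_real t * \<eta> i b (p t)" for i b t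
    define \<tau> where "\<tau> t j = (\<Sum>a\<in>UNIV. v$a * \<theta> (p t) $ j $ a)" for t j
    have \<tau>: "cmod (\<tau> t j) \<le> 4 * \<epsilon> * M" if "t \<in> {0..1}" for t j
    proof -
      have "cmod (\<tau> t j) \<le> (\<Sum>a\<in>(UNIV::4 set). \<epsilon> * M)" unfolding \<tau>_def
      proof (intro order_trans[OF norm_sum] sum_mono)
        fix a
        have "cmod (v$a) \<le> \<epsilon>" using Finite_Cartesian_Product.norm_nth_le[of v a] v by simp
        then show "cmod (v$a * \<theta> (p t) $ j $ a) \<le> \<epsilon> * M"
          unfolding norm_mult using M(2)[OF p\<rho>(2)[OF that], of j a] \<epsilon> by (intro mult_mono) auto
      qed
      then show ?thesis by simp
    qed
    define Y' where "Y' i b t = (\<Sum>(j,k)\<in>index_pairs. T i j k * (\<tau> t j * Y k b t - Y j b t * \<tau> t k))" for i b t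
    have der: "(Y i b has_vector_derivative Y' i b t) (at t within S)" if t: "t \<in> {0..1}" for i b t S
    proof -
      have 1: "((\<lambda>t. complex_of_real t) has_vector_derivative 1) (at t within S)"
        by (auto intro!: derivative_eq_intros)
      have "(Y i b has_vector_derivative complex_of_real t * (\<Sum>a\<in>UNIV. v$a * pd a (\<eta> i b) (p t)) + \<eta> i b (p t)) (at t within S)"
        using has_vector_derivative_mult[OF 1 holo_at_real_line[OF h\<eta>[OF p\<rho>(1)[OF t], unfolded p_def]]]
        unfolding Y_def p_def by simp
      moreover have "complex_of_real t * (\<Sum>a\<in>UNIV. v$a * pd a (\<eta> i b) (p t)) + \<eta> i b (p t) = Y' i b t"
      proof -
        have sc: "(p t - z0)$a = complex_of_real t * v$a" for a by (simp add: p_def scaleR_conv_of_real[where 'a = complex])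
        have "\<eta> i b (p t) + (\<Sum>a\<in>UNIV. (p t - z0)$a * pd a (\<eta> i b) (p t))
          = (\<Sum>(j,k)\<in>index_pairs. T i j k *
            ((\<Sum>a\<in>UNIV. (p t - z0)$a * \<theta> (p t) $ j $ a) * \<eta> k b (p t)
            - \<eta> j b (p t) * (\<Sum>a\<in>UNIV. (p t - z0)$a * \<theta> (p t) $ k $ a)))"
          unfolding \<eta>_def by (rule radial_difference_equation[OF \<theta> P T rad p\<rho>(1)[OF t]])
        then show ?thesis unfolding sc
          by (simp add: Y'_def Y_def \<tau>_def sum_distrib_left mult_ac add.commute)
      qed
      ultimately show ?thesis by simp
    qed
    define S where "S t = (\<Sum>i\<in>UNIV. \<Sum>b\<in>UNIV. cmod (Y i b t))" for t
    have "continuous_on {0..1} (Y i b)" for i b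
      by (rule continuous_on_vector_derivative[where f' = "Y' i b"]) (rule der)
    then have "continuous_on {0..1} S" unfolding S_def by (intro continuous_intros)
    then obtain t0 where t0: "t0 \<in> {0..1}" "\<And>t. t \<in> {0..1} \<Longrightarrow> S t \<le> S t0"
      using continuous_attains_sup[of "{0..1}" S] by auto
    have S0: "0 \<le> S t" for t unfolding S_def by (intro sum_nonneg norm_ge_zero)
    have YS: "cmod (Y i b t) \<le> S t" for i b t
    proof -
      have "cmod (Y i b t) \<le> (\<Sum>b\<in>UNIV. cmod (Y i b t))" by (rule member_le_sum) auto
      also have "\<dots> \<le> S t" unfolding S_def by (rule member_le_sum[of i]) (auto intro!: sum_nonneg)
      finally show ?thesis .
    qed
    define c where "c = 6 * (N * (2 * (4 * \<epsilon> * M) * S t0))"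
    have Y'b: "cmod (Y' i b t) \<le> c" if t: "t \<in> {0..1}" for i b t
    proof -
      have "cmod (Y' i b t) \<le> (\<Sum>p\<in>index_pairs. N * (2 * (4 * \<epsilon> * M) * S t0))"
        unfolding Y'_def case_prod_unfold
      proof (intro order_trans[OF norm_sum] sum_mono)
        fix p
        have e: "cmod (\<tau> t j * Y k b t) \<le> 4 * \<epsilon> * M * S t0" for j k
          unfolding norm_mult using \<tau>[OF t, of j] order_trans[OF YS[of k b t] t0(2)[OF t]] \<epsilon> M
          by (intro mult_mono) auto
        have "cmod (\<tau> t (fst p) * Y (snd p) b t - Y (fst p) b t * \<tau> t (snd p)) \<le> 4 * \<epsilon> * M * S t0 + 4 * \<epsilon> * M * S t0"
          by (rule order_trans[OF norm_triangle_ineq4], rule add_mono) (use e in \<open>simp_all add: mult.commute[of "Y _ _ _"]\<close>)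
        then show "cmod (T i (fst p) (snd p) * (\<tau> t (fst p) * Y (snd p) b t - Y (fst p) b t * \<tau> t (snd p))) \<le> N * (2 * (4 * \<epsilon> * M) * S t0)"
          unfolding norm_mult using NT N by (intro mult_mono) (auto simp: mult_ac)
      qed
      also have "\<dots> = c" by (simp add: c_def index_pairs_def)
      finally show ?thesis .
    qed
    have c0: "0 \<le> c" unfolding c_def using N M \<epsilon> S0 by (intro mult_nonneg_nonneg) auto
    have Yc: "cmod (Y i b t0) \<le> c" for i b
    proof -
      have "norm (Y i b t0 - Y i b 0) \<le> c * norm (t0 - 0)"
      proof (rule differentiable_bound[where S = "{0..1::real}" and f' = "\<lambda>t h. h *\<^sub>R Y' i b t"])
        show "(Y i b has_derivative (\<lambda>h. h *\<^sub>R Y' i b t)) (at t within {0..1})" if "t \<in> {0..1}" for t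
          using der[OF that] by (simp add: has_vector_derivative_def)
        show "onorm (\<lambda>h. h *\<^sub>R Y' i b t) \<le> c" if "t \<in> {0..1}" for t
        proof (rule onorm_bound[OF c0])
          fix h :: real
          show "norm (h *\<^sub>R Y' i b t) \<le> c * norm h"
            using mult_right_mono[OF Y'b[OF that, of i b], of "norm h"] by (simp add: mult.commute)
        qed
      qed (use t0 in auto)
      also have "\<dots> \<le> c * 1" using t0 c0 by (intro mult_left_mono) auto
      finally show ?thesis by (simp add: Y_def)
    qed
    have "S t0 \<le> (\<Sum>i\<in>(UNIV::4 set). \<Sum>b\<in>(UNIV::4 set). c)" unfolding S_def by (intro sum_mono Yc)
    also have "\<dots> = 16 * (6 * (N * (2 * (4 * \<epsilon> * M)))) * S t0" by (simp add: c_def)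
    also have "\<dots> \<le> 1/2 * S t0" by (rule mult_right_mono[OF \<epsilon>2 S0])
    finally have "S t0 \<le> 0" by simp
    then have "S 1 \<le> 0" using t0(2)[of 1] by simp
    then have "cmod (Y i b 1) \<le> 0" for i b using YS[of i b 1] by linarith
    then have "\<eta> i b z = 0" for i b by (simp add: Y_def p_def v_def)
    then show ?thesis by (simp add: \<eta>_def vec_eq_iff)
  qed
  then show ?thesis using \<epsilon> \<rho> by (intro exI[of _ \<epsilon>]) auto
qed

lemma holo_at_det:
  fixes A :: "complex^'m::finite \<Rightarrow> complex^'n::finite^'n"
  assumes "\<And>i j. holo_at (\<lambda>w. A w $ i $ j) w"
  shows "holo_at (\<lambda>w. det (A w)) w"
  unfolding det_def by (intro holo_at_sum holo_at_mult holo_at_const holo_at_prod assms)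

text \<open>
  For coframes with constant structure functions the graph of an equivalence is an integral manifold
  of \<open>\<theta> - \<Theta>\<close> on the product, and it can be found by integrating along
  rays: \<open>\<Phi>\<close> is determined by \<open>(\<Phi>\<^sup>* \<Theta>)(R) =
  \<theta>(R)\<close> for the radial field \<open>R\<close>. The pulled back coframe then has the
  same structure functions as \<open>\<theta>\<close> and agrees with it on \<open>R\<close>, hence
  everywhere.
\<close>

lemma coframe_equivalence:
  fixes \<theta> \<Theta> :: "complex^4 \<Rightarrow> complex^4^4"
  assumes \<theta>: "\<And>i b. holo_on (\<lambda>y. \<theta> y $ i $ b) U" and z0: "z0 \<in> U"
    and \<Theta>: "\<And>i b. holo_on (\<lambda>y. \<Theta> y $ i $ b) V" and w0: "w0 \<in> V"
    and det: "\<And>w. w \<in> V \<Longrightarrow> det (\<Theta> w) \<noteq> 0"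
    and T: "\<And>z. z \<in> U \<Longrightarrow> structure_functions_at \<theta> z T"
      "\<And>w. w \<in> V \<Longrightarrow> structure_functions_at \<Theta> w T"
  shows "\<exists>\<rho>>0. \<exists>\<Phi>. ball z0 \<rho> \<subseteq> U \<and> \<Phi> z0 = w0 \<and> (\<forall>z\<in>ball z0 \<rho>. \<Phi> z \<in> V) \<and>
    (\<forall>m. holo_on (\<lambda>z. \<Phi> z $ m) (ball z0 \<rho>)) \<and> (\<forall>z\<in>ball z0 \<rho>. pullback \<Phi> \<Theta> z = \<theta> z)"
proof -
  \<comment> \<open>Cramer's rule gives the inverse matrix of \<open>\<Theta>\<close> in a visibly
    holomorphic form.\<close>
  define K where "K i j w = det (\<chi> a b. if b = i then (axis j 1 :: complex^4) $ a else \<Theta> w $ a $ b) / det (\<Theta> w)" for i j w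
  have K: "holo_on (K i j) V" for i j
    unfolding holo_on_iff
  proof (intro conjI ballI)
    show "open V" using \<Theta> by (auto simp: holo_on_iff)
    fix w assume w: "w \<in> V"
    have e: "holo_at (\<lambda>y. \<Theta> y $ i $ b) w" for i b using \<Theta> w by (simp add: holo_on_iff)
    show "holo_at (K i j) w" unfolding K_def
    proof (rule holo_at_divide)
      show "det (\<Theta> w) \<noteq> 0" by (rule det[OF w])
      show "holo_at (\<lambda>w. det (\<chi> a b. if b = i then axis j 1 $ a else \<Theta> w $ a $ b)) w"
      proof (rule holo_at_det)
        fix a b
        show "holo_at (\<lambda>w. (\<chi> a b. if b = i then axis j 1 $ a else \<Theta> w $ a $ b) $ a $ b) w"
          by (cases "b = i") (simp_all add: e)
      qed
      show "holo_at (\<lambda>w. det (\<Theta> w)) w" by (rule holo_at_det) (rule e)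
    qed
  qed
  have inv: "(\<Sum>m\<in>UNIV. \<Theta> w $ k $ m * K m j w) = (if k = j then 1 else 0)" if "w \<in> V" for w k j
  proof -
    have "\<Theta> w *v (\<chi> m. K m j w) = axis j 1"
      unfolding cramer[OF det[OF that]] by (simp add: K_def)
    from arg_cong[OF this, of "\<lambda>x. x $ k"] show ?thesis
      by (simp add: matrix_vector_mult_def axis_def)
  qed
  obtain \<rho> \<Phi> where \<rho>: "\<rho> > 0" "ball z0 \<rho> \<subseteq> U" and \<Phi>0: "\<Phi> z0 = w0"
    and \<Phi>V: "\<And>z. z \<in> ball z0 \<rho> \<Longrightarrow> \<Phi> z \<in> V" and \<Phi>: "\<And>m. holo_on (\<lambda>z. \<Phi> z $ m) (ball z0 \<rho>)"
    and ode: "\<And>z i. z \<in> ball z0 \<rho> \<Longrightarrow> (\<Sum>b\<in>UNIV. (z - z0)$b * pd b (\<lambda>z. \<Phi> z $ i) z)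
        = (\<Sum>b\<in>UNIV. (z - z0)$b * (\<Sum>j\<in>UNIV. K i j (\<Phi> z) * \<theta> z $ j $ b))"
    using radial_Picard[where K = K and \<theta> = "\<lambda>j b y. \<theta> y $ j $ b", OF K w0 \<theta> z0] by blast
  have \<theta>B: "holo_on (\<lambda>y. \<theta> y $ i $ b) (ball z0 \<rho>)" for i b using \<theta> \<rho>(2) by (auto simp: holo_on_iff)
  have \<Theta>\<Phi>: "holo_at (\<lambda>w. \<Theta> w $ i $ b) (\<Phi> z)" if "z \<in> ball z0 \<rho>" for i b z
    using \<Theta> \<Phi>V[OF that] by (simp add: holo_on_iff)
  have PB: "holo_on (\<lambda>y. pullback \<Phi> \<Theta> y $ i $ b) (ball z0 \<rho>)" for i b
    unfolding holo_on_iff using holo_at_pullback(1)[OF \<Phi> _ \<Theta>\<Phi>] by blast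
  have TP: "structure_functions_at (pullback \<Phi> \<Theta>) z T" if "z \<in> ball z0 \<rho>" for z
    by (rule structure_functions_pullback[OF \<Phi> that \<Theta>\<Phi>[OF that] T(2)[OF \<Phi>V[OF that]]])
  have rad: "(\<Sum>b\<in>UNIV. (z - z0)$b * pullback \<Phi> \<Theta> z $ i $ b) = (\<Sum>b\<in>UNIV. (z - z0)$b * \<theta> z $ i $ b)"
    if z: "z \<in> ball z0 \<rho>" for z i
  proof -
    define R where "R b = (z - z0)$b" for b
    have "(\<Sum>b\<in>UNIV. R b * pullback \<Phi> \<Theta> z $ i $ b) = (\<Sum>b\<in>UNIV. \<Sum>m\<in>UNIV. \<Theta> (\<Phi> z) $ i $ m * (R b * pd b (\<lambda>z. \<Phi> z $ m) z))"
      by (simp add: pullback_def sum_distrib_left mult_ac)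
    also have "\<dots> = (\<Sum>m\<in>UNIV. \<Theta> (\<Phi> z) $ i $ m * (\<Sum>b\<in>UNIV. R b * pd b (\<lambda>z. \<Phi> z $ m) z))"
      by (subst sum.swap) (simp add: sum_distrib_left)
    also have "\<dots> = (\<Sum>m\<in>UNIV. \<Theta> (\<Phi> z) $ i $ m * (\<Sum>b\<in>UNIV. R b * (\<Sum>j\<in>UNIV. K m j (\<Phi> z) * \<theta> z $ j $ b)))"
      unfolding R_def ode[OF z] ..
    also have "\<dots> = (\<Sum>m\<in>UNIV. \<Sum>b\<in>UNIV. \<Sum>j\<in>UNIV. (\<Theta> (\<Phi> z) $ i $ m * K m j (\<Phi> z)) * (R b * \<theta> z $ j $ b))"
      by (simp add: sum_distrib_left mult_ac)
    also have "\<dots> = (\<Sum>b\<in>UNIV. \<Sum>m\<in>UNIV. \<Sum>j\<in>UNIV. (\<Theta> (\<Phi> z) $ i $ m * K m j (\<Phi> z)) * (R b * \<theta> z $ j $ b))"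
      by (rule sum.swap)
    also have "\<dots> = (\<Sum>b\<in>UNIV. \<Sum>j\<in>UNIV. \<Sum>m\<in>UNIV. (\<Theta> (\<Phi> z) $ i $ m * K m j (\<Phi> z)) * (R b * \<theta> z $ j $ b))"
      by (intro sum.cong refl sum.swap)
    also have "\<dots> = (\<Sum>b\<in>UNIV. \<Sum>j\<in>UNIV. (if i = j then 1 else 0) * (R b * \<theta> z $ j $ b))"
      unfolding sum_distrib_right[symmetric] inv[OF \<Phi>V[OF z]] ..
    also have "\<dots> = (\<Sum>b\<in>UNIV. R b * \<theta> z $ i $ b)" by (simp add: mult_delta_left)
    finally show ?thesis by (simp add: R_def)
  qed
  obtain \<epsilon> where \<epsilon>: "\<epsilon> > 0" "\<epsilon> \<le> \<rho>" "\<And>z. z \<in> ball z0 \<epsilon> \<Longrightarrow> pullback \<Phi> \<Theta> z = \<theta> z"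
    using coframes_agree[OF \<theta>B PB T(1) TP rad \<rho>(1)] \<rho>(2) by blast
  have sub: "ball z0 \<epsilon> \<subseteq> ball z0 \<rho>" using \<epsilon>(2) by (rule subset_ball)
  show ?thesis
    using \<epsilon> sub \<rho>(2) \<Phi>0 \<Phi>V \<Phi> by (intro exI[of _ \<epsilon>] conjI exI[of _ \<Phi>]) (auto simp: holo_on_iff simp del: mem_ball)
qed

section \<open>Structure equations of an adapted coframe\<close>

lemma vector_4 [simp]:
  "(vector [x1, x2, x3, x4] :: 'a::zero^4) $ 1 = x1" "(vector [x1, x2, x3, x4] :: 'a^4) $ 2 = x2"
  "(vector [x1, x2, x3, x4] :: 'a^4) $ 3 = x3" "(vector [x1, x2, x3, x4] :: 'a^4) $ 4 = x4"
  unfolding vector_def by simp_all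

lemma matrix_mult_nth: "((A :: complex^4^4) ** B) $ i $ j = A$i$1 * B$1$j + A$i$2 * B$2$j + A$i$3 * B$3$j + A$i$4 * B$4$j"
  by (simp add: matrix_matrix_mult_def sum_4)

lemma base_coframe_nth [simp]:
  "base_coframe f z $ 1 $ 1 = - z$3" "base_coframe f z $ 1 $ 2 = 1" "base_coframe f z $ 1 $ 3 = 0" "base_coframe f z $ 1 $ 4 = 0"
  "base_coframe f z $ 2 $ 1 = - z$4" "base_coframe f z $ 2 $ 2 = 0" "base_coframe f z $ 2 $ 3 = 1" "base_coframe f z $ 2 $ 4 = 0"
  "base_coframe f z $ 3 $ 1 = - f z" "base_coframe f z $ 3 $ 2 = 0" "base_coframe f z $ 3 $ 3 = 0" "base_coframe f z $ 3 $ 4 = 1"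
  "base_coframe f z $ 4 $ 1 = 1" "base_coframe f z $ 4 $ 2 = 0" "base_coframe f z $ 4 $ 3 = 0" "base_coframe f z $ 4 $ 4 = 0"
  by (simp_all add: base_coframe_def)

lemma total_deriv_const [simp]: "total_deriv f (\<lambda>z. c) z = 0"
  by (simp add: total_deriv_def)

context
  fixes g h f :: "complex^4 \<Rightarrow> complex" and z
  assumes g: "holo_at g z" and h: "holo_at h z"
begin

lemma total_deriv_add [simp]: "total_deriv f (\<lambda>z. g z + h z) z = total_deriv f g z + total_deriv f h z"
  using g h by (simp add: total_deriv_def algebra_simps)
lemma total_deriv_diff [simp]: "total_deriv f (\<lambda>z. g z - h z) z = total_deriv f g z - total_deriv f h z"
  using g h by (simp add: total_deriv_def algebra_simps)
lemma total_deriv_mult [simp]: "total_deriv f (\<lambda>z. g z * h z) z = g z * total_deriv f h z + total_deriv f g z * h z"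
  using g h by (simp add: total_deriv_def algebra_simps)
lemma total_deriv_divide [simp]: "h z \<noteq> 0 \<Longrightarrow>
    total_deriv f (\<lambda>z. g z / h z) z = (total_deriv f g z * h z - g z * total_deriv f h z) / (h z)\<^sup>2"
  using g h by (simp add: total_deriv_def diff_divide_distrib add_divide_distrib algebra_simps)
lemma total_deriv_uminus [simp]: "total_deriv f (\<lambda>z. - g z) z = - total_deriv f g z"
  using g by (simp add: total_deriv_def algebra_simps)
lemma total_deriv_power [simp]: "total_deriv f (\<lambda>z. g z ^ n) z = of_nat n * g z ^ (n - 1) * total_deriv f g z"
  using g by (simp add: total_deriv_def algebra_simps)

end

lemma holo_at_total_deriv:
  assumes "holo_on f U" "holo_on g U" "z \<in> U"
  shows "holo_at (total_deriv f g) z"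
proof -
  have "holo_at (pd i g) z" "holo_at f z" for i using holo_on_pd[OF assms(2)] assms by (auto simp: holo_on_iff)
  then show ?thesis unfolding total_deriv_def[abs_def] by (intro holo_at_add holo_at_mult holo_at_nth)
qed

lemma derivatives_cong_open:
  assumes "open U" "z \<in> U" "\<And>y. y \<in> U \<Longrightarrow> g y = h y" "holo_at h z"
  shows "holo_at g z" "pd i g z = pd i h z"
proof -
  have ev: "\<forall>\<^sub>F y in nhds z. h y = g y"
    using eventually_nhds_in_open[OF assms(1,2)] by eventually_elim (simp add: assms(3))
  show "holo_at g z" "pd i g z = pd i h z" using holo_at_transform[OF assms(4) ev] by auto
qed

lemma total_deriv_cong_open:
  assumes "open U" "z \<in> U" "\<And>y. y \<in> U \<Longrightarrow> g y = h y" "holo_at h z"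
  shows "total_deriv f g z = total_deriv f h z"
  using derivatives_cong_open(2)[OF assms] by (simp add: total_deriv_def)

text \<open>
  A two-form vanishes if it vanishes on all pairs from the frame \<open>\<partial>\<^sub>u\<close>,
  \<open>\<partial>\<^sub>p\<close>, \<open>\<partial>\<^sub>q\<close>, \<open>\<partial>\<^sub>x +
  p \<partial>\<^sub>u + q \<partial>\<^sub>p + r \<partial>\<^sub>q\<close>, which with \<open>r =
  f\<close> is dual to the base coframe. This is how the total derivative enters the structure
  equations.
\<close>

lemma antisymmetric_frame:
  fixes W :: "4 \<Rightarrow> 4 \<Rightarrow> complex"
  assumes "\<And>a b. W b a = - W a b"
  shows "(\<forall>a b. W a b = 0) \<longleftrightarrow> W 2 3 = 0 \<and> W 2 4 = 0 \<and> W 3 4 = 0 \<and>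
     W 2 1 + q * W 2 3 + r * W 2 4 = 0 \<and> W 3 1 + p * W 3 2 + r * W 3 4 = 0 \<and> W 4 1 + p * W 4 2 + q * W 4 3 = 0"
proof -
  have "W a a = 0" for a using assms[of a a] by simp
  moreover have "W 1 2 = - W 2 1" "W 1 3 = - W 3 1" "W 1 4 = - W 4 1" "W 3 2 = - W 2 3" "W 4 2 = - W 2 4" "W 4 3 = - W 3 4"
    using assms by blast+
  ultimately show ?thesis unfolding forall_4 by auto
qed

definition minor :: "complex^4^4 \<Rightarrow> 4 \<Rightarrow> 4 \<Rightarrow> 4 \<Rightarrow> 4 \<Rightarrow> complex" where
  "minor C j k r s = C$j$r * C$k$s - C$j$s * C$k$r"

text \<open>
  In the frame dual to the base coframe, \<open>d\<omega>\<^sup>1 = \<omega>\<^sup>4 \<and>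
  \<omega>\<^sup>2\<close>, \<open>d\<omega>\<^sup>2 = \<omega>\<^sup>4 \<and>
  \<omega>\<^sup>3\<close> and \<open>d\<omega>\<^sup>3 = \<omega>\<^sup>4 \<and> df\<close>: these
  are the extra terms in the last three equations.
\<close>

lemma structure_functions_frame:
  fixes C :: "complex^4 \<Rightarrow> complex^4^4"
  assumes f: "holo_at f z" and C: "\<And>i r. holo_at (\<lambda>y. C y $ i $ r) z"
  defines "S \<equiv> \<lambda>T i r s. \<Sum>(j,k)\<in>index_pairs. T i j k * minor (C z) j k r s"
  shows "structure_functions_at (\<lambda>y. C y ** base_coframe f y) z T \<longleftrightarrow> (\<forall>i.
     pd 2 (\<lambda>y. C y $ i $ 2) z - pd 3 (\<lambda>y. C y $ i $ 1) z = S T i 1 2 \<and>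
     pd 2 (\<lambda>y. C y $ i $ 3) z - pd 4 (\<lambda>y. C y $ i $ 1) z = S T i 1 3 \<and>
     pd 3 (\<lambda>y. C y $ i $ 3) z - pd 4 (\<lambda>y. C y $ i $ 2) z = S T i 2 3 \<and>
     pd 2 (\<lambda>y. C y $ i $ 4) z - total_deriv f (\<lambda>y. C y $ i $ 1) z - C z $ i $ 3 * pd 2 f z = S T i 1 4 \<and>
     pd 3 (\<lambda>y. C y $ i $ 4) z - total_deriv f (\<lambda>y. C y $ i $ 2) z - C z $ i $ 1 - C z $ i $ 3 * pd 3 f z = S T i 2 4 \<and>
     pd 4 (\<lambda>y. C y $ i $ 4) z - total_deriv f (\<lambda>y. C y $ i $ 3) z - C z $ i $ 2 - C z $ i $ 3 * pd 4 f z = S T i 3 4)"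
    (is "_ \<longleftrightarrow> ?R")
proof -
  let ?\<theta> = "\<lambda>y. C y ** base_coframe f y"
  define W where "W i a b = ext_deriv ?\<theta> i a b z - (\<Sum>(j,k)\<in>index_pairs. T i j k * wedge ?\<theta> j k a b z)" for i a b
  have entries: "(\<lambda>y. ?\<theta> y $ i $ 1) = (\<lambda>y. C y $ i $ 4 - y$3 * C y $ i $ 1 - y$4 * C y $ i $ 2 - f y * C y $ i $ 3)"
    "(\<lambda>y. ?\<theta> y $ i $ 2) = (\<lambda>y. C y $ i $ 1)" "(\<lambda>y. ?\<theta> y $ i $ 3) = (\<lambda>y. C y $ i $ 2)" "(\<lambda>y. ?\<theta> y $ i $ 4) = (\<lambda>y. C y $ i $ 3)" for i
    by (auto simp: matrix_mult_nth fun_eq_iff algebra_simps)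
  have entries_z: "?\<theta> z $ i $ 1 = C z $ i $ 4 - z$3 * C z $ i $ 1 - z$4 * C z $ i $ 2 - f z * C z $ i $ 3"
    "?\<theta> z $ i $ 2 = C z $ i $ 1" "?\<theta> z $ i $ 3 = C z $ i $ 2" "?\<theta> z $ i $ 4 = C z $ i $ 3" for i
    using entries[THEN fun_cong] by auto
  have S: "S T i r s = (\<Sum>(j,k)\<in>index_pairs. T i j k * minor (C z) j k r s)" for i r s by (simp add: S_def)
  have anti: "W i b a = - W i a b" for i a b
    by (simp add: W_def ext_deriv_def wedge_def index_pairs_def algebra_simps)
  have "structure_functions_at ?\<theta> z T \<longleftrightarrow> (\<forall>i. \<forall>a b. W i a b = 0)"
    by (simp add: structure_functions_at_def W_def)
  also have "\<dots> \<longleftrightarrow> (\<forall>i. W i 2 3 = 0 \<and> W i 2 4 = 0 \<and> W i 3 4 = 0 \<and>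
     W i 2 1 + z$4 * W i 2 3 + f z * W i 2 4 = 0 \<and> W i 3 1 + z$3 * W i 3 2 + f z * W i 3 4 = 0 \<and>
     W i 4 1 + z$3 * W i 4 2 + z$4 * W i 4 3 = 0)"
    by (intro all_cong1 antisymmetric_frame anti)
  also have "\<dots> \<longleftrightarrow> ?R"
  proof (rule all_cong1, intro conj_cong)
    fix i
    have hol: "holo_at (\<lambda>y. y$3 * C y $ i $ 1) z" "holo_at (\<lambda>y. y$4 * C y $ i $ 2) z" "holo_at (\<lambda>y. f y * C y $ i $ 3) z"
      "holo_at (\<lambda>y. C y $ i $ 4 - y$3 * C y $ i $ 1) z" "holo_at (\<lambda>y. C y $ i $ 4 - y$3 * C y $ i $ 1 - y$4 * C y $ i $ 2) z"
      using C f by auto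
    have d1: "pd a (\<lambda>y. C y $ i $ 4 - y$3 * C y $ i $ 1 - y$4 * C y $ i $ 2 - f y * C y $ i $ 3) z =
      pd a (\<lambda>y. C y $ i $ 4) z - z$3 * pd a (\<lambda>y. C y $ i $ 1) z - (if a = 3 then C z $ i $ 1 else 0)
       - z$4 * pd a (\<lambda>y. C y $ i $ 2) z - (if a = 4 then C z $ i $ 2 else 0)
       - f z * pd a (\<lambda>y. C y $ i $ 3) z - pd a f z * C z $ i $ 3" for a
      using C f hol by (simp add: algebra_simps)
    show "(W i 2 3 = 0) = (pd 2 (\<lambda>y. C y $ i $ 2) z - pd 3 (\<lambda>y. C y $ i $ 1) z = S T i 1 2)"
      "(W i 2 4 = 0) = (pd 2 (\<lambda>y. C y $ i $ 3) z - pd 4 (\<lambda>y. C y $ i $ 1) z = S T i 1 3)"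
      "(W i 3 4 = 0) = (pd 3 (\<lambda>y. C y $ i $ 3) z - pd 4 (\<lambda>y. C y $ i $ 2) z = S T i 2 3)"
      by (simp_all add: W_def S wedge_def minor_def ext_deriv_def entries entries_z)
    have "W i 2 1 + z$4 * W i 2 3 + f z * W i 2 4 =
        pd 2 (\<lambda>y. C y $ i $ 4) z - total_deriv f (\<lambda>y. C y $ i $ 1) z - C z $ i $ 3 * pd 2 f z - S T i 1 4"
      unfolding W_def S wedge_def minor_def ext_deriv_def entries entries_z d1 index_pairs_def total_deriv_def
      by (simp add: algebra_simps)
    then show "(W i 2 1 + z$4 * W i 2 3 + f z * W i 2 4 = 0) =
       (pd 2 (\<lambda>y. C y $ i $ 4) z - total_deriv f (\<lambda>y. C y $ i $ 1) z - C z $ i $ 3 * pd 2 f z = S T i 1 4)" by simp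
    have "W i 3 1 + z$3 * W i 3 2 + f z * W i 3 4 =
        pd 3 (\<lambda>y. C y $ i $ 4) z - total_deriv f (\<lambda>y. C y $ i $ 2) z - C z $ i $ 1 - C z $ i $ 3 * pd 3 f z - S T i 2 4"
      unfolding W_def S wedge_def minor_def ext_deriv_def entries entries_z d1 index_pairs_def total_deriv_def
      by (simp add: algebra_simps)
    then show "(W i 3 1 + z$3 * W i 3 2 + f z * W i 3 4 = 0) =
       (pd 3 (\<lambda>y. C y $ i $ 4) z - total_deriv f (\<lambda>y. C y $ i $ 2) z - C z $ i $ 1 - C z $ i $ 3 * pd 3 f z = S T i 2 4)" by simp
    have "W i 4 1 + z$3 * W i 4 2 + z$4 * W i 4 3 =
        pd 4 (\<lambda>y. C y $ i $ 4) z - total_deriv f (\<lambda>y. C y $ i $ 3) z - C z $ i $ 2 - C z $ i $ 3 * pd 4 f z - S T i 3 4"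
      unfolding W_def S wedge_def minor_def ext_deriv_def entries entries_z d1 index_pairs_def total_deriv_def
      by (simp add: algebra_simps)
    then show "(W i 4 1 + z$3 * W i 4 2 + z$4 * W i 4 3 = 0) =
       (pd 4 (\<lambda>y. C y $ i $ 4) z - total_deriv f (\<lambda>y. C y $ i $ 3) z - C z $ i $ 2 - C z $ i $ 3 * pd 4 f z = S T i 3 4)" by simp
  qed
  finally show ?thesis .
qed

text \<open>
  Prolonged point transformations preserve the span of \<open>\<omega>\<^sup>1\<close>, the spans of
  \<open>\<omega>\<^sup>1, \<omega>\<^sup>2\<close> and of \<open>\<omega>\<^sup>1,
  \<omega>\<^sup>2, \<omega>\<^sup>3\<close>, and the span of \<open>\<omega>\<^sup>1,
  \<omega>\<^sup>4\<close>, that is of \<open>du\<close> and \<open>dx\<close>. The matrices of this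
  pattern are those whose coframes are adapted to the four spans.
\<close>

definition adapted_shape :: "complex^4^4 \<Rightarrow> bool" where
  "adapted_shape C \<longleftrightarrow> C$1$2 = 0 \<and> C$1$3 = 0 \<and> C$1$4 = 0 \<and> C$2$3 = 0 \<and> C$2$4 = 0 \<and> C$3$4 = 0 \<and> C$4$2 = 0 \<and> C$4$3 = 0"

lemma structure_functions_shape:
  fixes C :: "complex^4 \<Rightarrow> complex^4^4"
  assumes f: "holo_at f z" and C: "\<And>i r. holo_at (\<lambda>y. C y $ i $ r) z" and sh: "adapted_shape (C z)"
  defines "A i j \<equiv> \<lambda>y. C y $ i $ j"
  shows "structure_functions_at (\<lambda>y. C y ** base_coframe f y) z T \<longleftrightarrow>
    (\<forall>i.
     pd 2 (\<lambda>y. C y $ i $ 2) z - pd 3 (\<lambda>y. C y $ i $ 1) z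
       = T i 1 2 * (A 1 1 z * A 2 2 z) + T i 1 3 * (A 1 1 z * A 3 2 z) + T i 2 3 * (A 2 1 z * A 3 2 z - A 2 2 z * A 3 1 z)
         - T i 2 4 * (A 2 2 z * A 4 1 z) - T i 3 4 * (A 3 2 z * A 4 1 z) \<and>
     pd 2 (\<lambda>y. C y $ i $ 3) z - pd 4 (\<lambda>y. C y $ i $ 1) z
       = T i 1 3 * (A 1 1 z * A 3 3 z) + T i 2 3 * (A 2 1 z * A 3 3 z) - T i 3 4 * (A 3 3 z * A 4 1 z) \<and>
     pd 3 (\<lambda>y. C y $ i $ 3) z - pd 4 (\<lambda>y. C y $ i $ 2) z = T i 2 3 * (A 2 2 z * A 3 3 z) \<and>
     pd 2 (\<lambda>y. C y $ i $ 4) z - total_deriv f (\<lambda>y. C y $ i $ 1) z - C z $ i $ 3 * pd 2 f z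
       = T i 1 4 * (A 1 1 z * A 4 4 z) + T i 2 4 * (A 2 1 z * A 4 4 z) + T i 3 4 * (A 3 1 z * A 4 4 z) \<and>
     pd 3 (\<lambda>y. C y $ i $ 4) z - total_deriv f (\<lambda>y. C y $ i $ 2) z - C z $ i $ 1 - C z $ i $ 3 * pd 3 f z
       = T i 2 4 * (A 2 2 z * A 4 4 z) + T i 3 4 * (A 3 2 z * A 4 4 z) \<and>
     pd 4 (\<lambda>y. C y $ i $ 4) z - total_deriv f (\<lambda>y. C y $ i $ 3) z - C z $ i $ 2 - C z $ i $ 3 * pd 4 f z
       = T i 3 4 * (A 3 3 z * A 4 4 z))"
proof -
  have z: "C z $ 1 $ 2 = 0" "C z $ 1 $ 3 = 0" "C z $ 1 $ 4 = 0" "C z $ 2 $ 3 = 0" "C z $ 2 $ 4 = 0" "C z $ 3 $ 4 = 0" "C z $ 4 $ 2 = 0" "C z $ 4 $ 3 = 0"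
    using sh by (auto simp: adapted_shape_def)
  show ?thesis
    unfolding structure_functions_frame[OF f C]
    by (intro all_cong1 conj_cong) (simp_all add: minor_def index_pairs_def z A_def algebra_simps)
qed


lemma structure_functions_cong:
  assumes "\<forall>\<^sub>F y in nhds z. \<theta> y = \<theta>' y" and "\<And>i b. holo_at (\<lambda>y. \<theta>' y $ i $ b) z"
  shows "structure_functions_at \<theta> z T \<longleftrightarrow> structure_functions_at \<theta>' z T"
proof -
  have "pd a (\<lambda>y. \<theta> y $ i $ b) z = pd a (\<lambda>y. \<theta>' y $ i $ b) z" for a i b
    by (rule holo_at_transform(2)[OF assms(2)])
       (use assms(1) in \<open>rule eventually_mono; simp\<close>)
  moreover have "\<theta> z = \<theta>' z" using eventually_nhds_x_imp_x[OF assms(1)] .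
  ultimately show ?thesis by (simp add: structure_functions_at_def ext_deriv_def wedge_def)
qed

text \<open>
  Affine relations between structure functions that are shared by the coframes of all the canonical
  forms and that suffice to recover every entry of an adapted matrix from the equation.
\<close>

definition normalized :: "(4 \<Rightarrow> 4 \<Rightarrow> 4 \<Rightarrow> complex) \<Rightarrow> bool" where
  "normalized T \<longleftrightarrow> T 1 2 3 = 0 \<and> T 1 2 4 = - 1 \<and> T 1 3 4 = 0 \<and>
     T 2 1 3 = 1 \<and> T 2 3 4 = - 1 \<and> T 3 1 4 = 0 \<and> T 4 1 2 = 0 \<and> T 4 1 3 = 1 \<and> T 4 2 3 = 0 \<and>
     T 3 2 4 = T 2 1 4 \<and> T 3 3 4 = 2 * T 2 2 4 - T 1 1 4 \<and> T 4 3 4 = T 2 2 3 - T 1 1 3 \<and>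
     T 1 1 2 + 2 * T 4 2 4 + T 3 2 3 = 1"

text \<open>
  The diagonal entries \<open>l\<^sup>2 h\<close>, \<open>l h\<close>, \<open>h\<close> are forced
  by \<open>T 1 2 4 = T 2 3 4 = -1\<close>. Splitting off the factors \<open>l h\<close>,
  \<open>h\<close> and \<open>l\<close> from the other entries makes \<open>B\<close>,
  \<open>G\<close>, \<open>E\<close>, \<open>K\<close> polynomial in \<open>I1\<close>,
  \<open>I2\<close>, \<open>I3\<close> and \<open>I5 / I6\<close>.
\<close>

definition adapted_matrix :: "complex \<Rightarrow> complex \<Rightarrow> complex \<Rightarrow> complex \<Rightarrow> complex \<Rightarrow> complex \<Rightarrow> complex^4^4" where
  "adapted_matrix l h B G E K = vector [vector [l * l * h, 0, 0, 0], vector [l * h * B, l * h, 0, 0],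
     vector [h * E, h * G, h, 0], vector [l * K, 0, 0, l]]"

lemma adapted_matrix_nth [simp]:
  "adapted_matrix l h B G E K $ 1 $ 1 = l * l * h" "adapted_matrix l h B G E K $ 1 $ 2 = 0" "adapted_matrix l h B G E K $ 1 $ 3 = 0" "adapted_matrix l h B G E K $ 1 $ 4 = 0"
  "adapted_matrix l h B G E K $ 2 $ 1 = l * h * B" "adapted_matrix l h B G E K $ 2 $ 2 = l * h" "adapted_matrix l h B G E K $ 2 $ 3 = 0" "adapted_matrix l h B G E K $ 2 $ 4 = 0"
  "adapted_matrix l h B G E K $ 3 $ 1 = h * E" "adapted_matrix l h B G E K $ 3 $ 2 = h * G" "adapted_matrix l h B G E K $ 3 $ 3 = h" "adapted_matrix l h B G E K $ 3 $ 4 = 0"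
  "adapted_matrix l h B G E K $ 4 $ 1 = l * K" "adapted_matrix l h B G E K $ 4 $ 2 = 0" "adapted_matrix l h B G E K $ 4 $ 3 = 0" "adapted_matrix l h B G E K $ 4 $ 4 = l"
  by (simp_all add: adapted_matrix_def)

lemma shape_adapted_matrix: "adapted_shape (adapted_matrix l h B G E K)"
  by (simp add: adapted_shape_def)

lemma holo_at_adapted_matrix:
  assumes "holo_at l z" "holo_at h z" "holo_at B z" "holo_at G z" "holo_at E z" "holo_at K z"
  shows "holo_at (\<lambda>y. adapted_matrix (l y) (h y) (B y) (G y) (E y) (K y) $ i $ r) z"
proof -
  have "\<forall>i r. holo_at (\<lambda>y. adapted_matrix (l y) (h y) (B y) (G y) (E y) (K y) $ i $ r) z"
    unfolding forall_4 using assms by simp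
  then show ?thesis by blast
qed

definition coframe_matrix :: "(complex^4 \<Rightarrow> complex) \<Rightarrow> complex^4 \<Rightarrow> complex^4^4" where
  "coframe_matrix f z = vector
        [vector [I7 f z^3 / I6 f z, 0, 0, 0],
         vector [I5 f z * I7 f z / I6 f z, I7 f z, 0, 0],
         vector [(I2 f z * (I6 f z)\<^sup>2 + (I5 f z)\<^sup>2) / (2 * I6 f z * I7 f z), (I1 f z * I6 f z + 3 * I5 f z) / (3 * I7 f z), I6 f z / I7 f z, 0],
         vector [I3 f z * (I7 f z)\<^sup>2 / I6 f z, 0, 0, (I7 f z)\<^sup>2 / I6 f z]]"

lemma coframe_eq: "coframe f z = coframe_matrix f z ** base_coframe f z"
  by (simp add: coframe_def coframe_matrix_def Let_def)

lemma shape_coframe_matrix: "adapted_shape (coframe_matrix f z)"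
  by (simp add: adapted_shape_def coframe_matrix_def)

text \<open>
  The structure equations are linear in the derivatives of the entries. They are first solved for
  derivatives of \<open>l\<close> and \<open>h\<close>, which involve structure functions left open
  by the normalization; after substitution only \<open>T 2 1 4\<close> survives in the equations for
  the other entries and for \<open>f\<close>, and it cancels from the invariants.
\<close>

lemma adapted_matrix_derivatives:
  assumes f: "holo_at f z" and hol: "holo_at l z" "holo_at h z" "holo_at B z" "holo_at G z" "holo_at E z" "holo_at K z"
    and nz: "l z \<noteq> 0" "h z \<noteq> 0" and N: "normalized T"
    and S: "structure_functions_at (\<lambda>y. adapted_matrix (l y) (h y) (B y) (G y) (E y) (K y) ** base_coframe f y) z T"
  shows "pd 4 B z = - l z * h z - K z"
    and "pd 4 G z = pd 4 B z - 2 * K z"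
    and "pd 4 K z = - l z * (h z)\<^sup>2"
    and "pd 3 K z = - l z * (h z)\<^sup>2 * G z - (K z)\<^sup>2"
    and "total_deriv f B z = - T 2 1 4 * (l z)\<^sup>2 + E z + (B z)\<^sup>2 - B z * G z"
    and "pd 4 f z = - 3 * (G z - B z)"
    and "pd 3 f z = - total_deriv f G z - 2 * (G z)\<^sup>2 + 3 * B z * G z - E z - T 2 1 4 * (l z)\<^sup>2"
    and "pd 2 f z = - total_deriv f E z - E z * (2 * G z - 3 * B z) - T 2 1 4 * (l z)\<^sup>2 * B z"
proof -
  note eqs = S[unfolded structure_functions_shape[OF f holo_at_adapted_matrix[OF hol] shape_adapted_matrix], rule_format]
  note e12 = eqs[THEN conjunct1] and e13 = eqs[THEN conjunct2, THEN conjunct1]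
    and e23 = eqs[THEN conjunct2, THEN conjunct2, THEN conjunct1]
    and e14 = eqs[THEN conjunct2, THEN conjunct2, THEN conjunct2, THEN conjunct1]
    and e24 = eqs[THEN conjunct2, THEN conjunct2, THEN conjunct2, THEN conjunct2, THEN conjunct1]
    and e34 = eqs[THEN conjunct2, THEN conjunct2, THEN conjunct2, THEN conjunct2, THEN conjunct2]
  have n: "T 1 2 3 = 0" "T 1 2 4 = - 1" "T 1 3 4 = 0" "T 2 1 3 = 1" "T 2 3 4 = - 1" "T 3 1 4 = 0"
     "T 4 1 2 = 0" "T 4 1 3 = 1" "T 4 2 3 = 0" "T 3 2 4 = T 2 1 4" "T 3 3 4 = 2 * T 2 2 4 - T 1 1 4"
     "T 4 3 4 = T 2 2 3 - T 1 1 3" "T 1 1 2 = 1 - 2 * T 4 2 4 - T 3 2 3"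
    using N by (auto simp: normalized_def algebra_simps)
  define L H b g e k where "L = l z" "H = h z" "b = B z" "g = G z" "e = E z" "k = K z"
  note defs = this
  define l2 l3 l4 h2 h3 h4 where "l2 = pd 3 l z" "l3 = pd 4 l z" "l4 = total_deriv f l z"
     "h2 = pd 3 h z" "h3 = pd 4 h z" "h4 = total_deriv f h z"
  note ds = this
  have nz': "L \<noteq> 0" "H \<noteq> 0" using nz by (auto simp: defs)
  have hp: "holo_at (\<lambda>y. l y * l y) z" "holo_at (\<lambda>y. l y * h y) z" using hol by auto
  note R = adapted_matrix_nth pd_const total_deriv_const n(1-9)
    pd_mult[OF hp(1) hol(2)] pd_mult[OF hp(2) hol(3)] pd_mult[OF hol(1) hol(1)] pd_mult[OF hol(1) hol(2)]
    pd_mult[OF hol(2) hol(5)] pd_mult[OF hol(2) hol(4)] pd_mult[OF hol(1) hol(6)]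
    total_deriv_mult[OF hp(1) hol(2)] total_deriv_mult[OF hp(2) hol(3)] total_deriv_mult[OF hol(1) hol(1)] total_deriv_mult[OF hol(1) hol(2)]
    total_deriv_mult[OF hol(2) hol(5)] total_deriv_mult[OF hol(2) hol(4)] total_deriv_mult[OF hol(1) hol(6)]
  have E1: "- (2 * L * l2 * H + L * L * h2) = T 1 1 2 * (L*L*H * (L*H)) + T 1 1 3 * (L*L*H * (H*g)) + L*H * (L*k)"
    using e12[of 1, unfolded R] unfolding ds defs by algebra
  have E2: "- (2 * L * l3 * H + L * L * h3) = T 1 1 3 * (L*L*H * H)"
    using e13[of 1, unfolded R] unfolding ds defs by algebra
  have E3: "- (2 * L * l4 * H + L * L * h4) = T 1 1 4 * (L*L*H * L) - L*H*b * L"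
    using e14[of 1, unfolded R] unfolding ds defs by algebra
  have E4: "- ((l3 * H + L * h3) * b + L * H * pd 4 B z) = L*L*H * H + T 2 2 3 * (L*H*b * H) + H * (L*k)"
    using e13[of 2, unfolded R] unfolding ds defs by algebra
  have E5: "- ((l4 * H + L * h4) * b + L * H * total_deriv f B z) = T 2 1 4 * (L*L*H * L) + T 2 2 4 * (L*H*b * L) - H*e * L"
    using e14[of 2, unfolded R] unfolding ds defs by algebra
  have E6: "- (l4 * H + L * h4) - L*H*b = T 2 2 4 * (L*H * L) - H*g * L"
    using e24[of 2, unfolded R] unfolding ds defs by algebra
  have E7: "h2 - (h3 * g + H * pd 4 G z) = T 3 2 3 * (L*H * H)"
    using e23[of 3, unfolded R] unfolding ds defs by algebra
  have E8: "- (h4 * e + H * total_deriv f E z) - H * pd 2 f z = T 3 2 4 * (L*H*b * L) + T 3 3 4 * (H*e * L)"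
    using e14[of 3, unfolded R] unfolding ds defs by algebra
  have E9: "- (h4 * g + H * total_deriv f G z) - H*e - H * pd 3 f z = T 3 2 4 * (L*H * L) + T 3 3 4 * (H*g * L)"
    using e24[of 3, unfolded R] unfolding ds defs by algebra
  have E10: "- h4 - H*g - H * pd 4 f z = T 3 3 4 * (H * L)"
    using e34[of 3, unfolded R] unfolding ds defs by algebra
  have E11: "- (l2 * k + L * pd 3 K z) = L*L*H * (H*g) - T 4 2 4 * (L*H * (L*k)) - T 4 3 4 * (H*g * (L*k))"
    using e12[of 4, unfolded R] unfolding ds defs by algebra
  have E12: "- (l3 * k + L * pd 4 K z) = L*L*H * H - T 4 3 4 * (H * (L*k))"
    using e13[of 4, unfolded R] unfolding ds defs by algebra
  have E13: "l2 - L*k = T 4 2 4 * (L*H * L) + T 4 3 4 * (H*g * L)"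
    using e24[of 4, unfolded R] unfolding ds defs by algebra
  have E14: "l3 = T 4 3 4 * (H * L)"
    using e34[of 4, unfolded R] unfolding ds defs by algebra
  have cancel: "x = y" if "c * (x - y) = 0" "c \<noteq> 0" for c x y :: complex using that by simp
  have l3: "l3 = T 4 3 4 * H * L" using E14 by (simp add: mult_ac)
  have h3: "h3 = - (T 1 1 3 + 2 * T 4 3 4) * H * H"
    by (rule cancel[of "L * L"]) (use E2[unfolded l3] in algebra, use nz' in simp)
  have B3: "pd 4 B z = - L * H - k"
    by (rule cancel[of "L * H"]) (use E4[unfolded l3 h3 n] in algebra, use nz' in simp)
  have l4: "l4 = L * (2 * b - g + (T 2 2 4 - T 1 1 4) * L)"
    by (rule cancel[of "L * H"]) (use E3 E6 in algebra, use nz' in simp)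
  have h4: "h4 = H * (2 * g - 3 * b + (T 1 1 4 - 2 * T 2 2 4) * L)"
    by (rule cancel[of L]) (use E6[unfolded l4] in algebra, use nz' in simp)
  have B4: "total_deriv f B z = - T 2 1 4 * L * L + e + b * b - b * g"
    by (rule cancel[of "L * H"]) (use E5[unfolded l4 h4] in algebra, use nz' in simp)
  have K3: "pd 4 K z = - L * H * H"
    by (rule cancel[of L]) (use E12[unfolded l3] in algebra, use nz' in simp)
  have l2: "l2 = L * k + T 4 2 4 * L * H * L + T 4 3 4 * H * g * L" using E13 by algebra
  have K2: "pd 3 K z = - L * H * H * g - k * k"
    by (rule cancel[of L]) (use E11[unfolded l2] in algebra, use nz' in simp)
  have h2: "h2 = H * (- T 1 1 2 * L * H - T 1 1 3 * H * g - 3 * k - 2 * T 4 2 4 * L * H - 2 * T 4 3 4 * H * g)"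
    by (rule cancel[of "L * L"]) (use E1[unfolded l2] in algebra, use nz' in simp)
  have G3: "pd 4 G z = - 3 * k - L * H"
    by (rule cancel[of H]) (use E7[unfolded h2 h3 n] in algebra, use nz' in simp)
  have f3: "pd 4 f z = - 3 * (g - b)"
    by (rule cancel[of H]) (use E10[unfolded h4 n] in algebra, use nz' in simp)
  have f2: "pd 3 f z = - total_deriv f G z - 2 * g * g + 3 * b * g - e - T 2 1 4 * L * L"
    by (rule cancel[of H]) (use E9[unfolded h4 n] in algebra, use nz' in simp)
  have f1: "pd 2 f z = - total_deriv f E z - e * (2 * g - 3 * b) - T 2 1 4 * L * L * b"
    by (rule cancel[of H]) (use E8[unfolded h4 n] in algebra, use nz' in simp)
  show "pd 4 B z = - l z * h z - K z" "pd 4 G z = pd 4 B z - 2 * K z" "pd 4 K z = - l z * (h z)\<^sup>2"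
    "pd 3 K z = - l z * (h z)\<^sup>2 * G z - (K z)\<^sup>2"
    "total_deriv f B z = - T 2 1 4 * (l z)\<^sup>2 + E z + (B z)\<^sup>2 - B z * G z"
    "pd 4 f z = - 3 * (G z - B z)"
    "pd 3 f z = - total_deriv f G z - 2 * (G z)\<^sup>2 + 3 * B z * G z - E z - T 2 1 4 * (l z)\<^sup>2"
    "pd 2 f z = - total_deriv f E z - E z * (2 * G z - 3 * B z) - T 2 1 4 * (l z)\<^sup>2 * B z"
    using B3 G3 K3 K2 B4 f3 f2 f1 unfolding defs by (simp_all add: power2_eq_square mult_ac)
qed

text \<open>
  In each invariant the derivatives that the structure equations do not supply, namely the total
  derivatives of \<open>G\<close> and \<open>E\<close>, cancel against those in \<open>pd 3
  f\<close> and \<open>pd 2 f\<close>. The invariants come out as polynomials in the entries, and in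
  these terms the matrix of the theorem is the given one.
\<close>

lemma adapted_matrix_invariants:
  assumes f: "holo_on f V" and hol: "holo_on l V" "holo_on h V" "holo_on B V" "holo_on G V" "holo_on E V" "holo_on K V"
    and nz: "\<And>y. y \<in> V \<Longrightarrow> l y \<noteq> 0" "\<And>y. y \<in> V \<Longrightarrow> h y \<noteq> 0" and N: "normalized T"
    and S: "\<And>y. y \<in> V \<Longrightarrow> structure_functions_at (\<lambda>y. adapted_matrix (l y) (h y) (B y) (G y) (E y) (K y) ** base_coframe f y) y T"
    and z: "z \<in> V"
  shows "I4 f z = 0" "I6 f z \<noteq> 0" "I7 f z \<noteq> 0"
    "coframe f z = adapted_matrix (l z) (h z) (B z) (G z) (E z) (K z) ** base_coframe f z"
proof -
  have opn: "open V" using f by (simp add: holo_on_iff)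
  have ho: "holo_at f y" "holo_at l y" "holo_at h y" "holo_at B y" "holo_at G y" "holo_at E y" "holo_at K y" if "y \<in> V" for y
    using f hol that by (auto simp: holo_on_iff)
  note D = adapted_matrix_derivatives[OF ho nz N S]
  have hd: "holo_at (\<lambda>y. G y - B y) y" "holo_at (\<lambda>y. 3 * (G y - B y)) y" "holo_at (\<lambda>y. 2 * E y) y"
    "holo_at (\<lambda>y. (B y)\<^sup>2) y" "holo_at (\<lambda>y. 2 * E y - (B y)\<^sup>2) y" if "y \<in> V" for y
    using ho[OF that] by auto
  have I1: "I1 f y = 3 * (G y - B y)" if "y \<in> V" for y
    using D(6)[OF that that that that that that that that that that] by (simp add: I1_def)
  have dI1: "pd i (I1 f) y = pd i (\<lambda>y. 3 * (G y - B y)) y" if y: "y \<in> V" for y i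
    by (rule derivatives_cong_open(2)[OF opn y _ hd(2)[OF y]], rule I1)
  have tI1: "total_deriv f (I1 f) y = total_deriv f (\<lambda>y. 3 * (G y - B y)) y" if y: "y \<in> V" for y
    by (rule total_deriv_cong_open[OF opn y _ hd(2)[OF y]], rule I1)
  have I3: "I3 f y = K y" if y: "y \<in> V" for y
    unfolding I3_def dI1[OF y]
    using D(1,2)[OF y y y y y y y y y y] ho[OF y] hd[OF y] by (simp add: algebra_simps)
  have I2: "I2 f y = 2 * E y - (B y)\<^sup>2" if y: "y \<in> V" for y
  proof -
    have t: "total_deriv f (\<lambda>y. 3 * (G y - B y)) y = 3 * (total_deriv f G y - total_deriv f B y)"
      using ho[OF y] hd[OF y] by simp
    show ?thesis
      unfolding I2_def tI1[OF y] t I1[OF y] D(7)[OF y y y y y y y y y y] D(5)[OF y y y y y y y y y y]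
      by (simp add: power2_eq_square algebra_simps D(5)[OF y y y y y y y y y y])
  qed
  have dI2: "total_deriv f (I2 f) z = total_deriv f (\<lambda>y. 2 * E y - (B y)\<^sup>2) z"
    by (rule total_deriv_cong_open[OF opn z _ hd(5)[OF z]], rule I2)
  show I4: "I4 f z = 0"
  proof -
    have t: "total_deriv f (\<lambda>y. 2 * E y - (B y)\<^sup>2) z = 2 * total_deriv f E z - 2 * B z * total_deriv f B z"
      using ho[OF z] hd[OF z] by simp
    show ?thesis
      unfolding I4_def dI2 t I1[OF z] I2[OF z] D(8)[OF z z z z z z z z z z]
      by (simp add: power2_eq_square algebra_simps D(5)[OF z z z z z z z z z z])
  qed
  have "pd i (I3 f) y = pd i K y" if y: "y \<in> V" for i y
    by (rule derivatives_cong_open(2)[OF opn y _ ho(7)[OF y]], rule I3)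
  then have K3: "pd 4 (I3 f) y = - l y * (h y)\<^sup>2" "pd 3 (I3 f) y = - l y * (h y)\<^sup>2 * G y - (K y)\<^sup>2" if y: "y \<in> V" for y
    using D(3,4)[OF y y y y y y y y y y] y by auto
  have I6: "I6 f y = l y * (h y)\<^sup>2" if y: "y \<in> V" for y
    by (simp add: I6_def K3[OF y])
  have I5: "I5 f y = B y * (l y * (h y)\<^sup>2)" if y: "y \<in> V" for y
    unfolding I5_def K3[OF y] I1[OF y] I3[OF y] by (simp add: algebra_simps)
  have q: "I5 f y / I6 f y = B y" if y: "y \<in> V" for y
    using nz[OF y] by (simp add: I5[OF y] I6[OF y])
  have dq: "pd 4 (\<lambda>y. I5 f y / I6 f y) y = pd 4 B y" if y: "y \<in> V" for y
    by (rule derivatives_cong_open(2)[OF opn y _ ho(4)[OF y]], rule q)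
  have I7: "I7 f y = l y * h y" if y: "y \<in> V" for y
    unfolding I7_def dq[OF y] I3[OF y]
    using D(1)[OF y y y y y y y y y y] by simp
  show "I6 f z \<noteq> 0" "I7 f z \<noteq> 0" using nz[OF z] by (simp_all add: I6[OF z] I7[OF z])
  have "coframe_matrix f z = adapted_matrix (l z) (h z) (B z) (G z) (E z) (K z)"
    unfolding coframe_matrix_def adapted_matrix_def I1[OF z] I2[OF z] I3[OF z] I5[OF z] I6[OF z] I7[OF z]
    using nz[OF z] by (simp add: field_simps power2_eq_square power3_eq_cube)
  then show "coframe f z = adapted_matrix (l z) (h z) (B z) (G z) (E z) (K z) ** base_coframe f z"
    by (simp add: coframe_eq)
qed

text \<open>
  An arbitrary adapted matrix is brought into the form \<open>adapted_matrix\<close> by the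
  coefficients of \<open>\<omega>\<^sup>2 \<and> \<omega>\<^sup>4\<close> in
  \<open>d\<theta>\<^sup>1\<close> and of \<open>\<omega>\<^sup>3 \<and> \<omega>\<^sup>4\<close> in
  \<open>d\<theta>\<^sup>2\<close>: there \<open>T 1 2 4 = -1\<close> and \<open>T 2 3 4 =
  -1\<close> relate the diagonal entries.
\<close>

lemma normalized_adapted_coframe:
  fixes C :: "complex^4 \<Rightarrow> complex^4^4"
  assumes f: "holo_on f V" and C: "\<And>i r. holo_on (\<lambda>y. C y $ i $ r) V"
    and sh: "\<And>y. y \<in> V \<Longrightarrow> adapted_shape (C y)" and nz: "\<And>y. y \<in> V \<Longrightarrow> C y $ 1 $ 1 \<noteq> 0"
    and N: "normalized T"
    and S: "\<And>y. y \<in> V \<Longrightarrow> structure_functions_at (\<lambda>y. C y ** base_coframe f y) y T"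
    and z: "z \<in> V"
  shows "I4 f z = 0" "I6 f z \<noteq> 0" "I7 f z \<noteq> 0" "coframe f z = C z ** base_coframe f z"
proof -
  have opn: "open V" using f by (simp add: holo_on_iff)
  have ho: "holo_at f y" "holo_at (\<lambda>y. C y $ i $ r) y" if "y \<in> V" for y i r
    using f C that by (auto simp: holo_on_iff)
  have zero: "C y $ 1 $ 2 = 0" "C y $ 1 $ 3 = 0" "C y $ 1 $ 4 = 0" "C y $ 2 $ 3 = 0" "C y $ 2 $ 4 = 0"
      "C y $ 3 $ 4 = 0" "C y $ 4 $ 2 = 0" "C y $ 4 $ 3 = 0" if "y \<in> V" for y
    using sh[OF that] by (auto simp: adapted_shape_def)
  have dz: "pd a g y = 0" "total_deriv f g y = 0" if "y \<in> V" "\<And>x. x \<in> V \<Longrightarrow> g x = 0" for a g y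
    using derivatives_cong_open(2)[OF opn that(1), of g "\<lambda>_. 0"] that(2) total_deriv_cong_open[OF opn that(1), of g "\<lambda>_. 0"]
    by auto
  have rel: "C y $ 2 $ 2 = C y $ 4 $ 4 * C y $ 3 $ 3" "C y $ 1 $ 1 = C y $ 4 $ 4 * C y $ 4 $ 4 * C y $ 3 $ 3"
    if y: "y \<in> V" for y
  proof -
    note eqs = S[OF y, unfolded structure_functions_shape[OF ho[OF y] sh[OF y]], rule_format]
    have "pd 3 (\<lambda>y. C y $ 1 $ 4) y - total_deriv f (\<lambda>y. C y $ 1 $ 2) y - C y $ 1 $ 1 - C y $ 1 $ 3 * pd 3 f y
       = T 1 2 4 * (C y $ 2 $ 2 * C y $ 4 $ 4) + T 1 3 4 * (C y $ 3 $ 2 * C y $ 4 $ 4)"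
      using eqs[of 1] by blast
    then have 1: "C y $ 1 $ 1 = C y $ 2 $ 2 * C y $ 4 $ 4"
      using N zero[OF y] dz[OF y, of "\<lambda>y. C y $ 1 $ 4"] dz[OF y, of "\<lambda>y. C y $ 1 $ 2"] zero by (simp add: normalized_def)
    have "pd 4 (\<lambda>y. C y $ 2 $ 4) y - total_deriv f (\<lambda>y. C y $ 2 $ 3) y - C y $ 2 $ 2 - C y $ 2 $ 3 * pd 4 f y
       = T 2 3 4 * (C y $ 3 $ 3 * C y $ 4 $ 4)"
      using eqs[of 2] by blast
    then have 2: "C y $ 2 $ 2 = C y $ 3 $ 3 * C y $ 4 $ 4"
      using N zero[OF y] dz[OF y, of "\<lambda>y. C y $ 2 $ 4"] dz[OF y, of "\<lambda>y. C y $ 2 $ 3"] zero by (simp add: normalized_def)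
    show "C y $ 2 $ 2 = C y $ 4 $ 4 * C y $ 3 $ 3" "C y $ 1 $ 1 = C y $ 4 $ 4 * C y $ 4 $ 4 * C y $ 3 $ 3"
      using 1 2 by auto
  qed
  define l where "l y = C y $ 4 $ 4" for y
  define h where "h y = C y $ 3 $ 3" for y
  define B where "B y = C y $ 2 $ 1 / C y $ 2 $ 2" for y
  define G where "G y = C y $ 3 $ 2 / C y $ 3 $ 3" for y
  define E where "E y = C y $ 3 $ 1 / C y $ 3 $ 3" for y
  define K where "K y = C y $ 4 $ 1 / C y $ 4 $ 4" for y
  have nz': "C y $ 4 $ 4 \<noteq> 0" "C y $ 3 $ 3 \<noteq> 0" "C y $ 2 $ 2 \<noteq> 0" if "y \<in> V" for y
    using nz[OF that] rel[OF that] by auto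
  have hol: "holo_on l V" "holo_on h V" "holo_on B V" "holo_on G V" "holo_on E V" "holo_on K V"
    unfolding l_def[abs_def] h_def[abs_def] B_def[abs_def] G_def[abs_def] E_def[abs_def] K_def[abs_def] holo_on_iff
    using opn ho(2) nz' by (auto intro!: holo_at_divide)
  have eq: "C y = adapted_matrix (l y) (h y) (B y) (G y) (E y) (K y)" if y: "y \<in> V" for y
    unfolding vec_eq_iff forall_4 using zero[OF y] rel[OF y] nz'[OF y]
    by (simp add: l_def h_def B_def G_def E_def K_def)
  have S': "structure_functions_at (\<lambda>y. adapted_matrix (l y) (h y) (B y) (G y) (E y) (K y) ** base_coframe f y) y T" if y: "y \<in> V" for y
  proof -
    have b: "\<forall>i j. holo_at (\<lambda>y. base_coframe f y $ i $ j) y" unfolding forall_4 using ho(1)[OF y] by simp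
    have "structure_functions_at (\<lambda>y. adapted_matrix (l y) (h y) (B y) (G y) (E y) (K y) ** base_coframe f y) y T
      \<longleftrightarrow> structure_functions_at (\<lambda>y. C y ** base_coframe f y) y T"
    proof (rule structure_functions_cong)
      show "\<forall>\<^sub>F y in nhds y. adapted_matrix (l y) (h y) (B y) (G y) (E y) (K y) ** base_coframe f y = C y ** base_coframe f y"
        using eventually_nhds_in_open[OF opn y] by eventually_elim (simp add: eq)
      show "holo_at (\<lambda>y. (C y ** base_coframe f y) $ i $ b) y" for i b
        unfolding matrix_mult_nth using b ho(2)[OF y] by (intro holo_at_add holo_at_mult) auto
    qed
    then show ?thesis using S[OF y] by simp
  qed
  have nzl: "l y \<noteq> 0" "h y \<noteq> 0" if "y \<in> V" for y using nz'[OF that] by (auto simp: l_def h_def)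
  show "I4 f z = 0" "I6 f z \<noteq> 0" "I7 f z \<noteq> 0" "coframe f z = C z ** base_coframe f z"
    using adapted_matrix_invariants[OF f hol nzl N S' z] eq[OF z] by auto
qed

lemma shape_mult_base:
  assumes "adapted_shape C"
  shows "(C ** base_coframe f z) $ 1 $ b = C$1$1 * base_coframe f z $ 1 $ b"
    "(C ** base_coframe f z) $ 2 $ b = C$2$1 * base_coframe f z $ 1 $ b + C$2$2 * base_coframe f z $ 2 $ b"
    "(C ** base_coframe f z) $ 3 $ b = C$3$1 * base_coframe f z $ 1 $ b + C$3$2 * base_coframe f z $ 2 $ b + C$3$3 * base_coframe f z $ 3 $ b"
    "(C ** base_coframe f z) $ 4 $ b = C$4$1 * base_coframe f z $ 1 $ b + C$4$4 * base_coframe f z $ 4 $ b"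
  using assms by (simp_all add: matrix_mult_nth adapted_shape_def)

lemma coframe_matrix_diagonal:
  assumes "I6 f z \<noteq> 0" "I7 f z \<noteq> 0"
  shows "coframe_matrix f z $ 1 $ 1 \<noteq> 0" "coframe_matrix f z $ 2 $ 2 \<noteq> 0" "coframe_matrix f z $ 3 $ 3 \<noteq> 0" "coframe_matrix f z $ 4 $ 4 \<noteq> 0"
  using assms by (simp_all add: coframe_matrix_def)

lemma holo_on_coframe:
  assumes f: "holo_on f U" and nz: "\<And>z. z \<in> U \<Longrightarrow> I6 f z \<noteq> 0" "\<And>z. z \<in> U \<Longrightarrow> I7 f z \<noteq> 0"
  shows "holo_on (\<lambda>z. coframe_matrix f z $ i $ j) U" "holo_on (\<lambda>z. coframe f z $ i $ j) U"
proof -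
  have opn: "open U" using f by (simp add: holo_on_iff)
  have intro_on: "holo_on g U" if "\<And>z. z \<in> U \<Longrightarrow> holo_at g z" for g :: "complex^4 \<Rightarrow> complex"
    using opn that by (simp add: holo_on_iff)
  have at: "holo_at g z" if "holo_on g U" "z \<in> U" for g :: "complex^4 \<Rightarrow> complex" and z using that by (simp add: holo_on_iff)
  note rules = holo_at_add holo_at_diff holo_at_mult holo_at_uminus holo_at_power holo_at_const holo_at_divide
    at[OF holo_on_pd] at[OF f] at holo_at_total_deriv[OF f]
  have 1: "holo_on (I1 f) U" unfolding I1_def[abs_def] by (rule intro_on) (intro rules f)
  have 2: "holo_on (I2 f) U" unfolding I2_def[abs_def] by (rule intro_on) (intro rules f 1)
  have 3: "holo_on (I3 f) U" unfolding I3_def[abs_def] by (rule intro_on) (intro rules f 1)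
  have 5: "holo_on (I5 f) U" unfolding I5_def[abs_def] by (rule intro_on) (intro rules f 1 3)
  have 6: "holo_on (I6 f) U" unfolding I6_def[abs_def] by (rule intro_on) (intro rules f 3)
  have q: "holo_on (\<lambda>z. I5 f z / I6 f z) U"
    by (rule intro_on, rule holo_at_divide) (use at[OF 5] at[OF 6] nz in auto)
  have 7: "holo_on (I7 f) U" unfolding I7_def[abs_def] by (rule intro_on) (intro rules f 3 q)
  have m: "\<forall>i j. holo_at (\<lambda>z. coframe_matrix f z $ i $ j) z" if z: "z \<in> U" for z
    unfolding forall_4 using at[OF 1 z] at[OF 2 z] at[OF 3 z] at[OF 5 z] at[OF 6 z] at[OF 7 z] nz[OF z]
    by (simp add: coframe_matrix_def)
  then show "holo_on (\<lambda>z. coframe_matrix f z $ i $ j) U" using opn by (simp add: holo_on_iff)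
  have b: "\<forall>i j. holo_at (\<lambda>y. base_coframe f y $ i $ j) z" if z: "z \<in> U" for z
    unfolding forall_4 using at[OF f z] by simp
  show "holo_on (\<lambda>z. coframe f z $ i $ j) U"
    by (rule intro_on) (use m b in \<open>auto simp: coframe_eq matrix_mult_nth\<close>)
qed

section \<open>Prolonged point transformations and adapted coframes\<close>

lemma base_pt_nth [simp]: "base_pt z $ 1 = z $ 1" "base_pt z $ 2 = z $ 2"
  by (simp_all add: base_pt_def)

lemma holo_at_lift:
  assumes "holo_at g (base_pt z)"
  shows "holo_at (lift g) z" "pd 1 (lift g) z = lift (pd 1 g) z" "pd 2 (lift g) z = lift (pd 2 g) z"
    "pd 3 (lift g) z = 0" "pd 4 (lift g) z = 0"
    "total_deriv f (lift g) z = lift (pd 1 g) z + z$3 * lift (pd 2 g) z"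
proof -
  have c: "holo_at (\<lambda>z. base_pt z $ m) z" for m
    using exhaust_2[of m] by auto
  have eq: "lift g = (\<lambda>z. g (base_pt z))" by (simp add: lift_def fun_eq_iff)
  show "holo_at (lift g) z" unfolding eq by (rule holo_at_chain(1)[OF assms c])
  have d: "pd i (lift g) z = (\<Sum>m\<in>UNIV. pd m g (base_pt z) * pd i (\<lambda>z. base_pt z $ m) z)" for i
    unfolding eq by (rule holo_at_chain(2)[OF assms c])
  show "pd 1 (lift g) z = lift (pd 1 g) z" "pd 2 (lift g) z = lift (pd 2 g) z" "pd 3 (lift g) z = 0" "pd 4 (lift g) z = 0"
    by (simp_all add: d sum_2 lift_def)
  then show "total_deriv f (lift g) z = lift (pd 1 g) z + z$3 * lift (pd 2 g) z"
    by (simp add: total_deriv_def)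
qed

lemma isCont_vecI:
  fixes \<Phi> :: "complex^'n::finite \<Rightarrow> complex^'m::finite"
  assumes "\<And>m. holo_at (\<lambda>z. \<Phi> z $ m) z"
  shows "isCont \<Phi> z"
  unfolding isCont_def by (rule vec_tendstoI) (use holo_at_continuous[OF assms] in \<open>simp add: isCont_def\<close>)

lemma open_base_pt_vimage: "open W \<Longrightarrow> open (base_pt -` W)"
proof -
  assume W: "open W"
  have "isCont base_pt z" for z
  proof (rule isCont_vecI)
    show "holo_at (\<lambda>z. base_pt z $ m) z" for m using exhaust_2[of m] by auto
  qed
  then show ?thesis using W by (simp add: continuous_at_imp_continuous_on open_vimage)
qed

text \<open>
  The forms \<open>\<alpha>\<close>, \<open>\<beta>\<close>, \<open>\<gamma>\<close>,
  \<open>\<delta>\<close> are the pullbacks of the base coframe of \<open>F\<close>.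
\<close>

lemma pullback_frame_components:
  fixes M :: "complex^4 \<Rightarrow> complex^4^4" and F :: "complex^4 \<Rightarrow> complex"
  assumes M: "adapted_shape (M (\<Phi> z))"
  defines "\<alpha> \<equiv> \<lambda>b. pd b (\<lambda>y. \<Phi> y $ 2) z - \<Phi> z $ 3 * pd b (\<lambda>y. \<Phi> y $ 1) z"
    and "\<beta> \<equiv> \<lambda>b. pd b (\<lambda>y. \<Phi> y $ 3) z - \<Phi> z $ 4 * pd b (\<lambda>y. \<Phi> y $ 1) z"
    and "\<gamma> \<equiv> \<lambda>b. pd b (\<lambda>y. \<Phi> y $ 4) z - F (\<Phi> z) * pd b (\<lambda>y. \<Phi> y $ 1) z"
    and "\<delta> \<equiv> \<lambda>b. pd b (\<lambda>y. \<Phi> y $ 1) z"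
  defines "P \<equiv> pullback \<Phi> (\<lambda>w. M w ** base_coframe F w) z"
  shows "P $ 1 $ b = M (\<Phi> z) $ 1 $ 1 * \<alpha> b"
    "P $ 2 $ b = M (\<Phi> z) $ 2 $ 1 * \<alpha> b + M (\<Phi> z) $ 2 $ 2 * \<beta> b"
    "P $ 3 $ b = M (\<Phi> z) $ 3 $ 1 * \<alpha> b + M (\<Phi> z) $ 3 $ 2 * \<beta> b + M (\<Phi> z) $ 3 $ 3 * \<gamma> b"
    "P $ 4 $ b = M (\<Phi> z) $ 4 $ 1 * \<alpha> b + M (\<Phi> z) $ 4 $ 4 * \<delta> b"
  unfolding P_def pullback_def
  by (simp_all add: sum_4 shape_mult_base[OF M] \<alpha>_def \<beta>_def \<gamma>_def \<delta>_def algebra_simps)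

text \<open>
  Coefficients of the forms in the rows of \<open>P\<close> with respect to the base coframe: their
  values on the dual frame \<open>\<partial>\<^sub>u\<close>, \<open>\<partial>\<^sub>p\<close>,
  \<open>\<partial>\<^sub>q\<close>, \<open>\<partial>\<^sub>x + p \<partial>\<^sub>u + q
  \<partial>\<^sub>p + f \<partial>\<^sub>q\<close>.
\<close>

definition frame_matrix :: "(complex^4 \<Rightarrow> complex) \<Rightarrow> (complex^4 \<Rightarrow> complex^4^4) \<Rightarrow> complex^4 \<Rightarrow> complex^4^4" where
  "frame_matrix f P z = (\<chi> i r. if r = 1 then P z $ i $ 2 else if r = 2 then P z $ i $ 3 else if r = 3 then P z $ i $ 4
     else P z $ i $ 1 + z$3 * P z $ i $ 2 + z$4 * P z $ i $ 3 + f z * P z $ i $ 4)"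

lemma frame_matrix_base: "frame_matrix f P z ** base_coframe f z = P z"
  unfolding vec_eq_iff forall_4 by (simp add: matrix_mult_nth frame_matrix_def algebra_simps)


text \<open>
  The prolongation \<open>\<Phi>\<close> of the transformation sends solutions to solutions, so
  \<open>\<Phi>\<close> pulls \<open>\<omega>\<^sup>1, \<omega>\<^sup>2, \<omega>\<^sup>3\<close> of
  \<open>F\<close> back to forms that vanish on the total derivative of \<open>f\<close>. As the
  first three components of \<open>\<Phi>\<close> have order at most \<open>0, 0, 1\<close>, the
  pulled back coframe is adapted. Its structure functions are those of \<open>F\<close>, hence
  normalized, and uniqueness identifies it with the coframe of \<open>f\<close>.
\<close>

lemma structure_if_point_equivalent:
  assumes f: "holo_on f U" and z0: "z0 \<in> U" and F: "holo_on F V" and w: "w \<in> V"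
    and nz: "\<And>y. y \<in> V \<Longrightarrow> I6 F y \<noteq> 0" "\<And>y. y \<in> V \<Longrightarrow> I7 F y \<noteq> 0"
    and S: "\<And>y. y \<in> V \<Longrightarrow> structure_functions_at (coframe F) y T" and N: "normalized T"
    and eqv: "point_equivalent_at f z0 F w"
  shows "invariants_near f z0" "constant_structure_near f z0 T"
proof -
  obtain \<phi> \<psi> W where W: "base_pt z0 \<in> W" "holo_on \<phi> W" "holo_on \<psi> W"
    and jac: "\<And>y. y \<in> W \<Longrightarrow> pd 1 \<phi> y * pd 2 \<psi> y - pd 2 \<phi> y * pd 1 \<psi> y \<noteq> 0"
    and D0: "total_deriv f (lift \<phi>) z0 \<noteq> 0" and pr: "prolong f \<phi> \<psi> z0 = w"
    and ev: "\<forall>\<^sub>F z in nhds z0. F (prolong f \<phi> \<psi> z) = prol_r f \<phi> \<psi> z"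
    using eqv unfolding point_equivalent_at_def by blast
  define U0 where "U0 = U \<inter> base_pt -` W"
  have U0: "open U0" "z0 \<in> U0"
    using f z0 W open_base_pt_vimage by (auto simp: U0_def holo_on_iff)
  have atW: "holo_at \<phi> (base_pt z)" "holo_at \<psi> (base_pt z)" "holo_at (pd i \<phi>) (base_pt z)" "holo_at (pd i \<psi>) (base_pt z)"
    if "z \<in> U0" for z i
    using W holo_on_pd[OF W(2)] holo_on_pd[OF W(3)] that by (auto simp: U0_def holo_on_iff)
  have fU0: "holo_at f z" if "z \<in> U0" for z using f that by (auto simp: U0_def holo_on_iff)
  let ?D\<phi> = "total_deriv f (lift \<phi>)" and ?D\<psi> = "total_deriv f (lift \<psi>)"
  have D: "?D\<phi> z = lift (pd 1 \<phi>) z + z$3 * lift (pd 2 \<phi>) z" "?D\<psi> z = lift (pd 1 \<psi>) z + z$3 * lift (pd 2 \<psi>) z"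
    if "z \<in> U0" for z
    using holo_at_lift(6)[OF atW(1)[OF that]] holo_at_lift(6)[OF atW(2)[OF that]] by auto
  have Dh: "holo_at ?D\<phi> z" "pd 4 ?D\<phi> z = 0" "holo_at ?D\<psi> z" "pd 4 ?D\<psi> z = 0" if z: "z \<in> U0" for z
  proof -
    have h: "holo_at (lift (pd i \<phi>)) z" "pd 4 (lift (pd i \<phi>)) z = 0" "holo_at (lift (pd i \<psi>)) z" "pd 4 (lift (pd i \<psi>)) z = 0" for i
      using holo_at_lift[OF atW(3)[OF z]] holo_at_lift[OF atW(4)[OF z]] by auto
    have h1: "holo_at (\<lambda>z. lift (pd 1 \<phi>) z + z$3 * lift (pd 2 \<phi>) z) z" "holo_at (\<lambda>z. lift (pd 1 \<psi>) z + z$3 * lift (pd 2 \<psi>) z) z"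
      using h by (intro holo_at_add holo_at_mult holo_at_nth; simp)+
    have "pd 4 (\<lambda>z. lift (pd 1 \<phi>) z + z$3 * lift (pd 2 \<phi>) z) z = 0" "pd 4 (\<lambda>z. lift (pd 1 \<psi>) z + z$3 * lift (pd 2 \<psi>) z) z = 0"
      using h by (simp_all add: holo_at_mult)
    then show "holo_at ?D\<phi> z" "pd 4 ?D\<phi> z = 0" "holo_at ?D\<psi> z" "pd 4 ?D\<psi> z = 0"
      using derivatives_cong_open[OF U0(1) z D(1) h1(1)] derivatives_cong_open[OF U0(1) z D(2) h1(2)] by auto
  qed
  have "isCont ?D\<phi> z0" using Dh(1)[OF U0(2)] by (rule holo_at_continuous)
  then have "\<forall>\<^sub>F z in nhds z0. ?D\<phi> z \<noteq> 0"
    using D0 by (simp add: isCont_def tendsto_imp_eventually_ne eventually_nhds_conv_at)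
  then obtain U1' where U1': "open U1'" "z0 \<in> U1'" "\<And>z. z \<in> U1' \<Longrightarrow> ?D\<phi> z \<noteq> 0"
    unfolding eventually_nhds by blast
  define U1 where "U1 = U0 \<inter> U1'"
  have U1: "open U1" "z0 \<in> U1" "\<And>z. z \<in> U1 \<Longrightarrow> z \<in> U0" "\<And>z. z \<in> U1 \<Longrightarrow> ?D\<phi> z \<noteq> 0"
    using U0 U1' by (auto simp: U1_def)
  have fU1: "holo_on f U1" using U1 fU0 by (simp add: holo_on_iff)
  let ?P = "prol_p f \<phi> \<psi>" and ?Q = "prol_q f \<phi> \<psi>"
  have P: "holo_at ?P z" "pd 4 ?P z = 0" if z: "z \<in> U1" for z
    unfolding prol_p_def[abs_def] using Dh[OF U1(3)[OF z]] U1(4)[OF z] by simp_all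
  have PU1: "holo_on ?P U1" using P U1 by (simp add: holo_on_iff)
  have Q: "holo_at ?Q z" if z: "z \<in> U1" for z
    unfolding prol_q_def[abs_def]
    by (rule holo_at_divide[OF holo_at_total_deriv[OF fU1 PU1 z] Dh(1)[OF U1(3)[OF z]] U1(4)[OF z]])
  define \<Phi> where "\<Phi> = prolong f \<phi> \<psi>"
  have \<Phi>n: "(\<lambda>z. \<Phi> z $ 1) = lift \<phi>" "(\<lambda>z. \<Phi> z $ 2) = lift \<psi>" "(\<lambda>z. \<Phi> z $ 3) = ?P" "(\<lambda>z. \<Phi> z $ 4) = ?Q"
    by (simp_all add: \<Phi>_def prolong_def fun_eq_iff)
  have \<Phi>h: "holo_at (\<lambda>z. \<Phi> z $ m) z" if z: "z \<in> U1" for m z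
  proof -
    have "\<forall>m. holo_at (\<lambda>z. \<Phi> z $ m) z" unfolding forall_4 \<Phi>n
      using P(1)[OF z] Q[OF z] holo_at_lift(1)[OF atW(1)[OF U1(3)[OF z]]] holo_at_lift(1)[OF atW(2)[OF U1(3)[OF z]]] by simp
    then show ?thesis ..
  qed
  have "isCont \<Phi> z0" by (rule isCont_vecI) (rule \<Phi>h[OF U1(2)])
  moreover have "open V" using F by (simp add: holo_on_iff)
  ultimately have "\<forall>\<^sub>F z in nhds z0. \<Phi> z \<in> V"
    using w pr unfolding \<Phi>_def isCont_def
    by (intro eventually_nhds_conv_at[THEN iffD2] conjI topological_tendstoD) auto
  with ev have "\<forall>\<^sub>F z in nhds z0. \<Phi> z \<in> V \<and> F (\<Phi> z) = prol_r f \<phi> \<psi> z"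
    unfolding \<Phi>_def by eventually_elim simp
  then obtain U2' where U2': "open U2'" "z0 \<in> U2'" "\<And>z. z \<in> U2' \<Longrightarrow> \<Phi> z \<in> V" "\<And>z. z \<in> U2' \<Longrightarrow> F (\<Phi> z) = prol_r f \<phi> \<psi> z"
    unfolding eventually_nhds by blast
  define U2 where "U2 = U1 \<inter> U2'"
  have U2: "open U2" "z0 \<in> U2" "\<And>z. z \<in> U2 \<Longrightarrow> z \<in> U1" "\<And>z. z \<in> U2 \<Longrightarrow> z \<in> U0"
      "\<And>z. z \<in> U2 \<Longrightarrow> \<Phi> z \<in> V" "\<And>z. z \<in> U2 \<Longrightarrow> F (\<Phi> z) = prol_r f \<phi> \<psi> z"
    using U1 U2' by (auto simp: U2_def)
  have fU2: "holo_on f U2" using U2 fU0 by (simp add: holo_on_iff)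
  have \<Phi>U2: "holo_on (\<lambda>z. \<Phi> z $ m) U2" for m using \<Phi>h U2 by (simp add: holo_on_iff)
  let ?\<theta> = "pullback \<Phi> (coframe F)"
  let ?C = "frame_matrix f ?\<theta>"
  have cF: "coframe F = (\<lambda>w. coframe_matrix F w ** base_coframe F w)" by (simp add: coframe_eq fun_eq_iff)
  note comp = pullback_frame_components[where M = "coframe_matrix F" and F = F and \<Phi> = \<Phi>, OF shape_coframe_matrix, folded cF]
  have holF: "holo_at (\<lambda>w. coframe F w $ i $ b) (\<Phi> z)" if "z \<in> U2" for i b z
    using holo_on_coframe(2)[OF F nz] U2(5)[OF that] by (simp add: holo_on_iff)
  have hol\<theta>: "holo_at (\<lambda>z. ?\<theta> z $ i $ b) z" if "z \<in> U2" for i b z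
    by (rule holo_at_pullback(1)[OF \<Phi>U2 that holF[OF that]])
  have holC: "holo_on (\<lambda>z. ?C z $ i $ r) U2" for i r
  proof -
    have "\<forall>r. holo_at (\<lambda>z. ?C z $ i $ r) z" if z: "z \<in> U2" for z
      unfolding forall_4 using hol\<theta>[OF z] fU2 z by (simp add: frame_matrix_def holo_on_iff)
    then show ?thesis using U2(1) by (simp add: holo_on_iff)
  qed
  have total: "?D\<psi> z = ?P z * ?D\<phi> z" "total_deriv f ?P z = ?Q z * ?D\<phi> z" "total_deriv f ?Q z = F (\<Phi> z) * ?D\<phi> z"
    if z: "z \<in> U2" for z
    using U1(4)[OF U2(3)[OF z]] U2(6)[OF z] by (simp_all add: prol_p_def prol_q_def prol_r_def)
  have low: "pd 3 (lift \<phi>) z = 0" "pd 4 (lift \<phi>) z = 0" "pd 3 (lift \<psi>) z = 0" "pd 4 (lift \<psi>) z = 0" "pd 4 ?P z = 0"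
    if z: "z \<in> U2" for z
    using holo_at_lift[OF atW(1)[OF U2(4)[OF z]]] holo_at_lift[OF atW(2)[OF U2(4)[OF z]]] P[OF U2(3)[OF z]] by auto
  have \<Phi>z: "\<Phi> z $ 3 = ?P z" "\<Phi> z $ 4 = ?Q z" for z using \<Phi>n[THEN fun_cong] by auto
  have shC: "adapted_shape (?C z)" if z: "z \<in> U2" for z
  proof -
    \<comment> \<open>Contracting a pulled back contact form with the total derivative: the combination
      vanishes because each prolongation is a quotient of total derivatives.\<close>
    have tot: "M * (a1 - u * c1) + z$3 * (M * (a2 - u * c2)) + z$4 * (M * (a3 - u * c3)) + f z * (M * (a4 - u * c4))
      = M * ((a1 + z$3 * a2 + z$4 * a3 + f z * a4) - u * (c1 + z$3 * c2 + z$4 * c3 + f z * c4))"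
      for M u a1 a2 a3 a4 c1 c2 c3 c4 by (simp add: algebra_simps)
    have e\<psi>: "pd 1 (lift \<psi>) z + z$3 * pd 2 (lift \<psi>) z + z$4 * pd 3 (lift \<psi>) z + f z * pd 4 (lift \<psi>) z = ?P z * ?D\<phi> z"
      and eP: "pd 1 ?P z + z$3 * pd 2 ?P z + z$4 * pd 3 ?P z + f z * pd 4 ?P z = ?Q z * ?D\<phi> z"
      and eQ: "pd 1 ?Q z + z$3 * pd 2 ?Q z + z$4 * pd 3 ?Q z + f z * pd 4 ?Q z = F (\<Phi> z) * ?D\<phi> z"
      and e\<phi>: "pd 1 (lift \<phi>) z + z$3 * pd 2 (lift \<phi>) z + z$4 * pd 3 (lift \<phi>) z + f z * pd 4 (lift \<phi>) z = ?D\<phi> z"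
      using total[OF z] by (simp_all add: total_deriv_def)
    have t1: "M * (pd 1 (lift \<psi>) z - ?P z * pd 1 (lift \<phi>) z) + z$3 * (M * (pd 2 (lift \<psi>) z - ?P z * pd 2 (lift \<phi>) z))
       + z$4 * (M * (pd 3 (lift \<psi>) z - ?P z * pd 3 (lift \<phi>) z)) + f z * (M * (pd 4 (lift \<psi>) z - ?P z * pd 4 (lift \<phi>) z)) = 0" for M
      unfolding tot e\<psi> e\<phi> by simp
    have t2: "M * (pd 1 ?P z - ?Q z * pd 1 (lift \<phi>) z) + z$3 * (M * (pd 2 ?P z - ?Q z * pd 2 (lift \<phi>) z))
       + z$4 * (M * (pd 3 ?P z - ?Q z * pd 3 (lift \<phi>) z)) + f z * (M * (pd 4 ?P z - ?Q z * pd 4 (lift \<phi>) z)) = 0" for M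
      unfolding tot eP e\<phi> by simp
    have t3: "M * (pd 1 ?Q z - F (\<Phi> z) * pd 1 (lift \<phi>) z) + z$3 * (M * (pd 2 ?Q z - F (\<Phi> z) * pd 2 (lift \<phi>) z))
       + z$4 * (M * (pd 3 ?Q z - F (\<Phi> z) * pd 3 (lift \<phi>) z)) + f z * (M * (pd 4 ?Q z - F (\<Phi> z) * pd 4 (lift \<phi>) z)) = 0" for M
      unfolding tot eQ e\<phi> by simp
    let ?M = "\<lambda>i j. coframe_matrix F (\<Phi> z) $ i $ j"
    have "?C z $ 1 $ 4 = 0"
      using t1[of "?M 1 1"] by (simp add: frame_matrix_def comp \<Phi>n \<Phi>z)
    moreover have "?C z $ 2 $ 4 = 0"
      using t1[of "?M 2 1"] t2[of "?M 2 2"] by (simp add: frame_matrix_def comp \<Phi>n \<Phi>z distrib_left) algebra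
    moreover have "?C z $ 3 $ 4 = 0"
      using t1[of "?M 3 1"] t2[of "?M 3 2"] t3[of "?M 3 3"] by (simp add: frame_matrix_def comp \<Phi>n \<Phi>z distrib_left) algebra
    ultimately show ?thesis
      by (simp add: adapted_shape_def) (simp add: frame_matrix_def comp \<Phi>n \<Phi>z low[OF z])
  qed
  have C11: "?C z $ 1 $ 1 \<noteq> 0" if z: "z \<in> U2" for z
  proof -
    have zW: "base_pt z \<in> W" using U2(4)[OF z] by (simp add: U0_def)
    have "?C z $ 1 $ 1 * ?D\<phi> z = coframe_matrix F (\<Phi> z) $ 1 $ 1 * (lift (pd 2 \<psi>) z * ?D\<phi> z - ?D\<psi> z * lift (pd 2 \<phi>) z)"
      using total(1)[OF z] holo_at_lift(3)[OF atW(1)[OF U2(4)[OF z]]] holo_at_lift(3)[OF atW(2)[OF U2(4)[OF z]]]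
      by (simp add: frame_matrix_def comp \<Phi>n \<Phi>z algebra_simps)
    also have "lift (pd 2 \<psi>) z * ?D\<phi> z - ?D\<psi> z * lift (pd 2 \<phi>) z
       = pd 1 \<phi> (base_pt z) * pd 2 \<psi> (base_pt z) - pd 2 \<phi> (base_pt z) * pd 1 \<psi> (base_pt z)"
      unfolding D[OF U2(4)[OF z]] by (simp add: lift_def algebra_simps)
    finally show ?thesis
      using jac[OF zW] coframe_matrix_diagonal(1)[OF nz[OF U2(5)[OF z]]] by auto
  qed
  have SC: "structure_functions_at (\<lambda>y. ?C y ** base_coframe f y) z T" if z: "z \<in> U2" for z
    unfolding frame_matrix_base
    by (rule structure_functions_pullback[OF \<Phi>U2 z holF[OF z] S[OF U2(5)[OF z]]])
  note res = normalized_adapted_coframe[OF fU2 holC shC C11 N SC]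
  show "invariants_near f z0" unfolding invariants_near_def
    using eventually_nhds_in_open[OF U2(1,2)] by eventually_elim (use res in blast)
  have eq: "coframe f y = ?\<theta> y" if "y \<in> U2" for y
  proof -
    have "coframe f y = ?C y ** base_coframe f y" using res(4) that by blast
    then show ?thesis unfolding frame_matrix_base .
  qed
  have "structure_functions_at (coframe f) z T" if z: "z \<in> U2" for z
  proof -
    have "\<forall>\<^sub>F y in nhds z. coframe f y = ?\<theta> y"
      using eventually_nhds_in_open[OF U2(1) z] by eventually_elim (rule eq)
    then show ?thesis
      using structure_functions_cong[of "coframe f" ?\<theta> z T] hol\<theta>[OF z] SC[OF z] unfolding frame_matrix_base by blast
  qed
  then show "constant_structure_near f z0 T" unfolding constant_structure_near_def
    using eventually_nhds_in_open[OF U2(1,2)] by (auto elim: eventually_mono)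
qed

lemma det_coframe:
  assumes "I6 f z \<noteq> 0" "I7 f z \<noteq> 0"
  shows "det (coframe f z) \<noteq> 0"
proof -
  have "x = 0" if "coframe f z *v x = 0" for x
  proof -
    have e: "(\<Sum>b\<in>UNIV. coframe f z $ i $ b * x $ b) = 0" for i
      using arg_cong[OF that, of "\<lambda>v. v $ i"] by (simp add: matrix_vector_mult_def)
    note d = coframe_matrix_diagonal[OF assms]
    have 1: "x$2 = z$3 * x$1"
    proof -
      have "coframe_matrix f z $ 1 $ 1 * (x$2 - z$3 * x$1) = 0"
        using e[of 1] unfolding sum_4 coframe_eq shape_mult_base[OF shape_coframe_matrix] by (simp add: algebra_simps)
      then show ?thesis using d by simp
    qed
    have 2: "x$3 = z$4 * x$1"
    proof -
      have "coframe_matrix f z $ 2 $ 2 * (x$3 - z$4 * x$1) = 0"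
        using e[of 2] unfolding sum_4 coframe_eq shape_mult_base[OF shape_coframe_matrix] 1 by (simp add: algebra_simps)
      then show ?thesis using d by simp
    qed
    have 3: "x$4 = f z * x$1"
    proof -
      have "coframe_matrix f z $ 3 $ 3 * (x$4 - f z * x$1) = 0"
        using e[of 3] unfolding sum_4 coframe_eq shape_mult_base[OF shape_coframe_matrix] 1 2 by (simp add: algebra_simps)
      then show ?thesis using d by simp
    qed
    have "coframe_matrix f z $ 4 $ 4 * x$1 = 0"
      using e[of 4] unfolding sum_4 coframe_eq shape_mult_base[OF shape_coframe_matrix] 1 by (simp add: algebra_simps)
    then have "x$1 = 0" using d by simp
    then show ?thesis using 1 2 3 unfolding vec_eq_iff forall_4 by simp
  qed
  then have "invertible (coframe f z)"
    unfolding invertible_left_inverse matrix_left_invertible_ker by blast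
  then show ?thesis by (simp add: invertible_det_nz)
qed

text \<open>
  A ball meets each fibre over the \<open>(x, u)\<close>-plane in a convex set.
\<close>

lemma constant_along_fibre:
  fixes g :: "complex^4 \<Rightarrow> complex"
  assumes g: "holo_on g (ball z0 \<epsilon>)" and d: "\<And>z. z \<in> ball z0 \<epsilon> \<Longrightarrow> pd 3 g z = 0" "\<And>z. z \<in> ball z0 \<epsilon> \<Longrightarrow> pd 4 g z = 0"
    and z: "z \<in> ball z0 \<epsilon>" "z' \<in> ball z0 \<epsilon>" and eq: "z$1 = z'$1" "z$2 = z'$2"
  shows "g z = g z'"
proof -
  let ?v = "z' - z"
  have mem: "z + t *\<^sub>R ?v \<in> ball z0 \<epsilon>" if "t \<in> {0..1}" for t
  proof -
    have "(1 - t) *\<^sub>R z + t *\<^sub>R z' \<in> ball z0 \<epsilon>"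
      by (rule convexD[OF convex_ball z]) (use that in auto)
    then show ?thesis by (simp add: algebra_simps)
  qed
  have "((\<lambda>t. g (z + t *\<^sub>R ?v)) has_vector_derivative 0) (at t within {0..1})" if t: "t \<in> {0..1}" for t
  proof -
    have "holo_at g (z + t *\<^sub>R ?v)" using g mem[OF t] by (simp add: holo_on_iff del: mem_ball)
    from holo_at_real_line[OF this, of "{0..1}"] show ?thesis
      using d[OF mem[OF t]] eq by (simp add: sum_4)
  qed
  from has_vector_derivative_zero_constant[OF convex_real_interval(5) this]
  obtain c where c: "\<And>t. t \<in> {0..1} \<Longrightarrow> g (z + t *\<^sub>R ?v) = c" by metis
  show ?thesis using c[of 0] c[of 1] by simp
qed

text \<open>
  An equivalence \<open>\<Phi>\<close> of the two coframes satisfies \<open>\<Phi>\<^sup>* (M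
  \<omega>\<^sub>F) = m \<omega>\<^sub>f\<close> with invertible matrices of the adapted pattern.
  The first and last rows show that the \<open>x\<close>- and \<open>u\<close>-components of
  \<open>\<Phi>\<close> are constant along fibres, so they come from functions
  \<open>\<phi>\<close>, \<open>\<psi>\<close> of \<open>(x, u)\<close>; contracting the rows one
  after another with the total derivative of \<open>f\<close> shows that the remaining components
  are the prolongations and that the third derivative is mapped to \<open>F\<close>.
\<close>

lemma point_equivalent_if_structure:
  assumes f: "holo_on f U" and z0: "z0 \<in> U" and F: "holo_on F V" and w: "w \<in> V"
    and nzf: "\<And>y. y \<in> U \<Longrightarrow> I6 f y \<noteq> 0" "\<And>y. y \<in> U \<Longrightarrow> I7 f y \<noteq> 0"
    and nzF: "\<And>y. y \<in> V \<Longrightarrow> I6 F y \<noteq> 0" "\<And>y. y \<in> V \<Longrightarrow> I7 F y \<noteq> 0"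
    and Sf: "\<And>y. y \<in> U \<Longrightarrow> structure_functions_at (coframe f) y T"
    and SF: "\<And>y. y \<in> V \<Longrightarrow> structure_functions_at (coframe F) y T"
  shows "point_equivalent_at f z0 F w"
proof -
  obtain \<epsilon> \<Phi> where \<epsilon>: "\<epsilon> > 0" "ball z0 \<epsilon> \<subseteq> U" and \<Phi>0: "\<Phi> z0 = w"
    and \<Phi>V: "\<And>z. z \<in> ball z0 \<epsilon> \<Longrightarrow> \<Phi> z \<in> V"
    and \<Phi>: "\<And>m. holo_on (\<lambda>z. \<Phi> z $ m) (ball z0 \<epsilon>)"
    and pb: "\<And>z. z \<in> ball z0 \<epsilon> \<Longrightarrow> pullback \<Phi> (coframe F) z = coframe f z"
    using coframe_equivalence[OF holo_on_coframe(2)[OF f nzf] z0 holo_on_coframe(2)[OF F nzF] w det_coframe[OF nzF] Sf SF] by blast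
  let ?B = "ball z0 \<epsilon>"
  let ?X = "\<lambda>z. \<Phi> z $ 1" and ?U = "\<lambda>z. \<Phi> z $ 2" and ?P = "\<lambda>z. \<Phi> z $ 3" and ?Q = "\<lambda>z. \<Phi> z $ 4"
  have ho: "holo_at (\<lambda>z. \<Phi> z $ m) z" if "z \<in> ?B" for m z using \<Phi> that by (simp add: holo_on_iff)
  have cF: "coframe F = (\<lambda>w. coframe_matrix F w ** base_coframe F w)" by (simp add: coframe_eq fun_eq_iff)
  have facts: "pd 3 ?X z = 0 \<and> pd 4 ?X z = 0 \<and> pd 3 ?U z = 0 \<and> pd 4 ?U z = 0 \<and>
      total_deriv f ?X z \<noteq> 0 \<and> total_deriv f ?U z = ?P z * total_deriv f ?X z \<and>
      total_deriv f ?P z = ?Q z * total_deriv f ?X z \<and> total_deriv f ?Q z = F (\<Phi> z) * total_deriv f ?X z \<and>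
      pd 2 ?U z - ?P z * pd 2 ?X z \<noteq> 0" if z: "z \<in> ?B" for z
  proof -
    let ?M = "\<lambda>i j. coframe_matrix F (\<Phi> z) $ i $ j" and ?m = "\<lambda>i j. coframe_matrix f z $ i $ j"
    have zU: "z \<in> U" using z \<epsilon>(2) by blast
    note dM = coframe_matrix_diagonal[OF nzF[OF \<Phi>V[OF z]]] and dm = coframe_matrix_diagonal[OF nzf[OF zU]]
    note comp = pullback_frame_components[where M = "coframe_matrix F" and F = F and \<Phi> = \<Phi> and z = z, OF shape_coframe_matrix, folded cF, unfolded pb[OF z]]
    note comp' = comp[unfolded coframe_eq shape_mult_base[OF shape_coframe_matrix]]
    define \<alpha> where "\<alpha> b = pd b ?U z - ?P z * pd b ?X z" for b
    define \<beta> where "\<beta> b = pd b ?P z - ?Q z * pd b ?X z" for b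
    define \<gamma> where "\<gamma> b = pd b ?Q z - F (\<Phi> z) * pd b ?X z" for b
    note R = comp'[folded \<alpha>_def \<beta>_def \<gamma>_def]
    have r: "?m 1 1 * base_coframe f z $ 1 $ b = ?M 1 1 * \<alpha> b"
      "?m 2 1 * base_coframe f z $ 1 $ b + ?m 2 2 * base_coframe f z $ 2 $ b = ?M 2 1 * \<alpha> b + ?M 2 2 * \<beta> b"
      "?m 3 1 * base_coframe f z $ 1 $ b + ?m 3 2 * base_coframe f z $ 2 $ b + ?m 3 3 * base_coframe f z $ 3 $ b
        = ?M 3 1 * \<alpha> b + ?M 3 2 * \<beta> b + ?M 3 3 * \<gamma> b"
      "?m 4 1 * base_coframe f z $ 1 $ b + ?m 4 4 * base_coframe f z $ 4 $ b = ?M 4 1 * \<alpha> b + ?M 4 4 * pd b ?X z" for b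
      using R by blast+
    have \<alpha>0: "\<alpha> 3 = 0" "\<alpha> 4 = 0" using r(1)[of 3] r(1)[of 4] dM by auto
    have \<alpha>2: "\<alpha> 2 \<noteq> 0" using r(1)[of 2] dm dM by auto
    have X0: "pd 3 ?X z = 0" "pd 4 ?X z = 0" using r(4)[of 3] r(4)[of 4] dM \<alpha>0 by auto
    have U0: "pd 3 ?U z = 0" "pd 4 ?U z = 0" using \<alpha>0 X0 by (auto simp: \<alpha>_def)
    have tot: "total_deriv f ?U z - ?P z * total_deriv f ?X z = \<alpha> 1 + z$3 * \<alpha> 2 + z$4 * \<alpha> 3 + f z * \<alpha> 4"
      "total_deriv f ?P z - ?Q z * total_deriv f ?X z = \<beta> 1 + z$3 * \<beta> 2 + z$4 * \<beta> 3 + f z * \<beta> 4"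
      "total_deriv f ?Q z - F (\<Phi> z) * total_deriv f ?X z = \<gamma> 1 + z$3 * \<gamma> 2 + z$4 * \<gamma> 3 + f z * \<gamma> 4"
      by (simp_all add: total_deriv_def \<alpha>_def \<beta>_def \<gamma>_def algebra_simps)
    have a: "\<alpha> 1 + z$3 * \<alpha> 2 + z$4 * \<alpha> 3 + f z * \<alpha> 4 = 0"
    proof -
      have "?M 1 1 * (\<alpha> 1 + z$3 * \<alpha> 2 + z$4 * \<alpha> 3 + f z * \<alpha> 4) = ?M 1 1 * \<alpha> 1 + z$3 * (?M 1 1 * \<alpha> 2) + z$4 * (?M 1 1 * \<alpha> 3) + f z * (?M 1 1 * \<alpha> 4)"
        by (simp add: algebra_simps)
      also have "\<dots> = 0" unfolding r(1)[symmetric] by simp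
      finally show ?thesis using dM by simp
    qed
    have b: "\<beta> 1 + z$3 * \<beta> 2 + z$4 * \<beta> 3 + f z * \<beta> 4 = 0"
    proof -
      have "?M 2 1 * (\<alpha> 1 + z$3 * \<alpha> 2 + z$4 * \<alpha> 3 + f z * \<alpha> 4) + ?M 2 2 * (\<beta> 1 + z$3 * \<beta> 2 + z$4 * \<beta> 3 + f z * \<beta> 4)
        = (?M 2 1 * \<alpha> 1 + ?M 2 2 * \<beta> 1) + z$3 * (?M 2 1 * \<alpha> 2 + ?M 2 2 * \<beta> 2) + z$4 * (?M 2 1 * \<alpha> 3 + ?M 2 2 * \<beta> 3) + f z * (?M 2 1 * \<alpha> 4 + ?M 2 2 * \<beta> 4)"
        by (simp add: algebra_simps)
      also have "\<dots> = 0" unfolding r(2)[symmetric] by simp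
      finally show ?thesis using dM a by simp
    qed
    have c: "\<gamma> 1 + z$3 * \<gamma> 2 + z$4 * \<gamma> 3 + f z * \<gamma> 4 = 0"
    proof -
      have "?M 3 1 * (\<alpha> 1 + z$3 * \<alpha> 2 + z$4 * \<alpha> 3 + f z * \<alpha> 4) + ?M 3 2 * (\<beta> 1 + z$3 * \<beta> 2 + z$4 * \<beta> 3 + f z * \<beta> 4)
          + ?M 3 3 * (\<gamma> 1 + z$3 * \<gamma> 2 + z$4 * \<gamma> 3 + f z * \<gamma> 4)
        = (?M 3 1 * \<alpha> 1 + ?M 3 2 * \<beta> 1 + ?M 3 3 * \<gamma> 1) + z$3 * (?M 3 1 * \<alpha> 2 + ?M 3 2 * \<beta> 2 + ?M 3 3 * \<gamma> 2)
          + z$4 * (?M 3 1 * \<alpha> 3 + ?M 3 2 * \<beta> 3 + ?M 3 3 * \<gamma> 3) + f z * (?M 3 1 * \<alpha> 4 + ?M 3 2 * \<beta> 4 + ?M 3 3 * \<gamma> 4)"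
        by (simp add: algebra_simps)
      also have "\<dots> = 0" unfolding r(3)[symmetric] by simp
      finally show ?thesis using dM a b by simp
    qed
    have d: "?M 4 4 * total_deriv f ?X z = ?m 4 4"
    proof -
      have "?M 4 1 * (\<alpha> 1 + z$3 * \<alpha> 2 + z$4 * \<alpha> 3 + f z * \<alpha> 4) + ?M 4 4 * total_deriv f ?X z
        = (?M 4 1 * \<alpha> 1 + ?M 4 4 * pd 1 ?X z) + z$3 * (?M 4 1 * \<alpha> 2 + ?M 4 4 * pd 2 ?X z)
         + z$4 * (?M 4 1 * \<alpha> 3 + ?M 4 4 * pd 3 ?X z) + f z * (?M 4 1 * \<alpha> 4 + ?M 4 4 * pd 4 ?X z)"
        by (simp add: total_deriv_def algebra_simps)
      also have "\<dots> = ?m 4 4" unfolding r(4)[symmetric] by (simp add: algebra_simps)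
      finally show ?thesis using a by simp
    qed
    show ?thesis using X0 U0 tot a b c d dm dM \<alpha>2 by (auto simp: \<alpha>_def)
  qed
  \<comment> \<open>The section of the projection through \<open>z0\<close>, along which
    \<open>\<phi>\<close> and \<open>\<psi>\<close> are read off.\<close>
  define \<iota> :: "complex^2 \<Rightarrow> complex^4" where "\<iota> y = vector [y$1, y$2, z0$3, z0$4]" for y
  have \<iota>n [simp]: "\<iota> y $ 1 = y$1" "\<iota> y $ 2 = y$2" "\<iota> y $ 3 = z0$3" "\<iota> y $ 4 = z0$4" for y by (simp_all add: \<iota>_def)
  have \<iota>h: "holo_at (\<lambda>y. \<iota> y $ m) y" for m y
  proof -
    have "\<forall>m. holo_at (\<lambda>y. \<iota> y $ m) y" unfolding forall_4 by simp
    then show ?thesis ..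
  qed
  define W where "W = \<iota> -` ?B"
  have W: "open W" unfolding W_def using isCont_vecI[of \<iota>, OF \<iota>h] by (simp add: continuous_at_imp_continuous_on open_vimage)
  have \<iota>z0: "\<iota> (base_pt z0) = z0" unfolding vec_eq_iff forall_4 by simp
  have mem: "\<iota> (base_pt z) \<in> ?B" if "z \<in> ?B" for z
  proof -
    have "norm (\<iota> (base_pt z) - z0) \<le> norm (z - z0)"
      unfolding norm_vec_def L2_set_def by (simp add: sum_4)
    then show ?thesis using that by (simp add: dist_norm norm_minus_commute)
  qed
  define \<phi> where "\<phi> y = ?X (\<iota> y)" for y
  define \<psi> where "\<psi> y = ?U (\<iota> y)" for y
  have hW: "holo_on \<phi> W" "holo_on \<psi> W"
    unfolding holo_on_iff \<phi>_def[abs_def] \<psi>_def[abs_def] using W holo_at_chain(1)[OF ho \<iota>h] by (auto simp: W_def)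
  have pdW: "pd 1 \<phi> y = pd 1 ?X (\<iota> y)" "pd 2 \<phi> y = pd 2 ?X (\<iota> y)" "pd 1 \<psi> y = pd 1 ?U (\<iota> y)" "pd 2 \<psi> y = pd 2 ?U (\<iota> y)"
    if "y \<in> W" for y
  proof -
    have B: "\<iota> y \<in> ?B" using that by (simp add: W_def)
    have "pd i (\<lambda>y. \<Phi> (\<iota> y) $ m) y = (\<Sum>k\<in>UNIV. pd k (\<lambda>z. \<Phi> z $ m) (\<iota> y) * pd i (\<lambda>y. \<iota> y $ k) y)" for i m
      by (rule holo_at_chain(2)[OF ho[OF B] \<iota>h])
    then show "pd 1 \<phi> y = pd 1 ?X (\<iota> y)" "pd 2 \<phi> y = pd 2 ?X (\<iota> y)" "pd 1 \<psi> y = pd 1 ?U (\<iota> y)" "pd 2 \<psi> y = pd 2 ?U (\<iota> y)"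
      unfolding \<phi>_def[abs_def] \<psi>_def[abs_def] by (simp_all add: sum_4)
  qed
  have liftX: "lift \<phi> z = ?X z" "lift \<psi> z = ?U z" if z: "z \<in> ?B" for z
  proof -
    show "lift \<phi> z = ?X z" unfolding lift_def \<phi>_def
      by (rule constant_along_fibre[OF \<Phi> _ _ mem[OF z] z]) (use facts in auto)
    show "lift \<psi> z = ?U z" unfolding lift_def \<psi>_def
      by (rule constant_along_fibre[OF \<Phi> _ _ mem[OF z] z]) (use facts in auto)
  qed
  have tX: "total_deriv f (lift \<phi>) z = total_deriv f ?X z" if z: "z \<in> ?B" for z
    by (rule total_deriv_cong_open[OF open_ball z _ ho[OF z]], rule liftX)
  have tU: "total_deriv f (lift \<psi>) z = total_deriv f ?U z" if z: "z \<in> ?B" for z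
    by (rule total_deriv_cong_open[OF open_ball z _ ho[OF z]], rule liftX)
  have pp: "prol_p f \<phi> \<psi> z = ?P z" if z: "z \<in> ?B" for z
    using facts[OF z] by (simp add: prol_p_def tX[OF z] tU[OF z])
  have tP: "total_deriv f (prol_p f \<phi> \<psi>) z = total_deriv f ?P z" if z: "z \<in> ?B" for z
    by (rule total_deriv_cong_open[OF open_ball z _ ho[OF z]], rule pp)
  have pq: "prol_q f \<phi> \<psi> z = ?Q z" if z: "z \<in> ?B" for z
    using facts[OF z] by (simp add: prol_q_def tX[OF z] tP[OF z])
  have tQ: "total_deriv f (prol_q f \<phi> \<psi>) z = total_deriv f ?Q z" if z: "z \<in> ?B" for z
    by (rule total_deriv_cong_open[OF open_ball z _ ho[OF z]], rule pq)
  have prr: "prol_r f \<phi> \<psi> z = F (\<Phi> z)" if z: "z \<in> ?B" for z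
    using facts[OF z] by (simp add: prol_r_def tX[OF z] tQ[OF z])
  have prl: "prolong f \<phi> \<psi> z = \<Phi> z" if z: "z \<in> ?B" for z
    unfolding vec_eq_iff forall_4 prolong_def using liftX[OF z] pp[OF z] pq[OF z] by simp
  have z0B: "z0 \<in> ?B" using \<epsilon> by simp
  have jac: "pd 1 \<phi> y * pd 2 \<psi> y - pd 2 \<phi> y * pd 1 \<psi> y \<noteq> 0" if y: "y \<in> W" for y
  proof -
    have B: "\<iota> y \<in> ?B" using y by (simp add: W_def)
    have t: "total_deriv f g (\<iota> y) = pd 1 g (\<iota> y) + z0$3 * pd 2 g (\<iota> y)" if "pd 3 g (\<iota> y) = 0" "pd 4 g (\<iota> y) = 0" for g
      using that by (simp add: total_deriv_def)
    have "pd 1 ?U (\<iota> y) + z0$3 * pd 2 ?U (\<iota> y) = ?P (\<iota> y) * (pd 1 ?X (\<iota> y) + z0$3 * pd 2 ?X (\<iota> y))"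
      using facts[OF B] t[of ?U] t[of ?X] by simp
    \<comment> \<open>The Jacobian is the total derivative of the new \<open>x\<close> times the coefficient
      of \<open>du\<close> in the pulled back contact form.\<close>
    then have "pd 1 ?X (\<iota> y) * pd 2 ?U (\<iota> y) - pd 2 ?X (\<iota> y) * pd 1 ?U (\<iota> y)
      = (pd 1 ?X (\<iota> y) + z0$3 * pd 2 ?X (\<iota> y)) * (pd 2 ?U (\<iota> y) - ?P (\<iota> y) * pd 2 ?X (\<iota> y))" by algebra
    moreover have "pd 1 ?X (\<iota> y) + z0$3 * pd 2 ?X (\<iota> y) \<noteq> 0" "pd 2 ?U (\<iota> y) - ?P (\<iota> y) * pd 2 ?X (\<iota> y) \<noteq> 0"
      using facts[OF B] t[of ?X] by auto
    ultimately show ?thesis unfolding pdW[OF y] by simp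
  qed
  have "\<forall>\<^sub>F z in nhds z0. F (prolong f \<phi> \<psi> z) = prol_r f \<phi> \<psi> z"
    using eventually_nhds_in_open[OF open_ball z0B] by eventually_elim (simp add: prl prr)
  moreover have "base_pt z0 \<in> W" using \<iota>z0 z0B by (simp add: W_def)
  moreover have "total_deriv f (lift \<phi>) z0 \<noteq> 0" using facts[OF z0B] tX[OF z0B] by simp
  moreover have "prolong f \<phi> \<psi> z0 = w" using prl[OF z0B] \<Phi>0 by simp
  ultimately show ?thesis unfolding point_equivalent_at_def using hW jac by blast
qed

section \<open>Structure functions of the canonical forms\<close>

lemma holo_at_compose:
  assumes g: "holo_at g z" and \<phi>: "(\<phi> has_field_derivative d) (at (g z))"
  shows "holo_at (\<lambda>z. \<phi> (g z)) z"
proof -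
  obtain D where D: "(g has_derivative D) (at z)" "\<forall>c v. D (c *s v) = c * D v" using g by (auto simp: holo_at_def)
  have "((\<lambda>z. \<phi> (g z)) has_derivative (\<lambda>v. d * D v)) (at z)"
    using diff_chain_at[OF D(1) \<phi>[unfolded has_field_derivative_def]] by (simp add: o_def)
  then show ?thesis unfolding holo_at_def using D(2) by (intro exI[of _ "\<lambda>v. d * D v"]) simp
qed

text \<open>
  Near \<open>z\<close> a continuous square root of \<open>g\<close> is \<open>r z * csqrt (g y / g
  z)\<close>: the quotient \<open>r y / r z\<close> has positive real part by continuity, so it is
  the principal root of its square.
\<close>

lemma holo_at_square_root:
  fixes r g :: "complex^'n::finite \<Rightarrow> complex"
  assumes V: "open V" "z \<in> V" and r: "continuous_on V r" and sq: "\<And>y. y \<in> V \<Longrightarrow> (r y)\<^sup>2 = g y"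
    and g: "holo_at g z" and nz: "g z \<noteq> 0"
  shows "holo_at r z" "pd i r z = pd i g z / (2 * r z)"
proof -
  have rz: "r z \<noteq> 0" using sq[OF V(2)] nz by auto
  have "isCont r z" using r V by (simp add: continuous_on_eq_continuous_at)
  then have "((\<lambda>y. Re (r y / r z)) \<longlongrightarrow> Re (r z / r z)) (at z)"
    unfolding isCont_def using rz by (intro tendsto_Re tendsto_divide tendsto_const)
  then have "((\<lambda>y. Re (r y / r z)) \<longlongrightarrow> 1) (at z)" using rz by simp
  then have "\<forall>\<^sub>F y in at z. Re (r y / r z) > 0" by (rule order_tendstoD) simp
  then have pos: "\<forall>\<^sub>F y in nhds z. Re (r y / r z) > 0" using rz by (simp add: eventually_nhds_conv_at)
  have ev: "\<forall>\<^sub>F y in nhds z. r z * csqrt (g y / g z) = r y"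
    using pos eventually_nhds_in_open[OF V]
  proof eventually_elim
    case (elim y)
    have "g y / g z = (r y / r z)\<^sup>2" using sq[OF elim(2)] sq[OF V(2)] by (simp add: power_divide)
    then have "csqrt (g y / g z) = r y / r z" using elim(1) by (simp add: csqrt_square)
    then show ?case using rz by simp
  qed
  have q: "holo_at (\<lambda>y. g y / g z) z" using g nz by simp
  have c: "(csqrt has_field_derivative inverse (2 * csqrt (g z / g z))) (at (g z / g z))"
    by (rule has_field_derivative_csqrt) (use nz in auto)
  have "holo_at (\<lambda>y. csqrt (g y / g z)) z"
    by (rule holo_at_compose[where g = "\<lambda>y. g y / g z", OF q c])
  then have "holo_at (\<lambda>y. r z * csqrt (g y / g z)) z" by simp
  from holo_at_transform(1)[OF this ev] show hr: "holo_at r z" .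
  have "pd i (\<lambda>y. (r y)\<^sup>2) z = pd i g z"
    by (rule derivatives_cong_open(2)[OF V _ g]) (rule sq)
  then show "pd i r z = pd i g z / (2 * r z)" using hr rz by (simp add: field_simps)
qed

text \<open>
  The structure equations of an adapted matrix whose entries do not depend on \<open>u\<close>, with
  all derivatives replaced by given values. The premises \<open>e112, \<dots>, e434\<close> are
  named after the structure functions they verify; the other five equations hold by normalization.
\<close>

lemma structure_functions_adapted_matrixI:
  assumes f: "holo_at f z" and hol: "holo_at l z" "holo_at h z" "holo_at B z" "holo_at G z" "holo_at E z" "holo_at K z"
    and N: "normalized T"
    and u: "pd 2 f z = 0" "pd 2 l z = 0" "pd 2 h z = 0" "pd 2 B z = 0" "pd 2 G z = 0" "pd 2 E z = 0" "pd 2 K z = 0"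
    and p: "pd 3 f z = f2" "pd 3 l z = l2" "pd 3 h z = h2" "pd 3 B z = B2" "pd 3 G z = G2" "pd 3 E z = E2" "pd 3 K z = K2"
    and q: "pd 4 f z = f3" "pd 4 l z = l3" "pd 4 h z = h3" "pd 4 B z = B3" "pd 4 G z = G3" "pd 4 E z = E3" "pd 4 K z = K3"
    and D: "total_deriv f l z = l4" "total_deriv f h z = h4" "total_deriv f B z = B4" "total_deriv f G z = G4" "total_deriv f E z = E4" "total_deriv f K z = K4"
    and e112: "- (l z * h z * l2 + l z * h z * l2 + l z * l z * h2) = T 1 1 2 * ((l z * l z * h z) * (l z * h z)) + T 1 1 3 * ((l z * l z * h z) * (h z * G z)) + ((l z * h z) * (l z * K z))"
    and e113: "- (l z * h z * l3 + l z * h z * l3 + l z * l z * h3) = T 1 1 3 * ((l z * l z * h z) * h z)"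
    and e114: "- (l z * h z * l4 + l z * h z * l4 + l z * l z * h4) = T 1 1 4 * ((l z * l z * h z) * l z) - ((l z * h z * B z) * l z)"
    and e212: "- (h z * B z * l2 + l z * B z * h2 + l z * h z * B2) = T 2 1 2 * ((l z * l z * h z) * (l z * h z)) + ((l z * l z * h z) * (h z * G z)) + T 2 2 3 * ((l z * h z * B z) * (h z * G z)) - T 2 2 3 * ((l z * h z) * (h z * E z)) - T 2 2 4 * ((l z * h z) * (l z * K z)) + ((h z * G z) * (l z * K z))"
    and e213: "- (h z * B z * l3 + l z * B z * h3 + l z * h z * B3) = ((l z * l z * h z) * h z) + T 2 2 3 * ((l z * h z * B z) * h z) + (h z * (l z * K z))"
    and e223: "- (h z * l3 + l z * h3) = T 2 2 3 * ((l z * h z) * h z)"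
    and e214: "- (h z * B z * l4 + l z * B z * h4 + l z * h z * B4) = T 2 1 4 * ((l z * l z * h z) * l z) + T 2 2 4 * ((l z * h z * B z) * l z) - ((h z * E z) * l z)"
    and e224: "- (h z * l4 + l z * h4) - (l z * h z * B z) = T 2 2 4 * ((l z * h z) * l z) - ((h z * G z) * l z)"
    and e312: "- (E z * h2 + h z * E2) = T 3 1 2 * ((l z * l z * h z) * (l z * h z)) + T 3 1 3 * ((l z * l z * h z) * (h z * G z)) + T 3 2 3 * ((l z * h z * B z) * (h z * G z)) - T 3 2 3 * ((l z * h z) * (h z * E z)) - T 3 2 4 * ((l z * h z) * (l z * K z)) - T 3 3 4 * ((h z * G z) * (l z * K z))"
    and e313: "- (E z * h3 + h z * E3) = T 3 1 3 * ((l z * l z * h z) * h z) + T 3 2 3 * ((l z * h z * B z) * h z) - T 3 3 4 * (h z * (l z * K z))"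
    and e323: "h2 - (G z * h3 + h z * G3) = T 3 2 3 * ((l z * h z) * h z)"
    and e314: "- (E z * h4 + h z * E4) = T 3 2 4 * ((l z * h z * B z) * l z) + T 3 3 4 * ((h z * E z) * l z)"
    and e324: "- (G z * h4 + h z * G4) - (h z * E z) - h z * f2 = T 3 2 4 * ((l z * h z) * l z) + T 3 3 4 * ((h z * G z) * l z)"
    and e334: "- h4 - (h z * G z) - h z * f3 = T 3 3 4 * (h z * l z)"
    and e412: "- (K z * l2 + l z * K2) = ((l z * l z * h z) * (h z * G z)) - T 4 2 4 * ((l z * h z) * (l z * K z)) - T 4 3 4 * ((h z * G z) * (l z * K z))"
    and e413: "- (K z * l3 + l z * K3) = ((l z * l z * h z) * h z) - T 4 3 4 * (h z * (l z * K z))"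
    and e414: "- (K z * l4 + l z * K4) = T 4 1 4 * ((l z * l z * h z) * l z) + T 4 2 4 * ((l z * h z * B z) * l z) + T 4 3 4 * ((h z * E z) * l z)"
    and e424: "l2 - (l z * K z) = T 4 2 4 * ((l z * h z) * l z) + T 4 3 4 * ((h z * G z) * l z)"
    and e434: "l3 = T 4 3 4 * (h z * l z)"
  shows "structure_functions_at (\<lambda>y. adapted_matrix (l y) (h y) (B y) (G y) (E y) (K y) ** base_coframe f y) z T"
proof -
  have n: "T 1 2 3 = 0" "T 1 2 4 = - 1" "T 1 3 4 = 0" "T 2 1 3 = 1" "T 2 3 4 = - 1" "T 3 1 4 = 0"
     "T 4 1 2 = 0" "T 4 1 3 = 1" "T 4 2 3 = 0"
    using N by (auto simp: normalized_def)
  have hp: "holo_at (\<lambda>y. l y * l y) z" "holo_at (\<lambda>y. l y * h y) z" using hol by auto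
  note R = adapted_matrix_nth pd_const total_deriv_const n u p q D
    pd_mult[OF hp(1) hol(2)] pd_mult[OF hp(2) hol(3)] pd_mult[OF hol(1) hol(1)] pd_mult[OF hol(1) hol(2)]
    pd_mult[OF hol(2) hol(5)] pd_mult[OF hol(2) hol(4)] pd_mult[OF hol(1) hol(6)]
    total_deriv_mult[OF hp(1) hol(2)] total_deriv_mult[OF hp(2) hol(3)] total_deriv_mult[OF hol(1) hol(1)] total_deriv_mult[OF hol(1) hol(2)]
    total_deriv_mult[OF hol(2) hol(5)] total_deriv_mult[OF hol(2) hol(4)] total_deriv_mult[OF hol(1) hol(6)]
  show ?thesis
    unfolding structure_functions_shape[OF f holo_at_adapted_matrix[OF hol] shape_adapted_matrix] forall_4 R
    by (intro conjI,
        (insert e112, algebra)[1], (insert e113, algebra)[1], (algebra)[1], (insert e114, algebra)[1],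
        (algebra)[1], (algebra)[1], (insert e212, algebra)[1], (insert e213, algebra)[1],
        (insert e223, algebra)[1], (insert e214, algebra)[1], (insert e224, algebra)[1], (algebra)[1],
        (insert e312, algebra)[1], (insert e313, algebra)[1], (insert e323, algebra)[1], (insert e314, algebra)[1],
        (insert e324, algebra)[1], (insert e334, algebra)[1], (insert e412, algebra)[1], (insert e413, algebra)[1],
        (algebra)[1], (insert e414, algebra)[1], (insert e424, algebra)[1], (insert e434, algebra)[1])
qed

text \<open>
  The structure functions of the two canonical forms with a square root. They differ only in the
  value of \<open>c\<close>, which is \<open>T 2 1 2\<close>.
\<close>

definition structure_radical :: "complex \<Rightarrow> 4 \<Rightarrow> 4 \<Rightarrow> 4 \<Rightarrow> complex" where
  "structure_radical c i j k =
    (if i = 1 then (if (j, k) = (1, 2) then 1/2 else if (j, k) = (1, 4) then 1/4 else if (j, k) = (2, 4) then - 1 else 0)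
     else if i = 2 then (if (j, k) = (1, 2) then c else if (j, k) = (1, 3) then 1 else if (j, k) = (1, 4) then - c / 2
       else if (j, k) = (2, 3) then - 2 else if (j, k) = (3, 4) then - 1 else 0)
     else if i = 3 then (if (j, k) = (2, 3) then 1/2 else if (j, k) = (2, 4) then - c / 2 else if (j, k) = (3, 4) then - 1/4 else 0)
     else (if (j, k) = (1, 3) then 1 else if (j, k) = (1, 4) then - c else if (j, k) = (3, 4) then - 2 else 0))"

definition structure_cubic :: "4 \<Rightarrow> 4 \<Rightarrow> 4 \<Rightarrow> complex" where
  "structure_cubic i j k =
    (if i = 1 then (if (j, k) = (1, 2) then - 2/5 else if (j, k) = (1, 3) then - 15 else if (j, k) = (1, 4) then 1/25
       else if (j, k) = (2, 4) then - 1 else 0)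
     else if i = 2 then (if (j, k) = (1, 2) then 2/125 else if (j, k) = (1, 3) then 1 else if (j, k) = (2, 3) then - 5
       else if (j, k) = (2, 4) then 2/25 else if (j, k) = (3, 4) then - 1 else 0)
     else if i = 3 then (if (j, k) = (1, 2) then - 4/3125 else if (j, k) = (1, 3) then - 7/125 else if (j, k) = (2, 3) then 1/5
       else if (j, k) = (3, 4) then 3/25 else 0)
     else (if (j, k) = (1, 3) then 1 else if (j, k) = (1, 4) then - 1/125 else if (j, k) = (2, 4) then 3/5
       else if (j, k) = (3, 4) then 10 else 0))"

lemma normalized_radical: "normalized (structure_radical c)"
  by (simp add: normalized_def structure_radical_def)

lemma normalized_cubic: "normalized structure_cubic"
  by (simp add: normalized_def structure_cubic_def)

lemma coframe_of_adapted_matrix: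
  assumes f: "holo_on f V" and hol: "holo_on l V" "holo_on h V" "holo_on B V" "holo_on G V" "holo_on E V" "holo_on K V"
    and nz: "\<And>y. y \<in> V \<Longrightarrow> l y \<noteq> 0" "\<And>y. y \<in> V \<Longrightarrow> h y \<noteq> 0" and N: "normalized T"
    and S: "\<And>y. y \<in> V \<Longrightarrow> structure_functions_at (\<lambda>y. adapted_matrix (l y) (h y) (B y) (G y) (E y) (K y) ** base_coframe f y) y T"
    and z: "z \<in> V"
  shows "structure_functions_at (coframe f) z T" "I6 f z \<noteq> 0" "I7 f z \<noteq> 0"
proof -
  have V: "open V" using f by (simp add: holo_on_iff)
  note res = adapted_matrix_invariants[OF f hol nz N S]
  show "I6 f z \<noteq> 0" "I7 f z \<noteq> 0" using res z by blast+
  have holz: "holo_at l z" "holo_at h z" "holo_at B z" "holo_at G z" "holo_at E z" "holo_at K z" "holo_at f z"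
    using hol f z by (auto simp: holo_on_iff)
  have "structure_functions_at (coframe f) z T
     \<longleftrightarrow> structure_functions_at (\<lambda>y. adapted_matrix (l y) (h y) (B y) (G y) (E y) (K y) ** base_coframe f y) z T"
  proof (rule structure_functions_cong)
    show "\<forall>\<^sub>F y in nhds z. coframe f y = adapted_matrix (l y) (h y) (B y) (G y) (E y) (K y) ** base_coframe f y"
      using eventually_nhds_in_open[OF V z] by eventually_elim (use res in blast)
    have b: "\<forall>i j. holo_at (\<lambda>y. base_coframe f y $ i $ j) z" unfolding forall_4 using holz by simp
    show "holo_at (\<lambda>y. (adapted_matrix (l y) (h y) (B y) (G y) (E y) (K y) ** base_coframe f y) $ i $ b) z" for i b
      unfolding matrix_mult_nth using b holo_at_adapted_matrix[OF holz(1-6)] by (intro holo_at_add holo_at_mult) auto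
  qed
  then show "structure_functions_at (coframe f) z T" using S[OF z] by simp
qed

lemma canonical3_derivatives:
  assumes can: "canonical3 F V" and y: "y \<in> V"
  shows "open V" "y$4 \<noteq> 0" "F y = (y$4)^3" "holo_at F y" "i \<noteq> 4 \<Longrightarrow> pd i F y = 0" "pd 4 F y = 3 * (y$4)\<^sup>2"
proof -
  have V: "open V" and F: "\<And>y. y \<in> V \<Longrightarrow> F y = (y$4)^3" using can by (auto simp: canonical3_def)
  have h3: "holo_at (\<lambda>y. (y$4)^3) y" by simp
  show "open V" "y$4 \<noteq> 0" "F y = (y$4)^3" using can y by (auto simp: canonical3_def)
  show "holo_at F y" "i \<noteq> 4 \<Longrightarrow> pd i F y = 0" "pd 4 F y = 3 * (y$4)\<^sup>2"
    using derivatives_cong_open[OF V y F h3] by simp_all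
qed

lemma canonical3_coframe:
  assumes can: "canonical3 F V" and z: "z \<in> V"
  shows "holo_on F V" "structure_functions_at (coframe F) z structure_cubic" "I6 F z \<noteq> 0" "I7 F z \<noteq> 0"
proof -
  note V = canonical3_derivatives(1)[OF can z] and q = canonical3_derivatives(2)[OF can]
    and F = canonical3_derivatives(3)[OF can] and dF = canonical3_derivatives(4-6)[OF can]
  show FV: "holo_on F V" using V dF(1) by (simp add: holo_on_iff)
  \<comment> \<open>The values of \<open>I7\<^sup>2 / I6\<close>, \<open>I6 / I7\<close>, \<open>I5 /
    I6\<close>, \<open>I5 / I6 + I1 / 3\<close>, \<open>(I2 + (I5 / I6)\<^sup>2) / 2\<close> and
    \<open>I3\<close>, as required by the formulas for the invariants of an adapted coframe.\<close>
  define l :: "complex^4 \<Rightarrow> complex" where "l y = - 25 * (y$4)^2" for y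
  define h :: "complex^4 \<Rightarrow> complex" where "h y = 1 / (5 * y$4)" for y
  define B :: "complex^4 \<Rightarrow> complex" where "B y = 2 * (y$4)^2" for y
  define G :: "complex^4 \<Rightarrow> complex" where "G y = (y$4)^2" for y
  define E :: "complex^4 \<Rightarrow> complex" where "E y = 2 * (y$4)^4" for y
  define K :: "complex^4 \<Rightarrow> complex" where "K y = y$4" for y
  note defs = l_def h_def B_def G_def E_def K_def
  note adefs = l_def[abs_def] h_def[abs_def] B_def[abs_def] G_def[abs_def] E_def[abs_def] K_def[abs_def]
  have hol: "holo_at l y" "holo_at h y" "holo_at B y" "holo_at G y" "holo_at E y" "holo_at K y" if "y \<in> V" for y
    unfolding adefs using q[OF that] by simp_all
  have S: "structure_functions_at (\<lambda>y. adapted_matrix (l y) (h y) (B y) (G y) (E y) (K y) ** base_coframe F y) y structure_cubic"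
    if y: "y \<in> V" for y
  proof -
    have q0: "y$4 \<noteq> 0" by (rule q[OF y])
    have t: "total_deriv F g y = pd 1 g y + y$3 * pd 2 g y + y$4 * pd 3 g y + (y$4)^3 * pd 4 g y" for g
      by (simp add: total_deriv_def F[OF y])
    have z0: "pd i l y = 0" "pd i h y = 0" "pd i B y = 0" "pd i G y = 0" "pd i E y = 0" "pd i K y = 0" "pd i F y = 0" if "i \<noteq> 4" for i
      unfolding adefs using that q0 dF(2)[OF y] by simp_all
    have d: "pd 4 l y = - 50 * y$4" "pd 4 h y = - 1 / (5 * (y$4)^2)" "pd 4 B y = 4 * y$4" "pd 4 G y = 2 * y$4"
      "pd 4 E y = 8 * (y$4)^3" "pd 4 K y = 1" "pd 4 F y = 3 * (y$4)^2"
      unfolding adefs dF(3)[OF y] using q0 by (simp_all add: field_simps power2_eq_square)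
    have u: "pd 2 F y = 0" "pd 2 l y = 0" "pd 2 h y = 0" "pd 2 B y = 0" "pd 2 G y = 0" "pd 2 E y = 0" "pd 2 K y = 0"
      and P: "pd 3 F y = 0" "pd 3 l y = 0" "pd 3 h y = 0" "pd 3 B y = 0" "pd 3 G y = 0" "pd 3 E y = 0" "pd 3 K y = 0"
      by (simp_all add: z0)
    have D: "total_deriv F l y = - 50 * (y$4)^4" "total_deriv F h y = - y$4 / 5" "total_deriv F B y = 4 * (y$4)^4"
      "total_deriv F G y = 2 * (y$4)^4" "total_deriv F E y = 8 * (y$4)^6" "total_deriv F K y = (y$4)^3"
      using q0 by (simp_all add: z0 d t field_simps eval_nat_numeral)
    show ?thesis
      by (rule structure_functions_adapted_matrixI[OF dF(1)[OF y] hol[OF y] normalized_cubic u P d(7,1-6) D];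
          unfold defs structure_cubic_def; use q0 in simp;
          (simp add: field_simps eval_nat_numeral)?)
  qed
  have hV: "holo_on l V" "holo_on h V" "holo_on B V" "holo_on G V" "holo_on E V" "holo_on K V"
    using hol V by (simp_all add: holo_on_iff)
  have nz: "l y \<noteq> 0" "h y \<noteq> 0" if "y \<in> V" for y using q[OF that] by (simp_all add: defs)
  show "structure_functions_at (coframe F) z structure_cubic" "I6 F z \<noteq> 0" "I7 F z \<noteq> 0"
    using coframe_of_adapted_matrix[OF FV hV nz normalized_cubic S z] by auto
qed

text \<open>
  The data that a chosen branch \<open>r\<close> of the root of \<open>q\<close> provides for the
  form (ii), with the first derivatives needed in all later computations.
\<close>

definition square_root_branch :: "(complex^4 \<Rightarrow> complex) \<Rightarrow> (complex^4) set \<Rightarrow> (complex^4 \<Rightarrow> complex) \<Rightarrow> bool" where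
  "square_root_branch F V r \<longleftrightarrow> open V \<and> (\<forall>y\<in>V. r y \<noteq> 0 \<and> (r y)\<^sup>2 = y$4 \<and> F y = (r y)^3 \<and> holo_at r y \<and>
    (\<forall>i. pd i r y = (if i = 4 then 1 else 0) / (2 * r y)) \<and> holo_at F y \<and>
    (\<forall>i. pd i F y = (if i = 4 then 3 * r y / 2 else 0)))"

lemma canonical2_square_root:
  assumes can: "canonical2 F V"
  shows "\<exists>r. square_root_branch F V r"
proof -
  obtain r where V: "open V" and cr: "continuous_on V r" and q: "\<And>y. y \<in> V \<Longrightarrow> y$4 \<noteq> 0"
    and r: "\<And>y. y \<in> V \<Longrightarrow> (r y)\<^sup>2 = y$4" and F: "\<And>y. y \<in> V \<Longrightarrow> F y = (r y)^3"
    using can unfolding canonical2_def by blast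
  have nzr: "r y \<noteq> 0" if "y \<in> V" for y using q[OF that] r[OF that] by auto
  have hr: "holo_at r y" "pd i r y = (if i = 4 then 1 else 0) / (2 * r y)" if y: "y \<in> V" for y i
    using holo_at_square_root[OF V y cr r holo_at_nth q[OF y]] by auto
  have dF: "holo_at F y" "pd i F y = pd i (\<lambda>y. (r y)^3) y" if y: "y \<in> V" for y i
    using derivatives_cong_open[OF V y F holo_at_power[OF hr(1)[OF y]]] by auto
  have dF': "pd i F y = (if i = 4 then 3 * r y / 2 else 0)" if y: "y \<in> V" for y i
    unfolding dF(2)[OF y] using hr(1)[OF y] nzr[OF y] by (simp add: hr(2)[OF y] power2_eq_square)
  show ?thesis unfolding square_root_branch_def
    using V nzr r F hr dF(1) dF' by (intro exI[of _ r] conjI ballI allI) auto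
qed

lemma canonical2_coframe:
  assumes can: "canonical2 F V" and z: "z \<in> V"
  shows "holo_on F V" "structure_functions_at (coframe F) z (structure_radical (3/16))" "I6 F z \<noteq> 0" "I7 F z \<noteq> 0"
proof -
  obtain r where "square_root_branch F V r" using canonical2_square_root[OF can] ..
  then have V: "open V" and br: "\<forall>y\<in>V. r y \<noteq> 0" "\<forall>y\<in>V. (r y)\<^sup>2 = y$4" "\<forall>y\<in>V. F y = (r y)^3" "\<forall>y\<in>V. holo_at r y"
      "\<forall>y\<in>V. \<forall>i. pd i r y = (if i = 4 then 1 else 0) / (2 * r y)" "\<forall>y\<in>V. holo_at F y"
      "\<forall>y\<in>V. \<forall>i. pd i F y = (if i = 4 then 3 * r y / 2 else 0)"
    unfolding square_root_branch_def by blast+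
  note nzr = br(1)[rule_format] and r = br(2)[rule_format] and F = br(3)[rule_format] and hr = br(4,5)[rule_format] and dF = br(6,7)[rule_format]
  show FV: "holo_on F V" using V dF(1) by (simp add: holo_on_iff)
  \<comment> \<open>Again \<open>I7\<^sup>2 / I6\<close>, \<open>I6 / I7\<close>, \<open>I5 / I6\<close>,
    \<open>I5 / I6 + I1 / 3\<close>, \<open>(I2 + (I5 / I6)\<^sup>2) / 2\<close> and
    \<open>I3\<close>.\<close>
  define l where "l y = r y" for y
  define h where "h y = - 1 / (4 * (r y)^2)" for y
  define B where "B y = r y / 4" for y
  define G where "G y = - r y / 4" for y
  define E where "E y = - 3 * (r y)^2 / 32" for y
  define K where "K y = 1 / (8 * r y)" for y
  note defs = l_def h_def B_def G_def E_def K_def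
  note adefs = l_def[abs_def] h_def[abs_def] B_def[abs_def] G_def[abs_def] E_def[abs_def] K_def[abs_def]
  have hol: "holo_at l y" "holo_at h y" "holo_at B y" "holo_at G y" "holo_at E y" "holo_at K y" if "y \<in> V" for y
    unfolding adefs using nzr[OF that] hr(1)[OF that] by simp_all
  have S: "structure_functions_at (\<lambda>y. adapted_matrix (l y) (h y) (B y) (G y) (E y) (K y) ** base_coframe F y) y (structure_radical (3/16))"
    if y: "y \<in> V" for y
  proof -
    have r0: "r y \<noteq> 0" by (rule nzr[OF y])
    have t: "total_deriv F g y = pd 1 g y + y$3 * pd 2 g y + y$4 * pd 3 g y + (r y)^3 * pd 4 g y" for g
      by (simp add: total_deriv_def F[OF y])
    have z0: "pd i l y = 0" "pd i h y = 0" "pd i B y = 0" "pd i G y = 0" "pd i E y = 0" "pd i K y = 0" "pd i F y = 0" if "i \<noteq> 4" for i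
      unfolding adefs dF(2)[OF y] using that r0 hr(1)[OF y] by (simp_all add: hr(2)[OF y])
    have d: "pd 4 l y = 1 / (2 * r y)" "pd 4 h y = 1 / (4 * (r y)^4)" "pd 4 B y = 1 / (8 * r y)" "pd 4 G y = - 1 / (8 * r y)"
      "pd 4 E y = - 3 / 32" "pd 4 K y = - 1 / (16 * (r y)^3)" "pd 4 F y = 3 * r y / 2"
      unfolding adefs dF(2)[OF y] using r0 hr(1)[OF y]
      by (simp_all add: hr(2)[OF y] field_simps power2_eq_square power3_eq_cube power4_eq_xxxx)
    have u: "pd 2 F y = 0" "pd 2 l y = 0" "pd 2 h y = 0" "pd 2 B y = 0" "pd 2 G y = 0" "pd 2 E y = 0" "pd 2 K y = 0"
      and P: "pd 3 F y = 0" "pd 3 l y = 0" "pd 3 h y = 0" "pd 3 B y = 0" "pd 3 G y = 0" "pd 3 E y = 0" "pd 3 K y = 0"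
      by (simp_all add: z0)
    have D: "total_deriv F l y = (r y)^2 / 2" "total_deriv F h y = 1 / (4 * r y)" "total_deriv F B y = (r y)^2 / 8"
      "total_deriv F G y = - ((r y)^2 / 8)" "total_deriv F E y = - 3 * (r y)^3 / 32" "total_deriv F K y = - 1/16"
      using r0 by (simp_all add: z0 d t field_simps power2_eq_square power3_eq_cube power4_eq_xxxx)
    show ?thesis
      by (rule structure_functions_adapted_matrixI[OF dF(1)[OF y] hol[OF y] normalized_radical u P d(7,1-6) D];
          unfold defs structure_radical_def; use r0 in simp;
          (simp add: field_simps power2_eq_square power3_eq_cube power4_eq_xxxx)?; algebra?)
  qed
  have hV: "holo_on l V" "holo_on h V" "holo_on B V" "holo_on G V" "holo_on E V" "holo_on K V"
    using hol V by (simp_all add: holo_on_iff)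
  have nz: "l y \<noteq> 0" "h y \<noteq> 0" if "y \<in> V" for y using nzr[OF that] by (simp_all add: defs)
  show "structure_functions_at (coframe F) z (structure_radical (3/16))" "I6 F z \<noteq> 0" "I7 F z \<noteq> 0"
    using coframe_of_adapted_matrix[OF FV hV nz normalized_radical S z] by auto
qed

text \<open>
  The form (i) involves two square roots, but only through their quotient \<open>\<rho> = r /
  s\<close>. Since \<open>q\<close> is \<open>p (\<rho>\<^sup>2 - 1) / (2 x)\<close>, everything
  becomes rational in \<open>x\<close>, \<open>p\<close> and \<open>\<rho>\<close>.
\<close>

definition ratio_branch :: "complex \<Rightarrow> (complex^4 \<Rightarrow> complex) \<Rightarrow> (complex^4) set \<Rightarrow> (complex^4 \<Rightarrow> complex) \<Rightarrow> bool" where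
  "ratio_branch \<alpha> F V \<rho> \<longleftrightarrow> open V \<and> (\<forall>y\<in>V. y$1 \<noteq> 0 \<and> y$3 \<noteq> 0 \<and> \<rho> y \<noteq> 0 \<and> (\<rho> y)\<^sup>2 = (2 * y$1 * y$4 + y$3) / y$3 \<and>
    F y = 3 * (y$4)\<^sup>2 / y$3 + \<alpha> * (\<rho> y)^3 * y$3 / (y$1)\<^sup>2 \<and> holo_at \<rho> y \<and>
    pd 1 \<rho> y = y$4 / (\<rho> y * y$3) \<and> pd 2 \<rho> y = 0 \<and> pd 3 \<rho> y = (1 - (\<rho> y)\<^sup>2) / (2 * \<rho> y * y$3) \<and> pd 4 \<rho> y = y$1 / (\<rho> y * y$3) \<and>
    holo_at F y \<and> pd 1 F y = 3 * \<alpha> * \<rho> y * y$4 / (y$1)\<^sup>2 - 2 * \<alpha> * (\<rho> y)^3 * y$3 / (y$1)^3 \<and> pd 2 F y = 0 \<and>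
    pd 3 F y = \<alpha> * (3 * \<rho> y - (\<rho> y)^3) / (2 * (y$1)\<^sup>2) - 3 * (y$4)\<^sup>2 / (y$3)\<^sup>2 \<and> pd 4 F y = 6 * y$4 / y$3 + 3 * \<alpha> * \<rho> y / y$1)"

lemma canonical1_ratio:
  assumes can: "canonical1 \<alpha> F V"
  shows "\<exists>\<rho>. ratio_branch \<alpha> F V \<rho>"
proof -
  obtain r s where V: "open V" and cr: "continuous_on V r" and cs: "continuous_on V s"
    and nz0: "\<And>y. y \<in> V \<Longrightarrow> y$1 \<noteq> 0" "\<And>y. y \<in> V \<Longrightarrow> y$3 \<noteq> 0" "\<And>y. y \<in> V \<Longrightarrow> 2 * y$1 * y$4 + y$3 \<noteq> 0"
    and r: "\<And>y. y \<in> V \<Longrightarrow> (r y)\<^sup>2 = 2 * y$1 * y$4 + y$3" and s: "\<And>y. y \<in> V \<Longrightarrow> (s y)\<^sup>2 = y$3"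
    and F0: "\<And>y. y \<in> V \<Longrightarrow> F y = 3 * ((y$4)\<^sup>2 / y$3) + \<alpha> * ((r y)^3 / ((y$1)\<^sup>2 * s y))"
    using can unfolding canonical1_def by blast
  have s0: "s y \<noteq> 0" if "y \<in> V" for y using nz0(2)[OF that] s[OF that] by auto
  have r0: "r y \<noteq> 0" if "y \<in> V" for y using nz0(3)[OF that] r[OF that] by auto
  define \<rho> where "\<rho> y = r y / s y" for y
  have \<rho>0: "\<rho> y \<noteq> 0" if "y \<in> V" for y using r0[OF that] s0[OF that] by (simp add: \<rho>_def)
  have \<rho>2: "(\<rho> y)\<^sup>2 = (2 * y$1 * y$4 + y$3) / y$3" if "y \<in> V" for y
    using r[OF that] s[OF that] by (simp add: \<rho>_def power_divide)
  have F: "F y = 3 * (y$4)\<^sup>2 / y$3 + \<alpha> * (\<rho> y)^3 * y$3 / (y$1)\<^sup>2" if y: "y \<in> V" for y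
  proof -
    have "(\<rho> y)^3 * (s y)\<^sup>2 = (r y)^3 / s y" using s0[OF y] by (simp add: \<rho>_def field_simps power2_eq_square power3_eq_cube)
    then have "(r y)^3 / s y = (\<rho> y)^3 * y$3" using s[OF y] by simp
    then show ?thesis using F0[OF y] nz0(1)[OF y] s0[OF y] by (simp add: field_simps)
  qed
  have cont\<rho>: "continuous_on V \<rho>" unfolding \<rho>_def using cr cs s0 by (intro continuous_on_divide) auto
  let ?g = "\<lambda>y::complex^4. (2 * y$1 * y$4 + y$3) / y$3"
  have hg: "holo_at ?g y" if "y \<in> V" for y using nz0(2)[OF that] by simp
  have h\<rho>: "holo_at \<rho> y" "pd i \<rho> y = pd i ?g y / (2 * \<rho> y)" if y: "y \<in> V" for y i
    using holo_at_square_root[OF V y cont\<rho> \<rho>2 hg[OF y]] nz0[OF y] by auto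
  have d\<rho>: "pd 1 \<rho> y = y$4 / (\<rho> y * y$3)" "pd 2 \<rho> y = 0" "pd 3 \<rho> y = (1 - (\<rho> y)\<^sup>2) / (2 * \<rho> y * y$3)" "pd 4 \<rho> y = y$1 / (\<rho> y * y$3)"
    if y: "y \<in> V" for y
    unfolding h\<rho>(2)[OF y] \<rho>2[OF y] using nz0[OF y] \<rho>0[OF y] by (simp_all add: field_simps power2_eq_square)
  let ?F = "\<lambda>y. 3 * (y$4)\<^sup>2 / y$3 + \<alpha> * (\<rho> y)^3 * y$3 / (y$1)\<^sup>2"
  have hF: "holo_at ?F y" if y: "y \<in> V" for y using nz0[OF y] h\<rho>(1)[OF y] by simp
  have dF: "holo_at F y" "pd i F y = pd i ?F y" if y: "y \<in> V" for y i
    using derivatives_cong_open[OF V y F hF[OF y]] by auto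
  have dF': "pd 1 F y = 3 * \<alpha> * \<rho> y * y$4 / (y$1)\<^sup>2 - 2 * \<alpha> * (\<rho> y)^3 * y$3 / (y$1)^3" "pd 2 F y = 0"
    "pd 3 F y = \<alpha> * (3 * \<rho> y - (\<rho> y)^3) / (2 * (y$1)\<^sup>2) - 3 * (y$4)\<^sup>2 / (y$3)\<^sup>2" "pd 4 F y = 6 * y$4 / y$3 + 3 * \<alpha> * \<rho> y / y$1"
    if y: "y \<in> V" for y
    unfolding dF(2)[OF y] using h\<rho>(1)[OF y] nz0[OF y] \<rho>0[OF y]
    by (simp_all add: d\<rho>[OF y]) (simp_all add: field_simps power2_eq_square power3_eq_cube power4_eq_xxxx)
  have "ratio_branch \<alpha> F V \<rho>" unfolding ratio_branch_def
    using V nz0(1,2) \<rho>0 \<rho>2 F h\<rho>(1) d\<rho> dF(1) dF' by blast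
  then show ?thesis by blast
qed

lemma canonical1_coframe:
  assumes \<alpha>: "\<alpha> \<noteq> 0" and can: "canonical1 \<alpha> F V" and z: "z \<in> V"
  shows "holo_on F V" "structure_functions_at (coframe F) z (structure_radical ((3 * \<alpha>\<^sup>2 + 4) / (16 * \<alpha>\<^sup>2)))" "I6 F z \<noteq> 0" "I7 F z \<noteq> 0"
proof -
  obtain \<rho> where "ratio_branch \<alpha> F V \<rho>" using canonical1_ratio[OF can] ..
  then have V: "open V" and br: "\<forall>y\<in>V. y$1 \<noteq> 0" "\<forall>y\<in>V. y$3 \<noteq> 0" "\<forall>y\<in>V. \<rho> y \<noteq> 0"
      "\<forall>y\<in>V. (\<rho> y)\<^sup>2 = (2 * y$1 * y$4 + y$3) / y$3" "\<forall>y\<in>V. F y = 3 * (y$4)\<^sup>2 / y$3 + \<alpha> * (\<rho> y)^3 * y$3 / (y$1)\<^sup>2"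
      "\<forall>y\<in>V. holo_at \<rho> y" "\<forall>y\<in>V. pd 1 \<rho> y = y$4 / (\<rho> y * y$3)" "\<forall>y\<in>V. pd 2 \<rho> y = 0"
      "\<forall>y\<in>V. pd 3 \<rho> y = (1 - (\<rho> y)\<^sup>2) / (2 * \<rho> y * y$3)" "\<forall>y\<in>V. pd 4 \<rho> y = y$1 / (\<rho> y * y$3)"
      "\<forall>y\<in>V. holo_at F y" "\<forall>y\<in>V. pd 2 F y = 0"
      "\<forall>y\<in>V. pd 3 F y = \<alpha> * (3 * \<rho> y - (\<rho> y)^3) / (2 * (y$1)\<^sup>2) - 3 * (y$4)\<^sup>2 / (y$3)\<^sup>2"
      "\<forall>y\<in>V. pd 4 F y = 6 * y$4 / y$3 + 3 * \<alpha> * \<rho> y / y$1"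
    unfolding ratio_branch_def by blast+
  note nz0 = br(1,2)[rule_format] and \<rho>0 = br(3)[rule_format] and \<rho>2 = br(4)[rule_format] and F = br(5)[rule_format]
    and h\<rho> = br(6)[rule_format] and d\<rho> = br(7-10)[rule_format] and dF = br(11-14)[rule_format]
  show FV: "holo_on F V" using V dF(1) by (simp add: holo_on_iff)
  \<comment> \<open>Again \<open>I7\<^sup>2 / I6\<close>, \<open>I6 / I7\<close>, \<open>I5 / I6\<close>,
    \<open>I5 / I6 + I1 / 3\<close>, \<open>(I2 + (I5 / I6)\<^sup>2) / 2\<close> and
    \<open>I3\<close>.\<close>
  define l where "l y = 2 * \<alpha> * \<rho> y / y$1" for y
  define h where "h y = - y$1 / (2 * (\<rho> y)\<^sup>2 * y$3)" for y
  define B where "B y = (\<alpha> * \<rho> y - 1 - (\<rho> y)\<^sup>2) / (2 * y$1)" for y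
  define G where "G y = (1 - 3 * (\<rho> y)\<^sup>2 - \<alpha> * \<rho> y) / (2 * y$1)" for y
  define E where "E y = (4 * (\<rho> y)\<^sup>2 + 2 * \<alpha> * \<rho> y - 6 * \<alpha> * (\<rho> y)^3 - 3 * \<alpha>\<^sup>2 * (\<rho> y)\<^sup>2) / (8 * (y$1)\<^sup>2)" for y
  define K where "K y = (1 + \<alpha> / (2 * \<rho> y)) / y$3" for y
  note defs = l_def h_def B_def G_def E_def K_def
  note adefs = l_def[abs_def] h_def[abs_def] B_def[abs_def] G_def[abs_def] E_def[abs_def] K_def[abs_def]
  have hol: "holo_at l y" "holo_at h y" "holo_at B y" "holo_at G y" "holo_at E y" "holo_at K y" if "y \<in> V" for y
    unfolding adefs using nz0[OF that] \<rho>0[OF that] h\<rho>[OF that] by simp_all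
  have S: "structure_functions_at (\<lambda>y. adapted_matrix (l y) (h y) (B y) (G y) (E y) (K y) ** base_coframe F y) y (structure_radical ((3 * \<alpha>\<^sup>2 + 4) / (16 * \<alpha>\<^sup>2)))"
    if y: "y \<in> V" for y
  proof -
    define x p R where "x = y$1" "p = y$3" "R = \<rho> y"
    note xp = this
    have nz: "x \<noteq> 0" "p \<noteq> 0" "R \<noteq> 0" using nz0[OF y] \<rho>0[OF y] by (simp_all add: xp)
    have q: "y$4 = p * (R\<^sup>2 - 1) / (2 * x)"
      using \<rho>2[OF y] nz unfolding xp[symmetric] by (simp add: field_simps)
    \<comment> \<open>Names for \<open>pd 3 \<rho>\<close>, \<open>pd 4 \<rho>\<close>, the total derivative
      of \<open>\<rho>\<close> and that of \<open>p\<close>; keeping them folded keeps the expressions below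
      small.\<close>
    define R2 R3 R4 p4 where "R2 = (1 - R\<^sup>2) / (2 * R * p)" "R3 = x / (R * p)"
      "R4 = R * ((R\<^sup>2 - 1) / 2 + \<alpha> * R) / x" "p4 = p * (R\<^sup>2 - 1) / (2 * x)"
    note Rd = this
    have d\<rho>': "pd 2 \<rho> y = 0" "pd 3 \<rho> y = R2" "pd 4 \<rho> y = R3" using d\<rho>(2-4)[OF y] by (simp_all add: Rd xp)
    have t\<rho>: "total_deriv F \<rho> y = R4"
      unfolding total_deriv_def d\<rho>(1)[OF y] d\<rho>(2)[OF y] d\<rho>(3)[OF y] d\<rho>(4)[OF y] F[OF y] q xp[symmetric] Rd using nz
      by (simp add: field_simps power2_eq_square power3_eq_cube)
    have tx: "total_deriv F (\<lambda>y. y$1) y = 1" "total_deriv F (\<lambda>y. y$3) y = p4"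
      by (simp_all add: total_deriv_def q Rd)
    note hs = h\<rho>[OF y]
    have u: "pd 2 F y = 0" "pd 2 l y = 0" "pd 2 h y = 0" "pd 2 B y = 0" "pd 2 G y = 0" "pd 2 E y = 0" "pd 2 K y = 0"
      unfolding adefs using hs nz dF(2)[OF y] by (simp_all add: d\<rho>' flip: xp)
    have PF: "pd 3 F y = \<alpha> * (3 * R - R^3) / (2 * x\<^sup>2) - 3 * ((R\<^sup>2 - 1) / (2 * x))\<^sup>2"
        and QF: "pd 4 F y = 3 * (R\<^sup>2 - 1) / x + 3 * \<alpha> * R / x"
      using dF(3,4)[OF y] nz unfolding q xp[symmetric] by (simp_all add: power_divide power_mult_distrib)
    have P: "pd 3 l y = 2 * \<alpha> * R2 / x" "pd 3 h y = x * (2 * R2 * p + R) / (2 * R^3 * p\<^sup>2)"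
        "pd 3 B y = (\<alpha> - 2 * R) * R2 / (2 * x)" "pd 3 G y = (- \<alpha> - 6 * R) * R2 / (2 * x)"
        "pd 3 E y = (8 * R + 2 * \<alpha> - 18 * \<alpha> * R\<^sup>2 - 6 * \<alpha>\<^sup>2 * R) * R2 / (8 * x\<^sup>2)"
        "pd 3 K y = - \<alpha> * R2 / (2 * R\<^sup>2 * p) - (1 + \<alpha> / (2 * R)) / p\<^sup>2"
      unfolding adefs using hs nz
      by (simp_all add: d\<rho>' q flip: xp) (simp_all add: field_simps power2_eq_square power3_eq_cube power4_eq_xxxx)
    have Q: "pd 4 l y = 2 * \<alpha> * R3 / x" "pd 4 h y = x * R3 / (R^3 * p)"
        "pd 4 B y = (\<alpha> - 2 * R) * R3 / (2 * x)" "pd 4 G y = (- \<alpha> - 6 * R) * R3 / (2 * x)"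
        "pd 4 E y = (8 * R + 2 * \<alpha> - 18 * \<alpha> * R\<^sup>2 - 6 * \<alpha>\<^sup>2 * R) * R3 / (8 * x\<^sup>2)"
        "pd 4 K y = - \<alpha> * R3 / (2 * R\<^sup>2 * p)"
      unfolding adefs using hs nz
      by (simp_all add: d\<rho>' q flip: xp) (simp_all add: field_simps power2_eq_square power3_eq_cube power4_eq_xxxx)
    have D: "total_deriv F l y = 2 * \<alpha> * (R4 * x - R) / x\<^sup>2"
        "total_deriv F h y = (2 * R4 * p * x + R * p4 * x - R * p) / (2 * R^3 * p\<^sup>2)"
        "total_deriv F B y = ((\<alpha> - 2 * R) * R4 * x - (\<alpha> * R - 1 - R\<^sup>2)) / (2 * x\<^sup>2)"
        "total_deriv F G y = ((- \<alpha> - 6 * R) * R4 * x - (1 - 3 * R\<^sup>2 - \<alpha> * R)) / (2 * x\<^sup>2)"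
        "total_deriv F E y = ((8 * R + 2 * \<alpha> - 18 * \<alpha> * R\<^sup>2 - 6 * \<alpha>\<^sup>2 * R) * R4 * x
           - 2 * (4 * R\<^sup>2 + 2 * \<alpha> * R - 6 * \<alpha> * R^3 - 3 * \<alpha>\<^sup>2 * R\<^sup>2)) / (8 * x^3)"
        "total_deriv F K y = - \<alpha> * R4 / (2 * R\<^sup>2 * p) - (1 + \<alpha> / (2 * R)) * p4 / p\<^sup>2"
      unfolding adefs using hs nz
      by (simp_all add: t\<rho> tx flip: xp) (simp_all add: field_simps power2_eq_square power3_eq_cube power4_eq_xxxx)
    have vals: "l y = 2 * \<alpha> * R / x" "h y = - x / (2 * R\<^sup>2 * p)" "B y = (\<alpha> * R - 1 - R\<^sup>2) / (2 * x)"
       "G y = (1 - 3 * R\<^sup>2 - \<alpha> * R) / (2 * x)"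
       "E y = (4 * R\<^sup>2 + 2 * \<alpha> * R - 6 * \<alpha> * R^3 - 3 * \<alpha>\<^sup>2 * R\<^sup>2) / (8 * x\<^sup>2)" "K y = (1 + \<alpha> / (2 * R)) / p"
      by (simp_all add: defs xp)
    show ?thesis
      by (rule structure_functions_adapted_matrixI[OF dF(1)[OF y] hol[OF y] normalized_radical u PF P QF Q D];
          unfold vals Rd structure_radical_def; use nz \<alpha> in simp;
          (simp add: field_simps power2_eq_square power3_eq_cube)?; algebra?)
  qed
  have hV: "holo_on l V" "holo_on h V" "holo_on B V" "holo_on G V" "holo_on E V" "holo_on K V"
    using hol V by (simp_all add: holo_on_iff)
  have nz: "l y \<noteq> 0" "h y \<noteq> 0" if "y \<in> V" for y using \<rho>0[OF that] nz0[OF that] \<alpha> by (simp_all add: defs)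
  show "structure_functions_at (coframe F) z (structure_radical ((3 * \<alpha>\<^sup>2 + 4) / (16 * \<alpha>\<^sup>2)))" "I6 F z \<noteq> 0" "I7 F z \<noteq> 0"
    using coframe_of_adapted_matrix[OF FV hV nz normalized_radical S z] by auto
qed

section \<open>Equivalence with a canonical form\<close>

text \<open>
  The coefficient matrix of the structure functions in the structure equations is triangular with
  nonzero diagonal.
\<close>

lemma structure_function_12_unique:
  assumes f: "holo_on f U" and z: "z \<in> U" and nz: "\<And>y. y \<in> U \<Longrightarrow> I6 f y \<noteq> 0" "\<And>y. y \<in> U \<Longrightarrow> I7 f y \<noteq> 0"
    and T: "structure_functions_at (coframe f) z T" "structure_functions_at (coframe f) z T'"
  shows "T i 1 2 = T' i 1 2"
proof -
  have fz: "holo_at f z" using f z by (simp add: holo_on_iff)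
  have Cz: "holo_at (\<lambda>y. coframe_matrix f y $ i $ j) z" for i j
    using holo_on_coframe(1)[OF f nz] z by (simp add: holo_on_iff)
  note iff = structure_functions_shape[OF fz Cz shape_coframe_matrix]
  have cf: "coframe f = (\<lambda>y. coframe_matrix f y ** base_coframe f y)" by (simp add: coframe_eq fun_eq_iff)
  note e = T(1)[unfolded cf iff, rule_format, of i] and e' = T(2)[unfolded cf iff, rule_format, of i]
  define a where "a j k = coframe_matrix f z $ j $ k" for j k
  define d where "d j k = T i j k - T' i j k" for j k
  have nzd: "a 1 1 \<noteq> 0" "a 2 2 \<noteq> 0" "a 3 3 \<noteq> 0" "a 4 4 \<noteq> 0"
    unfolding a_def using coframe_matrix_diagonal[OF nz[OF z]] by auto
  have eq34: "T i 3 4 * (a 3 3 * a 4 4) = T' i 3 4 * (a 3 3 * a 4 4)" using e e' unfolding a_def by metis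
  have eq24: "T i 2 4 * (a 2 2 * a 4 4) + T i 3 4 * (a 3 2 * a 4 4) = T' i 2 4 * (a 2 2 * a 4 4) + T' i 3 4 * (a 3 2 * a 4 4)"
    using e e' unfolding a_def by metis
  have eq23: "T i 2 3 * (a 2 2 * a 3 3) = T' i 2 3 * (a 2 2 * a 3 3)" using e e' unfolding a_def by metis
  have eq13: "T i 1 3 * (a 1 1 * a 3 3) + T i 2 3 * (a 2 1 * a 3 3) - T i 3 4 * (a 3 3 * a 4 1)
     = T' i 1 3 * (a 1 1 * a 3 3) + T' i 2 3 * (a 2 1 * a 3 3) - T' i 3 4 * (a 3 3 * a 4 1)" using e e' unfolding a_def by metis
  have eq12: "T i 1 2 * (a 1 1 * a 2 2) + T i 1 3 * (a 1 1 * a 3 2) + T i 2 3 * (a 2 1 * a 3 2 - a 2 2 * a 3 1)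
         - T i 2 4 * (a 2 2 * a 4 1) - T i 3 4 * (a 3 2 * a 4 1)
     = T' i 1 2 * (a 1 1 * a 2 2) + T' i 1 3 * (a 1 1 * a 3 2) + T' i 2 3 * (a 2 1 * a 3 2 - a 2 2 * a 3 1)
         - T' i 2 4 * (a 2 2 * a 4 1) - T' i 3 4 * (a 3 2 * a 4 1)" using e e' unfolding a_def by metis
  have 34: "T i 3 4 = T' i 3 4" using eq34 nzd by simp
  have 24: "T i 2 4 = T' i 2 4" using eq24 nzd 34 by simp
  have 23: "T i 2 3 = T' i 2 3" using eq23 nzd by simp
  have 13: "T i 1 3 = T' i 1 3" using eq13 nzd 34 23 by simp
  show ?thesis using eq12 nzd 34 24 23 13 by simp
qed

lemma eventually_open_subset:
  assumes f: "holo_on f U" and z0: "z0 \<in> U" and ev: "\<forall>\<^sub>F z in nhds z0. P z"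
  obtains U' where "holo_on f U'" "z0 \<in> U'" "\<And>z. z \<in> U' \<Longrightarrow> P z"
proof -
  obtain S where S: "open S" "z0 \<in> S" "\<And>z. z \<in> S \<Longrightarrow> P z" using ev unfolding eventually_nhds by blast
  show ?thesis by (rule that[of "U \<inter> S"]) (use f z0 S in \<open>auto simp: holo_on_iff\<close>)
qed

text \<open>
  For the converse, the equivalence may be aimed at any point of any member of the family, since all
  members have the structure functions \<open>T\<close>; this is why it suffices that the family is
  not empty.
\<close>

lemma equivalent_to_iff_structure:
  assumes f: "holo_on f U" and z0: "z0 \<in> U" and ex: "\<exists>F V w. C F V \<and> w \<in> V" and N: "normalized T0"
    and canonical: "\<And>F V z. C F V \<Longrightarrow> z \<in> V \<Longrightarrow>
      holo_on F V \<and> structure_functions_at (coframe F) z T0 \<and> I6 F z \<noteq> 0 \<and> I7 F z \<noteq> 0"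
  shows "equivalent_to C f z0 \<longleftrightarrow> invariants_near f z0 \<and> (\<exists>T. canonical_structure C T \<and> constant_structure_near f z0 T)"
    and "equivalent_to C f z0 \<Longrightarrow> constant_structure_near f z0 T0"
proof -
  have can: "C F V \<Longrightarrow> z \<in> V \<Longrightarrow> holo_on F V" "C F V \<Longrightarrow> z \<in> V \<Longrightarrow> structure_functions_at (coframe F) z T0"
      "C F V \<Longrightarrow> z \<in> V \<Longrightarrow> I6 F z \<noteq> 0" "C F V \<Longrightarrow> z \<in> V \<Longrightarrow> I7 F z \<noteq> 0" for F V z
    using canonical[of F V z] by blast+
  have fwd: "invariants_near f z0 \<and> constant_structure_near f z0 T0" if eqv: "equivalent_to C f z0"
  proof -
    obtain F V w where F: "C F V" "w \<in> V" "point_equivalent_at f z0 F w"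
      using eqv unfolding equivalent_to_def by blast
    show ?thesis
      using structure_if_point_equivalent[OF f z0 can(1)[OF F(1,2)] F(2) can(3)[OF F(1)] can(4)[OF F(1)] can(2)[OF F(1)] N F(3)] by blast
  qed
  then show "equivalent_to C f z0 \<Longrightarrow> constant_structure_near f z0 T0" by blast
  have canT0: "canonical_structure C T0" unfolding canonical_structure_def using can(2) by blast
  show "equivalent_to C f z0 \<longleftrightarrow> invariants_near f z0 \<and> (\<exists>T. canonical_structure C T \<and> constant_structure_near f z0 T)"
  proof
    assume "equivalent_to C f z0"
    then show "invariants_near f z0 \<and> (\<exists>T. canonical_structure C T \<and> constant_structure_near f z0 T)"
      using fwd canT0 by blast
  next
    assume "invariants_near f z0 \<and> (\<exists>T. canonical_structure C T \<and> constant_structure_near f z0 T)"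
    then obtain T where inv: "invariants_near f z0" and T: "canonical_structure C T" "constant_structure_near f z0 T" by blast
    have "\<forall>\<^sub>F z in nhds z0. I6 f z \<noteq> 0 \<and> I7 f z \<noteq> 0 \<and> structure_functions_at (coframe f) z T"
      using inv T(2) unfolding invariants_near_def constant_structure_near_def by eventually_elim simp
    from eventually_open_subset[OF f z0 this] obtain U' where U': "holo_on f U'" "z0 \<in> U'"
      "\<And>z. z \<in> U' \<Longrightarrow> I6 f z \<noteq> 0" "\<And>z. z \<in> U' \<Longrightarrow> I7 f z \<noteq> 0" "\<And>z. z \<in> U' \<Longrightarrow> structure_functions_at (coframe f) z T"
      by metis
    obtain F V w where F: "C F V" "w \<in> V" using ex by blast
    have SF: "structure_functions_at (coframe F) y T" if "y \<in> V" for y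
      using T(1) F(1) that unfolding canonical_structure_def by blast
    have "point_equivalent_at f z0 F w"
      by (rule point_equivalent_if_structure[OF U'(1,2) can(1)[OF F(1,2)] F(2) U'(3,4) can(3)[OF F(1)] can(4)[OF F(1)] U'(5) SF])
    then show "equivalent_to C f z0" using F unfolding equivalent_to_def by blast
  qed
qed

lemma open_slit:
  fixes g :: "complex^'n::finite \<Rightarrow> complex"
  assumes "\<And>z. holo_at g z"
  shows "open {z. g z \<notin> \<real>\<^sub>\<le>\<^sub>0}"
proof -
  have "open (g -` (- \<real>\<^sub>\<le>\<^sub>0))"
    using holo_at_continuous[OF assms] by (intro open_vimage) (auto simp: continuous_at_imp_continuous_on open_Compl)
  then show ?thesis by (simp add: vimage_def)
qed

lemma continuous_on_csqrt_comp:
  fixes g :: "complex^'n::finite \<Rightarrow> complex"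
  assumes "\<And>z. holo_at g z" "\<And>z. z \<in> V \<Longrightarrow> g z \<notin> \<real>\<^sub>\<le>\<^sub>0"
  shows "continuous_on V (\<lambda>z. csqrt (g z))"
proof (rule continuous_on_compose2[of "- \<real>\<^sub>\<le>\<^sub>0" csqrt])
  show "continuous_on (- \<real>\<^sub>\<le>\<^sub>0) csqrt" by (rule continuous_on_csqrt; simp)
  show "continuous_on V g" by (rule continuous_at_imp_continuous_on) (use holo_at_continuous[OF assms(1)] in blast)
qed (use assms(2) in auto)

lemma canonical1_exists: "\<exists>F V w. canonical1 \<alpha> F V \<and> w \<in> V"
proof -
  let ?N = "\<lambda>z::complex^4. 2 * z$1 * z$4 + z$3"
  define V :: "(complex^4) set" where "V = {z. z$1 \<notin> \<real>\<^sub>\<le>\<^sub>0} \<inter> {z. z$3 \<notin> \<real>\<^sub>\<le>\<^sub>0} \<inter> {z. ?N z \<notin> \<real>\<^sub>\<le>\<^sub>0}"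
  have h: "holo_at ?N z" for z by simp
  have "open V" unfolding V_def by (intro open_Int open_slit) simp_all
  moreover have "continuous_on V (\<lambda>z. csqrt (?N z))"
    by (rule continuous_on_csqrt_comp[OF h]) (simp add: V_def)
  moreover have "continuous_on V (\<lambda>z. csqrt (z$3))"
    by (rule continuous_on_csqrt_comp[OF holo_at_nth]) (simp add: V_def)
  moreover have "z$1 \<noteq> 0" "z$3 \<noteq> 0" "?N z \<noteq> 0" if "z \<in> V" for z
    using that nonpos_Reals_zero_I[where 'a = complex] unfolding V_def by (metis (mono_tags, lifting) IntD1 IntD2 mem_Collect_eq)+
  ultimately have "canonical1 \<alpha> (\<lambda>z. 3 * ((z$4)\<^sup>2 / z$3) + \<alpha> * (csqrt (?N z) ^ 3 / ((z$1)\<^sup>2 * csqrt (z$3)))) V"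
    unfolding canonical1_def by (intro conjI exI[of _ "\<lambda>z. csqrt (?N z)"] exI[of _ "\<lambda>z. csqrt (z$3)"] ballI) auto
  moreover have "vector [1, 0, 1, 0] \<in> V" by (simp add: V_def complex_nonpos_Reals_iff)
  ultimately show ?thesis by blast
qed

lemma canonical2_exists: "\<exists>F V w. canonical2 F V \<and> w \<in> V"
proof -
  define V :: "(complex^4) set" where "V = {z. z$4 \<notin> \<real>\<^sub>\<le>\<^sub>0}"
  have "open V" unfolding V_def by (intro open_slit) simp
  moreover have "continuous_on V (\<lambda>z. csqrt (z$4))"
    by (rule continuous_on_csqrt_comp[OF holo_at_nth]) (simp add: V_def)
  moreover have "z$4 \<noteq> 0" if "z \<in> V" for z
    using that nonpos_Reals_zero_I[where 'a = complex] unfolding V_def by (metis (mono_tags, lifting) mem_Collect_eq)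
  ultimately have "canonical2 (\<lambda>z. csqrt (z$4) ^ 3) V"
    unfolding canonical2_def by (intro conjI exI[of _ "\<lambda>z. csqrt (z$4)"] ballI) auto
  moreover have "vector [1, 0, 1, 1] \<in> V" by (simp add: V_def complex_nonpos_Reals_iff)
  ultimately show ?thesis by blast
qed

lemma canonical3_exists: "\<exists>F V w. canonical3 F V \<and> w \<in> V"
proof -
  have "open {z :: complex^4. z$4 \<noteq> 0}"
    by (rule open_Collect_neq) (auto intro!: continuous_intros)
  then have "canonical3 (\<lambda>z. (z$4)^3) {z. z$4 \<noteq> 0}" by (simp add: canonical3_def)
  moreover have "vector [1, 0, 1, 1] \<in> {z :: complex^4. z$4 \<noteq> 0}" by simp
  ultimately show ?thesis by blast
qed

text \<open>
  Replacing the root \<open>r\<close> by \<open>- r\<close> changes the sign of the term with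
  \<open>\<alpha>\<close>.
\<close>

lemma canonical1_uminus: "canonical1 (- \<alpha>) F V \<Longrightarrow> canonical1 \<alpha> F V"
  unfolding canonical1_def
  by (elim conjE exE, intro conjI, assumption, rule_tac x = "\<lambda>z. - r z" in exI, rule_tac x = s in exI)
     (auto intro!: continuous_intros)

lemma parameter_injective:
  fixes \<alpha> \<beta> :: complex
  assumes "\<alpha> \<noteq> 0" "\<beta> \<noteq> 0" "(3 * \<alpha>\<^sup>2 + 4) / (16 * \<alpha>\<^sup>2) = (3 * \<beta>\<^sup>2 + 4) / (16 * \<beta>\<^sup>2)"
  shows "\<alpha> = \<beta> \<or> \<alpha> = - \<beta>"
proof -
  have "\<alpha>\<^sup>2 = \<beta>\<^sup>2" using assms by (simp add: field_simps)
  then show ?thesis by (simp add: power2_eq_iff)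
qed

section \<open>The determining equation of point symmetries\<close>

lemma pd_mixed:
  fixes g :: "complex^2 \<Rightarrow> complex"
  assumes g: "holo_on g W" and y: "y \<in> W"
  shows "pd 2 (pd 1 g) y = pd 1 (pd 2 g) y"
    and "pd 2 (pd 1 (pd 1 g)) y = pd 1 (pd 1 (pd 2 g)) y"
    and "pd 2 (pd 1 (pd 2 g)) y = pd 1 (pd 2 (pd 2 g)) y"
proof -
  have W: "open W" using g by (simp add: holo_on_iff)
  have h: "holo_at (pd 1 (pd 2 g)) y" using holo_on_pd[OF holo_on_pd[OF g]] y by (simp add: holo_on_iff)
  show "pd 2 (pd 1 g) y = pd 1 (pd 2 g) y" by (rule pd_commute[OF g y])
  have "pd 2 (pd 1 (pd 1 g)) y = pd 1 (pd 2 (pd 1 g)) y" by (rule pd_commute[OF holo_on_pd[OF g] y])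
  also have "\<dots> = pd 1 (pd 1 (pd 2 g)) y"
    by (rule derivatives_cong_open(2)[OF W y _ h], rule pd_commute[OF g])
  finally show "pd 2 (pd 1 (pd 1 g)) y = pd 1 (pd 1 (pd 2 g)) y" .
  show "pd 2 (pd 1 (pd 2 g)) y = pd 1 (pd 2 (pd 2 g)) y" by (rule pd_commute[OF holo_on_pd[OF g] y])
qed

text \<open>
  The classical prolongation formulas, with mixed derivatives ordered so that \<open>x\<close> comes
  first. As polynomials in \<open>q\<close>, the second and third prolongation have degree 1 and 2
  apart from the term with \<open>f\<close>.
\<close>

lemma prolongation_formulas:
  fixes f :: "complex^4 \<Rightarrow> complex" and \<xi> \<eta> :: "complex^2 \<Rightarrow> complex"
  assumes \<xi>: "holo_on \<xi> W" and \<eta>: "holo_on \<eta> W" and z: "base_pt z \<in> W"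
    and \<eta>1_def: "\<eta>1 = (\<lambda>z. total_deriv f (lift \<eta>) z - z$3 * total_deriv f (lift \<xi>) z)"
    and \<eta>2_def: "\<eta>2 = (\<lambda>z. total_deriv f \<eta>1 z - z$4 * total_deriv f (lift \<xi>) z)"
    and \<eta>3_def: "\<eta>3 = (\<lambda>z. total_deriv f \<eta>2 z - f z * total_deriv f (lift \<xi>) z)"
  defines "p \<equiv> z$3" and "q \<equiv> z$4"
  defines "x \<equiv> \<lambda>g. pd 1 g (base_pt z)" and "u \<equiv> \<lambda>g. pd 2 g (base_pt z)"
  shows "\<eta>1 z = x \<eta> + (u \<eta> - x \<xi>) * p - u \<xi> * p\<^sup>2"
    and "\<eta>2 z = x (pd 1 \<eta>) + (2 * x (pd 2 \<eta>) - x (pd 1 \<xi>)) * p + (u (pd 2 \<eta>) - 2 * x (pd 2 \<xi>)) * p\<^sup>2 - u (pd 2 \<xi>) * p^3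
      + (u \<eta> - 2 * x \<xi> - 3 * u \<xi> * p) * q"
    and "\<eta>3 z = x (pd 1 (pd 1 \<eta>)) + (3 * x (pd 1 (pd 2 \<eta>)) - x (pd 1 (pd 1 \<xi>))) * p
      + 3 * (x (pd 2 (pd 2 \<eta>)) - x (pd 1 (pd 2 \<xi>))) * p\<^sup>2 + (u (pd 2 (pd 2 \<eta>)) - 3 * x (pd 2 (pd 2 \<xi>))) * p^3
      - u (pd 2 (pd 2 \<xi>)) * p^4
      + 3 * (x (pd 2 \<eta>) - x (pd 1 \<xi>) + (u (pd 2 \<eta>) - 3 * x (pd 2 \<xi>)) * p - 2 * u (pd 2 \<xi>) * p\<^sup>2) * q
      - 3 * u \<xi> * q\<^sup>2 + (u \<eta> - 3 * x \<xi> - 4 * u \<xi> * p) * f z"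
proof -
  let ?N = "base_pt -` W"
  have N: "open ?N" using \<xi> by (intro open_base_pt_vimage) (simp add: holo_on_iff)
  have at: "holo_at g (base_pt y)" if "holo_on g W" "y \<in> ?N" for g y using that by (simp add: holo_on_iff)
  note L = holo_at_lift[OF at]
  note hol = \<xi> \<eta> holo_on_pd[OF \<xi>] holo_on_pd[OF \<eta>] holo_on_pd[OF holo_on_pd[OF \<xi>]] holo_on_pd[OF holo_on_pd[OF \<eta>]]
  have t: "total_deriv f (\<lambda>z. z$3) y = y$4" "total_deriv f (\<lambda>z. z$4) y = f y" for y
    by (simp_all add: total_deriv_def)
  have e1: "\<eta>1 y = lift (pd 1 \<eta>) y + (lift (pd 2 \<eta>) y - lift (pd 1 \<xi>) y) * y$3 - lift (pd 2 \<xi>) y * (y$3)\<^sup>2"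
    if y: "y \<in> ?N" for y
    unfolding \<eta>1_def L(6)[OF \<xi> y] L(6)[OF \<eta> y] by (simp add: algebra_simps power2_eq_square)
  have mixed: "lift (pd 2 (pd 1 g)) y = lift (pd 1 (pd 2 g)) y" "lift (pd 2 (pd 1 (pd 1 g))) y = lift (pd 1 (pd 1 (pd 2 g))) y"
     "lift (pd 2 (pd 1 (pd 2 g))) y = lift (pd 1 (pd 2 (pd 2 g))) y" if "holo_on g W" "y \<in> ?N" for g y
    using pd_mixed[OF that(1), of "base_pt y"] that(2) by (auto simp: lift_def)
  note LL = L(6)[OF hol(1)] L(6)[OF hol(2)] L(6)[OF hol(3)] L(6)[OF hol(4)] L(6)[OF hol(5)] L(6)[OF hol(6)]
  note HL = L(1)[OF hol(1)] L(1)[OF hol(2)] L(1)[OF hol(3)] L(1)[OF hol(4)] L(1)[OF hol(5)] L(1)[OF hol(6)]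
  have h1: "holo_at (\<lambda>y. lift (pd 1 \<eta>) y + (lift (pd 2 \<eta>) y - lift (pd 1 \<xi>) y) * y$3 - lift (pd 2 \<xi>) y * (y$3)\<^sup>2) y"
    if y: "y \<in> ?N" for y
    by (intro holo_at_add holo_at_diff holo_at_mult holo_at_power holo_at_nth HL y)
  have D1: "total_deriv f \<eta>1 y = total_deriv f (\<lambda>y. lift (pd 1 \<eta>) y + (lift (pd 2 \<eta>) y - lift (pd 1 \<xi>) y) * y$3 - lift (pd 2 \<xi>) y * (y$3)\<^sup>2) y"
    if y: "y \<in> ?N" for y
    by (rule total_deriv_cong_open[OF N y e1 h1[OF y]])
  have e2: "\<eta>2 y = lift (pd 1 (pd 1 \<eta>)) y + (2 * lift (pd 1 (pd 2 \<eta>)) y - lift (pd 1 (pd 1 \<xi>)) y) * y$3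
      + (lift (pd 2 (pd 2 \<eta>)) y - 2 * lift (pd 1 (pd 2 \<xi>)) y) * (y$3)\<^sup>2 - lift (pd 2 (pd 2 \<xi>)) y * (y$3)^3
      + (lift (pd 2 \<eta>) y - 2 * lift (pd 1 \<xi>) y - 3 * lift (pd 2 \<xi>) y * y$3) * y$4" if y: "y \<in> ?N" for y
    unfolding \<eta>2_def D1[OF y]
    by (simp add: t LL[OF y] HL[OF y] mixed[OF \<xi> y] mixed[OF \<eta> y])
       (simp add: t algebra_simps power2_eq_square power3_eq_cube)
  let ?E2 = "\<lambda>y. lift (pd 1 (pd 1 \<eta>)) y + (2 * lift (pd 1 (pd 2 \<eta>)) y - lift (pd 1 (pd 1 \<xi>)) y) * y$3
      + (lift (pd 2 (pd 2 \<eta>)) y - 2 * lift (pd 1 (pd 2 \<xi>)) y) * (y$3)\<^sup>2 - lift (pd 2 (pd 2 \<xi>)) y * (y$3)^3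
      + (lift (pd 2 \<eta>) y - 2 * lift (pd 1 \<xi>) y - 3 * lift (pd 2 \<xi>) y * y$3) * y$4"
  have h2: "holo_at ?E2 y" if y: "y \<in> ?N" for y
    by (intro holo_at_add holo_at_diff holo_at_mult holo_at_power holo_at_nth holo_at_const HL y)
  have D2: "total_deriv f \<eta>2 y = total_deriv f ?E2 y" if y: "y \<in> ?N" for y
    by (rule total_deriv_cong_open[OF N y e2 h2[OF y]])
  have zN: "z \<in> ?N" using z by simp
  have lz: "lift g z = g (base_pt z)" for g by (simp add: lift_def)
  show "\<eta>1 z = x \<eta> + (u \<eta> - x \<xi>) * p - u \<xi> * p\<^sup>2"
    unfolding e1[OF zN] lz x_def u_def p_def ..
  show "\<eta>2 z = x (pd 1 \<eta>) + (2 * x (pd 2 \<eta>) - x (pd 1 \<xi>)) * p + (u (pd 2 \<eta>) - 2 * x (pd 2 \<xi>)) * p\<^sup>2 - u (pd 2 \<xi>) * p^3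
      + (u \<eta> - 2 * x \<xi> - 3 * u \<xi> * p) * q"
    unfolding e2[OF zN] lz x_def u_def p_def q_def ..
  have "total_deriv f ?E2 z = lift (pd 1 (pd 1 (pd 1 \<eta>))) z + z$3 * lift (pd 1 (pd 1 (pd 2 \<eta>))) z
     + (2 * (lift (pd 1 (pd 1 (pd 2 \<eta>))) z + z$3 * lift (pd 1 (pd 2 (pd 2 \<eta>))) z)
        - (lift (pd 1 (pd 1 (pd 1 \<xi>))) z + z$3 * lift (pd 1 (pd 1 (pd 2 \<xi>))) z)) * z$3
     + (2 * lift (pd 1 (pd 2 \<eta>)) z - lift (pd 1 (pd 1 \<xi>)) z) * z$4
     + (lift (pd 1 (pd 2 (pd 2 \<eta>))) z + z$3 * lift (pd 2 (pd 2 (pd 2 \<eta>))) z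
        - 2 * (lift (pd 1 (pd 1 (pd 2 \<xi>))) z + z$3 * lift (pd 1 (pd 2 (pd 2 \<xi>))) z)) * (z$3)\<^sup>2
     + (lift (pd 2 (pd 2 \<eta>)) z - 2 * lift (pd 1 (pd 2 \<xi>)) z) * (2 * z$3 * z$4)
     - (lift (pd 1 (pd 2 (pd 2 \<xi>))) z + z$3 * lift (pd 2 (pd 2 (pd 2 \<xi>))) z) * (z$3)^3
     - lift (pd 2 (pd 2 \<xi>)) z * (3 * (z$3)\<^sup>2 * z$4)
     + (lift (pd 1 (pd 2 \<eta>)) z + z$3 * lift (pd 2 (pd 2 \<eta>)) z
        - 2 * (lift (pd 1 (pd 1 \<xi>)) z + z$3 * lift (pd 1 (pd 2 \<xi>)) z)
        - 3 * (lift (pd 1 (pd 2 \<xi>)) z + z$3 * lift (pd 2 (pd 2 \<xi>)) z) * z$3 - 3 * lift (pd 2 \<xi>) z * z$4) * z$4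
     + (lift (pd 2 \<eta>) z - 2 * lift (pd 1 \<xi>) z - 3 * lift (pd 2 \<xi>) z * z$3) * f z"
    by (simp add: t LL[OF zN] HL[OF zN] mixed[OF \<xi> zN] mixed[OF \<eta> zN])
       (simp add: t algebra_simps power2_eq_square power3_eq_cube)
  then show "\<eta>3 z = x (pd 1 (pd 1 \<eta>)) + (3 * x (pd 1 (pd 2 \<eta>)) - x (pd 1 (pd 1 \<xi>))) * p
      + 3 * (x (pd 2 (pd 2 \<eta>)) - x (pd 1 (pd 2 \<xi>))) * p\<^sup>2 + (u (pd 2 (pd 2 \<eta>)) - 3 * x (pd 2 (pd 2 \<xi>))) * p^3
      - u (pd 2 (pd 2 \<xi>)) * p^4
      + 3 * (x (pd 2 \<eta>) - x (pd 1 \<xi>) + (u (pd 2 \<eta>) - 3 * x (pd 2 \<xi>)) * p - 2 * u (pd 2 \<xi>) * p\<^sup>2) * q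
      - 3 * u \<xi> * q\<^sup>2 + (u \<eta> - 3 * x \<xi> - 4 * u \<xi> * p) * f z"
    unfolding \<eta>3_def D2[OF zN] L(6)[OF \<xi> zN] lz x_def u_def p_def q_def
    by (simp add: algebra_simps power2_eq_square power3_eq_cube power4_eq_xxxx)
qed

lemma polynomial4_zero:
  fixes S :: "complex set"
  assumes "infinite S" "\<And>t. t \<in> S \<Longrightarrow> c0 + c1 * t + c2 * t\<^sup>2 + c3 * t^3 + c4 * t^4 = 0"
  shows "c0 = 0" "c1 = 0" "c2 = 0" "c3 = 0" "c4 = 0"
proof -
  define c where "c i = (if i = 0 then c0 else if i = 1 then c1 else if i = 2 then c2 else if i = 3 then c3 else c4)" for i :: nat
  have "{..4::nat} = {0, 1, 2, 3, 4}" by auto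
  then have "(\<Sum>i\<le>4. c i * t^i) = c0 + c1 * t + c2 * t\<^sup>2 + c3 * t^3 + c4 * t^4" for t
    by (simp add: c_def)
  then have "S \<subseteq> {t. (\<Sum>i\<le>4. c i * t^i) = 0}" using assms(2) by auto
  then have "infinite {t. (\<Sum>i\<le>4. c i * t^i) = 0}" using assms(1) infinite_super by blast
  then have "\<forall>i\<le>4. c i = 0" using polyfun_finite_roots[of c 4] by blast
  then show "c0 = 0" "c1 = 0" "c2 = 0" "c3 = 0" "c4 = 0"
    by (force simp: c_def dest: spec[of _ "0::nat"] spec[of _ "1::nat"] spec[of _ "2::nat"] spec[of _ "3::nat"] spec[of _ "4::nat"])+
qed

lemma infinite_complex_ball: "\<delta> > 0 \<Longrightarrow> infinite {t::complex. cmod (t - a) < \<delta>}"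
proof -
  assume "\<delta> > 0"
  then have "infinite (ball a \<delta>)" using uncountable_ball countable_finite by blast
  moreover have "ball a \<delta> = {t. cmod (t - a) < \<delta>}" by (auto simp: dist_norm norm_minus_commute)
  ultimately show ?thesis by simp
qed

lemma eventually_nhds_box:
  fixes w :: "complex^4"
  assumes "\<forall>\<^sub>F z in nhds w. P z"
  shows "\<exists>\<delta>>0. \<forall>z. (\<forall>i. cmod (z$i - w$i) < \<delta>) \<longrightarrow> P z"
proof -
  obtain e where e: "e > 0" "\<And>z. dist z w < e \<Longrightarrow> P z" using assms unfolding eventually_nhds_metric by blast
  show ?thesis
  proof (intro exI[of _ "e / 4"] conjI allI impI)
    fix z assume z': "\<forall>i. cmod (z$i - w$i) < e / 4"
    then have z: "cmod (z$i - w$i) < e / 4" for i ..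
    have "norm (z - w) \<le> (\<Sum>i\<in>UNIV. cmod ((z - w)$i))" by (rule norm_vec_le_sum)
    also have "\<dots> < e" using z[of 1] z[of 2] z[of 3] z[of 4] by (simp add: sum_4)
    finally show "P z" by (intro e(2)) (simp add: dist_norm)
  qed (use e in simp)
qed

lemma constant_on_ball:
  fixes g :: "complex^'n::finite \<Rightarrow> complex"
  assumes g: "holo_on g (ball c r)" and d: "\<And>i z. z \<in> ball c r \<Longrightarrow> pd i g z = 0" and z: "z \<in> ball c r"
  shows "g z = g c"
proof -
  have "((\<lambda>t. g (c + t *\<^sub>R (z - c))) has_vector_derivative 0) (at t within {0..1})" if t: "t \<in> {0..1}" for t
  proof -
    have m: "c + t *\<^sub>R (z - c) \<in> ball c r" by (rule segment_in_ball[OF z t])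
    then have "holo_at g (c + t *\<^sub>R (z - c))" using g by (simp add: holo_on_iff del: mem_ball)
    from holo_at_real_line[OF this, of "{0..1}"] show ?thesis using d[OF m] by simp
  qed
  from has_vector_derivative_zero_constant[OF convex_real_interval(5) this]
  obtain k where k: "\<And>t. t \<in> {0..1} \<Longrightarrow> g (c + t *\<^sub>R (z - c)) = k" by metis
  show ?thesis using k[of 0] k[of 1] by simp
qed


text \<open>
  The first prolongation is \<open>sym_P\<close>, the second is \<open>sym_H + sym_R * q\<close>,
  and the third is \<open>sym_A + sym_B * q - 3 * pd 2 \<xi> * q\<^sup>2 + sym_S * f\<close>, each
  coefficient being a polynomial in \<open>p\<close> over functions of \<open>y = (x, u)\<close>.
\<close>

definition sym_P :: "(complex^2 \<Rightarrow> complex) \<Rightarrow> (complex^2 \<Rightarrow> complex) \<Rightarrow> complex^2 \<Rightarrow> complex \<Rightarrow> complex" where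
  "sym_P \<xi> \<eta> y p = pd 1 \<eta> y + (pd 2 \<eta> y - pd 1 \<xi> y) * p - pd 2 \<xi> y * p\<^sup>2"

definition sym_H :: "(complex^2 \<Rightarrow> complex) \<Rightarrow> (complex^2 \<Rightarrow> complex) \<Rightarrow> complex^2 \<Rightarrow> complex \<Rightarrow> complex" where
  "sym_H \<xi> \<eta> y p = pd 1 (pd 1 \<eta>) y + (2 * pd 1 (pd 2 \<eta>) y - pd 1 (pd 1 \<xi>) y) * p
     + (pd 2 (pd 2 \<eta>) y - 2 * pd 1 (pd 2 \<xi>) y) * p\<^sup>2 - pd 2 (pd 2 \<xi>) y * p^3"

definition sym_R :: "(complex^2 \<Rightarrow> complex) \<Rightarrow> (complex^2 \<Rightarrow> complex) \<Rightarrow> complex^2 \<Rightarrow> complex \<Rightarrow> complex" where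
  "sym_R \<xi> \<eta> y p = pd 2 \<eta> y - 2 * pd 1 \<xi> y - 3 * pd 2 \<xi> y * p"

definition sym_A :: "(complex^2 \<Rightarrow> complex) \<Rightarrow> (complex^2 \<Rightarrow> complex) \<Rightarrow> complex^2 \<Rightarrow> complex \<Rightarrow> complex" where
  "sym_A \<xi> \<eta> y p = pd 1 (pd 1 (pd 1 \<eta>)) y + (3 * pd 1 (pd 1 (pd 2 \<eta>)) y - pd 1 (pd 1 (pd 1 \<xi>)) y) * p
      + 3 * (pd 1 (pd 2 (pd 2 \<eta>)) y - pd 1 (pd 1 (pd 2 \<xi>)) y) * p\<^sup>2
      + (pd 2 (pd 2 (pd 2 \<eta>)) y - 3 * pd 1 (pd 2 (pd 2 \<xi>)) y) * p^3 - pd 2 (pd 2 (pd 2 \<xi>)) y * p^4"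

definition sym_B :: "(complex^2 \<Rightarrow> complex) \<Rightarrow> (complex^2 \<Rightarrow> complex) \<Rightarrow> complex^2 \<Rightarrow> complex \<Rightarrow> complex" where
  "sym_B \<xi> \<eta> y p = 3 * (pd 1 (pd 2 \<eta>) y - pd 1 (pd 1 \<xi>) y + (pd 2 (pd 2 \<eta>) y - 3 * pd 1 (pd 2 \<xi>) y) * p
      - 2 * pd 2 (pd 2 \<xi>) y * p\<^sup>2)"

definition sym_S :: "(complex^2 \<Rightarrow> complex) \<Rightarrow> (complex^2 \<Rightarrow> complex) \<Rightarrow> complex^2 \<Rightarrow> complex \<Rightarrow> complex" where
  "sym_S \<xi> \<eta> y p = pd 2 \<eta> y - 3 * pd 1 \<xi> y - 4 * pd 2 \<xi> y * p"

definition determining_eq :: "(complex^4 \<Rightarrow> complex) \<Rightarrow> (complex^2 \<Rightarrow> complex) \<Rightarrow> (complex^2 \<Rightarrow> complex) \<Rightarrow> complex^4 \<Rightarrow> bool" where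
  "determining_eq f \<xi> \<eta> z \<longleftrightarrow> (let y = base_pt z; p = z$3; q = z$4 in
     sym_A \<xi> \<eta> y p + sym_B \<xi> \<eta> y p * q - 3 * pd 2 \<xi> y * q\<^sup>2 + sym_S \<xi> \<eta> y p * f z
     = \<xi> y * pd 1 f z + \<eta> y * pd 2 f z + sym_P \<xi> \<eta> y p * pd 3 f z + (sym_H \<xi> \<eta> y p + sym_R \<xi> \<eta> y p * q) * pd 4 f z)"

lemma point_symmetry_iff:
  "point_symmetry_at f w X \<longleftrightarrow> (\<exists>W. base_pt w \<in> W \<and> holo_on (\<lambda>y. X y $ 1) W \<and> holo_on (\<lambda>y. X y $ 2) W) \<and>
     (\<forall>\<^sub>F z in nhds w. determining_eq f (\<lambda>y. X y $ 1) (\<lambda>y. X y $ 2) z)"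
proof -
  define \<xi> where "\<xi> = (\<lambda>y. X y $ 1)"
  define \<eta> where "\<eta> = (\<lambda>y. X y $ 2)"
  define \<eta>1 where "\<eta>1 = (\<lambda>z. total_deriv f (lift \<eta>) z - z$3 * total_deriv f (lift \<xi>) z)"
  define \<eta>2 where "\<eta>2 = (\<lambda>z. total_deriv f \<eta>1 z - z$4 * total_deriv f (lift \<xi>) z)"
  define \<eta>3 where "\<eta>3 = (\<lambda>z. total_deriv f \<eta>2 z - f z * total_deriv f (lift \<xi>) z)"
  have def: "point_symmetry_at f w X \<longleftrightarrow> (\<exists>W. base_pt w \<in> W \<and> holo_on \<xi> W \<and> holo_on \<eta> W) \<and>
     (\<forall>\<^sub>F z in nhds w. \<eta>3 z = lift \<xi> z * pd 1 f z + lift \<eta> z * pd 2 f z + \<eta>1 z * pd 3 f z + \<eta>2 z * pd 4 f z)"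
    unfolding point_symmetry_at_def Let_def \<eta>3_def \<eta>2_def \<eta>1_def \<xi>_def \<eta>_def by simp
  have "(\<forall>\<^sub>F z in nhds w. \<eta>3 z = lift \<xi> z * pd 1 f z + lift \<eta> z * pd 2 f z + \<eta>1 z * pd 3 f z + \<eta>2 z * pd 4 f z)
    \<longleftrightarrow> (\<forall>\<^sub>F z in nhds w. determining_eq f \<xi> \<eta> z)" if W: "base_pt w \<in> W" "holo_on \<xi> W" "holo_on \<eta> W" for W
  proof (rule eventually_subst)
    have "open (base_pt -` W)" using W by (intro open_base_pt_vimage) (simp add: holo_on_iff)
    moreover have "w \<in> base_pt -` W" using W by simp
    ultimately have "\<forall>\<^sub>F z in nhds w. z \<in> base_pt -` W" by (rule eventually_nhds_in_open)
    then show "\<forall>\<^sub>F z in nhds w. (\<eta>3 z = lift \<xi> z * pd 1 f z + lift \<eta> z * pd 2 f z + \<eta>1 z * pd 3 f z + \<eta>2 z * pd 4 f z) = determining_eq f \<xi> \<eta> z"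
    proof eventually_elim
      case (elim z)
      then have z: "base_pt z \<in> W" by simp
      note pf = prolongation_formulas[OF W(2,3) z \<eta>1_def \<eta>2_def \<eta>3_def]
      show ?case unfolding pf determining_eq_def Let_def sym_A_def sym_B_def sym_S_def sym_P_def sym_H_def sym_R_def lift_def ..
    qed
  qed
  then show ?thesis unfolding def \<xi>_def[symmetric] \<eta>_def[symmetric] by blast
qed

text \<open>
  On a polydisc around \<open>w\<close> the coordinates \<open>p\<close> and \<open>q\<close> vary
  independently of \<open>(x, u)\<close>, which allows a comparison of coefficients.
\<close>

lemma symmetry_local:
  assumes sym: "point_symmetry_at f w X" and V: "open V" "w \<in> V"
  obtains r where "r > 0" "holo_on (\<lambda>y. X y $ 1) (ball (base_pt w) r)" "holo_on (\<lambda>y. X y $ 2) (ball (base_pt w) r)"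
    "\<And>y p q. y \<in> ball (base_pt w) r \<Longrightarrow> cmod (p - w$3) < r \<Longrightarrow> cmod (q - w$4) < r \<Longrightarrow> vector [y$1, y$2, p, q] \<in> V"
    "\<And>y p q. y \<in> ball (base_pt w) r \<Longrightarrow> cmod (p - w$3) < r \<Longrightarrow> cmod (q - w$4) < r \<Longrightarrow>
       determining_eq f (\<lambda>y. X y $ 1) (\<lambda>y. X y $ 2) (vector [y$1, y$2, p, q])"
proof -
  obtain W where W: "base_pt w \<in> W" "holo_on (\<lambda>y. X y $ 1) W" "holo_on (\<lambda>y. X y $ 2) W"
    and ev: "\<forall>\<^sub>F z in nhds w. determining_eq f (\<lambda>y. X y $ 1) (\<lambda>y. X y $ 2) z"
    using sym unfolding point_symmetry_iff by blast
  have "\<forall>\<^sub>F z in nhds w. z \<in> V \<and> determining_eq f (\<lambda>y. X y $ 1) (\<lambda>y. X y $ 2) z"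
    using ev eventually_nhds_in_open[OF V] by eventually_elim simp
  then obtain \<delta> where \<delta>: "\<delta> > 0" "\<And>z. (\<And>i. cmod (z$i - w$i) < \<delta>) \<Longrightarrow> z \<in> V \<and> determining_eq f (\<lambda>y. X y $ 1) (\<lambda>y. X y $ 2) z"
    using eventually_nhds_box[of "\<lambda>z. z \<in> V \<and> determining_eq f (\<lambda>y. X y $ 1) (\<lambda>y. X y $ 2) z" w] by blast
  have "open W" using W by (simp add: holo_on_iff)
  then obtain e where e: "e > 0" "ball (base_pt w) e \<subseteq> W" using W(1) open_contains_ball by blast
  define r where "r = min \<delta> e"
  have r: "r > 0" "ball (base_pt w) r \<subseteq> W" "r \<le> \<delta>" using e \<delta> by (auto simp: r_def)
  have box: "vector [y$1, y$2, p, q] \<in> V \<and> determining_eq f (\<lambda>y. X y $ 1) (\<lambda>y. X y $ 2) (vector [y$1, y$2, p, q])"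
    if y: "y \<in> ball (base_pt w) r" and p: "cmod (p - w$3) < r" and q: "cmod (q - w$4) < r" for y p q
  proof (rule \<delta>(2))
    have n: "cmod (y$i - base_pt w $ i) < \<delta>" for i
      using Finite_Cartesian_Product.norm_nth_le[of "y - base_pt w" i] y r(3) by (simp add: dist_norm norm_minus_commute)
    have "\<forall>i. cmod ((vector [y$1, y$2, p, q] :: complex^4)$i - w$i) < \<delta>"
      unfolding forall_4 using n[of 1] n[of 2] p q r(3) by simp
    then show "cmod ((vector [y$1, y$2, p, q] :: complex^4)$i - w$i) < \<delta>" for i by blast
  qed
  show ?thesis
    by (rule that[OF r(1)]) (use W r(2) box in \<open>auto simp: holo_on_iff\<close>)
qed

lemma pd_zero_on_ball:
  assumes "\<And>y. y \<in> ball c r \<Longrightarrow> g y = 0" "y \<in> ball c r"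
  shows "pd i g y = 0"
  using derivatives_cong_open(2)[OF open_ball assms(2), of g "\<lambda>_. 0"] assms(1) by simp

text \<open>
  A linear family of symmetries, parametrized by four constants, in which every symmetry occurs and
  only the zero parameter gives the zero germ.
\<close>

lemma four_point_symmetriesI:
  fixes S :: "complex^4 \<Rightarrow> complex^2 \<Rightarrow> complex^2"
  assumes lin: "\<And>c y. S c y = (\<Sum>k\<in>UNIV. c$k *s S (axis k 1) y)"
    and sym: "\<And>c. point_symmetry_at f w (S c)"
    and span: "\<And>X. point_symmetry_at f w X \<Longrightarrow> \<exists>c. \<forall>\<^sub>F y in nhds (base_pt w). X y = S c y"
    and indep: "\<And>c. \<forall>\<^sub>F y in nhds (base_pt w). S c y = 0 \<Longrightarrow> c = 0"
  shows "four_point_symmetries_at f w"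
  unfolding four_point_symmetries_at_def
proof (intro exI[of _ "\<lambda>k. S (axis k 1)"] conjI allI impI)
  show "point_symmetry_at f w (S (axis k 1))" for k by (rule sym)
  fix X assume X: "point_symmetry_at f w X"
  obtain c where c: "\<forall>\<^sub>F y in nhds (base_pt w). X y = S c y" using span[OF X] ..
  show "\<exists>!c. \<forall>\<^sub>F y in nhds (base_pt w). X y = (\<Sum>k\<in>UNIV. c$k *s S (axis k 1) y)"
  proof (rule ex1I[of _ c])
    show "\<forall>\<^sub>F y in nhds (base_pt w). X y = (\<Sum>k\<in>UNIV. c$k *s S (axis k 1) y)"
      using c by (simp only: lin[symmetric])
    fix c' :: "complex^4" assume "\<forall>\<^sub>F y in nhds (base_pt w). X y = (\<Sum>k\<in>UNIV. c'$k *s S (axis k 1) y)"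
    then have "\<forall>\<^sub>F y in nhds (base_pt w). X y = S c' y" by (simp only: lin[symmetric])
    with c have "\<forall>\<^sub>F y in nhds (base_pt w). S (c' - c) y = 0"
    proof eventually_elim
      case (elim y)
      have "S (c' - c) y = S c' y - S c y"
        unfolding lin[of "c' - c"] lin[of c'] lin[of c] by (simp add: sum_subtractf[symmetric] vec_eq_iff algebra_simps)
      then show ?case using elim by simp
    qed
    then have "c' - c = 0" by (rule indep)
    then show "c' = c" by simp
  qed
qed

section \<open>Symmetries of the canonical forms\<close>

lemma eventually_zero_derivative:
  fixes g :: "complex^'n::finite \<Rightarrow> complex"
  assumes "\<forall>\<^sub>F y in nhds y0. g y = 0"
  shows "g y0 = 0" "pd i g y0 = 0"
proof -
  show "g y0 = 0" using eventually_nhds_x_imp_x[OF assms] .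
  have "\<forall>\<^sub>F y in nhds y0. 0 = g y" using assms by eventually_elim simp
  from holo_at_transform(2)[OF holo_at_const this] show "pd i g y0 = 0" by simp
qed

lemma vec2_eq_iff: "(x :: complex^2) = y \<longleftrightarrow> x$1 = y$1 \<and> x$2 = y$2"
  by (simp add: vec_eq_iff forall_2)

lemma affine_on_ball:
  fixes g :: "complex^2 \<Rightarrow> complex"
  assumes g: "holo_on g (ball c r)" and d: "\<And>y. y \<in> ball c r \<Longrightarrow> pd 1 g y = a" "\<And>y. y \<in> ball c r \<Longrightarrow> pd 2 g y = b"
  shows "\<exists>k. \<forall>y\<in>ball c r. g y = k + a * y$1 + b * y$2"
proof (intro exI[of _ "g c - a * c$1 - b * c$2"] ballI)
  fix y assume y: "y \<in> ball c r"
  have at: "holo_at g z" if "z \<in> ball c r" for z using g that by (simp add: holo_on_iff)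
  have "(\<lambda>y. g y - a * y$1 - b * y$2) y = (\<lambda>y. g y - a * y$1 - b * y$2) c"
  proof (rule constant_on_ball[OF _ _ y])
    show "holo_on (\<lambda>y. g y - a * y$1 - b * y$2) (ball c r)" using at by (simp add: holo_on_iff)
    fix i :: 2 and z assume z: "z \<in> ball c r"
    show "pd i (\<lambda>y. g y - a * y$1 - b * y$2) z = 0" using at[OF z] d[OF z] exhaust_2[of i] by auto
  qed
  then show "g y = g c - a * c$1 - b * c$2 + a * y$1 + b * y$2" by (simp add: algebra_simps)
qed

text \<open>
  A root \<open>g q\<close> determines \<open>q\<close>, so the branch takes infinitely many values
  on a disc. This allows comparing coefficients with respect to the root in place of
  \<open>q\<close>.
\<close>

lemma infinite_branch_values:
  fixes r :: real
  assumes "r > 0" and h: "\<And>q. cmod (q - q0) < r \<Longrightarrow> h (g q) = q"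
  shows "infinite (g ` {q::complex. cmod (q - q0) < r})"
proof
  assume "finite (g ` {q. cmod (q - q0) < r})"
  then have "finite (h ` g ` {q. cmod (q - q0) < r})" by (rule finite_imageI)
  moreover have "h ` g ` {q. cmod (q - q0) < r} = {q. cmod (q - q0) < r}" using h by (force simp: image_image)
  ultimately show False using infinite_complex_ball[OF assms(1)] by simp
qed

text \<open>
  For \<open>\<xi>\<close> independent of \<open>u\<close>, the coefficients of \<open>sym_B\<close>
  and \<open>sym_H\<close> in \<open>p\<close> give \<open>\<eta>\<^sub>x\<^sub>u =
  \<xi>\<^sub>x\<^sub>x\<close>, \<open>2 \<eta>\<^sub>x\<^sub>u = \<xi>\<^sub>x\<^sub>x\<close> and
  \<open>\<eta>\<^sub>x\<^sub>x = 0\<close>; as \<open>\<eta>\<^sub>u = m \<xi>\<^sub>x\<close>,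
  \<open>\<xi>\<close> and \<open>\<eta>\<close> are affine. Both the second and the third canonical
  form lead to this situation, with \<open>m = 0\<close> and \<open>m = 3/2\<close>.
\<close>

lemma affine_symmetry_components:
  assumes r: "r > 0" and h\<xi>: "holo_on \<xi> (ball c r)" and h\<eta>: "holo_on \<eta> (ball c r)"
    and u: "\<And>y. y \<in> ball c r \<Longrightarrow> pd 2 \<xi> y = 0" "\<And>y. y \<in> ball c r \<Longrightarrow> pd 2 \<eta> y = m * pd 1 \<xi> y"
    and B: "\<And>y p. y \<in> ball c r \<Longrightarrow> cmod (p - p0) < r \<Longrightarrow> sym_B \<xi> \<eta> y p = 0"
    and H: "\<And>y p. y \<in> ball c r \<Longrightarrow> cmod (p - p0) < r \<Longrightarrow> sym_H \<xi> \<eta> y p = 0"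
  shows "\<exists>a b e d. (\<forall>y\<in>ball c r. \<xi> y = a + b * y$1) \<and> (\<forall>y\<in>ball c r. \<eta> y = e + d * y$1 + m * b * y$2)"
proof -
  have pde: "pd 1 (pd 1 \<eta>) y = 0" "pd 1 (pd 2 \<eta>) y = 0" "pd 1 (pd 1 \<xi>) y = 0" if y: "y \<in> ball c r" for y
  proof -
    let ?D = "{p. cmod (p - p0) < r}"
    note inf = infinite_complex_ball[OF r, of p0]
    have H': "pd 1 (pd 1 \<eta>) y + (2 * pd 1 (pd 2 \<eta>) y - pd 1 (pd 1 \<xi>) y) * p
      + (pd 2 (pd 2 \<eta>) y - 2 * pd 1 (pd 2 \<xi>) y) * p\<^sup>2 + (- pd 2 (pd 2 \<xi>) y) * p^3 + 0 * p^4 = 0" if "p \<in> ?D" for p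
      using H[OF y, of p] that by (simp add: sym_H_def)
    note h = polynomial4_zero(1,2)[OF inf H']
    have B': "(pd 1 (pd 2 \<eta>) y - pd 1 (pd 1 \<xi>) y) + (pd 2 (pd 2 \<eta>) y - 3 * pd 1 (pd 2 \<xi>) y) * p
      + (- 2 * pd 2 (pd 2 \<xi>) y) * p\<^sup>2 + 0 * p^3 + 0 * p^4 = 0" if "p \<in> ?D" for p
      using B[OF y, of p] that unfolding sym_B_def mult_eq_0_iff by simp
    note b = polynomial4_zero(1)[OF inf B']
    show "pd 1 (pd 1 \<eta>) y = 0" by (rule h(1))
    have e: "pd 1 (pd 2 \<eta>) y = pd 1 (pd 1 \<xi>) y" "2 * pd 1 (pd 2 \<eta>) y = pd 1 (pd 1 \<xi>) y" using h(2) b by simp_all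
    have "2 * pd 1 (pd 1 \<xi>) y = pd 1 (pd 1 \<xi>) y" using e(2) unfolding e(1) .
    then show "pd 1 (pd 1 \<xi>) y = 0" by simp
    then show "pd 1 (pd 2 \<eta>) y = 0" using e(1) by simp
  qed
  have mixed: "pd 2 (pd 1 \<xi>) y = 0" "pd 2 (pd 1 \<eta>) y = 0" if y: "y \<in> ball c r" for y
    using pd_zero_on_ball[OF u(1) y] pde(2)[OF y] pd_mixed(1)[OF h\<xi> y] pd_mixed(1)[OF h\<eta> y] by simp_all
  obtain b where "\<forall>y\<in>ball c r. pd 1 \<xi> y = b + 0 * y$1 + 0 * y$2" using affine_on_ball[OF holo_on_pd[OF h\<xi>] pde(3) mixed(1)] ..
  then have \<xi>x: "\<And>y. y \<in> ball c r \<Longrightarrow> pd 1 \<xi> y = b" by simp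
  obtain d where "\<forall>y\<in>ball c r. pd 1 \<eta> y = d + 0 * y$1 + 0 * y$2" using affine_on_ball[OF holo_on_pd[OF h\<eta>] pde(1) mixed(2)] ..
  then have \<eta>x: "\<And>y. y \<in> ball c r \<Longrightarrow> pd 1 \<eta> y = d" by simp
  have \<eta>u: "pd 2 \<eta> y = m * b" if "y \<in> ball c r" for y using u(2)[OF that] \<xi>x[OF that] by simp
  obtain a where a: "\<forall>y\<in>ball c r. \<xi> y = a + b * y$1 + 0 * y$2"
    using affine_on_ball[OF h\<xi> \<xi>x u(1)] ..
  obtain e where "\<forall>y\<in>ball c r. \<eta> y = e + d * y$1 + m * b * y$2"
    using affine_on_ball[OF h\<eta> \<eta>x \<eta>u] ..
  with a show ?thesis by (intro exI[of _ a] exI[of _ b] exI[of _ e] exI[of _ d]) auto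
qed

definition canonical3_symmetry :: "complex^4 \<Rightarrow> complex^2 \<Rightarrow> complex^2" where
  "canonical3_symmetry c y = vector [c$1 + 2 * c$3 * y$1, c$2 + c$4 * y$1 + 3 * c$3 * y$2]"

text \<open>
  For \<open>f = q\<^sup>3\<close> the determining equation is a polynomial in \<open>q\<close>; its
  coefficients of degree 1, 2 and 3 suffice.
\<close>

lemma canonical3_four_point_symmetries:
  assumes can: "canonical3 F V" and w: "w \<in> V"
  shows "four_point_symmetries_at F w"
proof (rule four_point_symmetriesI[where S = canonical3_symmetry])
  note Fd = canonical3_derivatives[OF can]
  have V: "open V" by (rule Fd(1)[OF w])
  have c1: "(\<lambda>y. canonical3_symmetry c y $ 1) = (\<lambda>y. c$1 + 2 * c$3 * y$1)" and c2: "(\<lambda>y. canonical3_symmetry c y $ 2) = (\<lambda>y. c$2 + c$4 * y$1 + 3 * c$3 * y$2)" for c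
    by (simp_all add: canonical3_symmetry_def)
  show "canonical3_symmetry c y = (\<Sum>k\<in>UNIV. c$k *s canonical3_symmetry (axis k 1) y)" for c y
    by (simp add: vec2_eq_iff sum_4 canonical3_symmetry_def axis_def algebra_simps)
  show "point_symmetry_at F w (canonical3_symmetry c)" for c
    unfolding point_symmetry_iff c1 c2
  proof (intro conjI)
    show "\<exists>W. base_pt w \<in> W \<and> holo_on (\<lambda>y. c$1 + 2 * c$3 * y$1) W \<and> holo_on (\<lambda>y. c$2 + c$4 * y$1 + 3 * c$3 * y$2) W"
      by (rule exI[of _ UNIV]) (simp add: holo_on_iff)
    have d: "pd 1 (\<lambda>y::complex^2. c$1 + 2 * c$3 * y$1) = (\<lambda>_. 2 * c$3)" "pd 2 (\<lambda>y::complex^2. c$1 + 2 * c$3 * y$1) = (\<lambda>_. 0)"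
      "pd 1 (\<lambda>y::complex^2. c$2 + c$4 * y$1 + 3 * c$3 * y$2) = (\<lambda>_. c$4)" "pd 2 (\<lambda>y::complex^2. c$2 + c$4 * y$1 + 3 * c$3 * y$2) = (\<lambda>_. 3 * c$3)"
      by (rule ext, simp)+
    show "\<forall>\<^sub>F z in nhds w. determining_eq F (\<lambda>y. c$1 + 2 * c$3 * y$1) (\<lambda>y. c$2 + c$4 * y$1 + 3 * c$3 * y$2) z"
      using eventually_nhds_in_open[OF V w]
    proof eventually_elim
      case (elim z)
      show ?case
        unfolding determining_eq_def Let_def sym_A_def sym_B_def sym_S_def sym_P_def sym_H_def sym_R_def d pd_const
        by (simp add: Fd(3)[OF elim] Fd(5)[OF elim] Fd(6)[OF elim] algebra_simps power2_eq_square power3_eq_cube)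
    qed
  qed
  show "c = 0" if ev: "\<forall>\<^sub>F y in nhds (base_pt w). canonical3_symmetry c y = 0" for c
  proof -
    have e1: "\<forall>\<^sub>F y in nhds (base_pt w). c$1 + 2 * c$3 * y$1 = 0" and e2: "\<forall>\<^sub>F y in nhds (base_pt w). c$2 + c$4 * y$1 + 3 * c$3 * y$2 = 0"
      using ev by (eventually_elim, simp add: vec2_eq_iff canonical3_symmetry_def)+
    have "c$3 = 0" "c$4 = 0"
      using eventually_zero_derivative(2)[OF e1, of 1] eventually_zero_derivative(2)[OF e2, of 1] by simp_all
    moreover have "c$1 = 0" "c$2 = 0"
      using eventually_zero_derivative(1)[OF e1] eventually_zero_derivative(1)[OF e2] calculation by simp_all
    ultimately show ?thesis by (simp add: vec_eq_iff forall_4)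
  qed
  fix X assume sym: "point_symmetry_at F w X"
  define \<xi> where "\<xi> = (\<lambda>y. X y $ 1)"
  define \<eta> where "\<eta> = (\<lambda>y. X y $ 2)"
  obtain r where r: "r > 0" and h\<xi>: "holo_on \<xi> (ball (base_pt w) r)" and h\<eta>: "holo_on \<eta> (ball (base_pt w) r)"
    and inV: "\<And>y p q. y \<in> ball (base_pt w) r \<Longrightarrow> cmod (p - w$3) < r \<Longrightarrow> cmod (q - w$4) < r \<Longrightarrow> vector [y$1, y$2, p, q] \<in> V"
    and det: "\<And>y p q. y \<in> ball (base_pt w) r \<Longrightarrow> cmod (p - w$3) < r \<Longrightarrow> cmod (q - w$4) < r \<Longrightarrow> determining_eq F \<xi> \<eta> (vector [y$1, y$2, p, q])"
    using symmetry_local[OF sym V w] unfolding \<xi>_def \<eta>_def by metis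
  let ?B = "ball (base_pt w) r"
  have coeff: "sym_B \<xi> \<eta> y p = 0" "pd 2 \<xi> y + sym_H \<xi> \<eta> y p = 0" "sym_S \<xi> \<eta> y p - 3 * sym_R \<xi> \<eta> y p = 0"
    if y: "y \<in> ?B" and p: "cmod (p - w$3) < r" for y p
  proof -
    have eq: "sym_A \<xi> \<eta> y p + sym_B \<xi> \<eta> y p * q + (- 3 * (pd 2 \<xi> y + sym_H \<xi> \<eta> y p)) * q\<^sup>2
        + (sym_S \<xi> \<eta> y p - 3 * sym_R \<xi> \<eta> y p) * q^3 + 0 * q^4 = 0" if "q \<in> {q. cmod (q - w$4) < r}" for q
    proof -
      define z :: "complex^4" where "z = vector [y$1, y$2, p, q]"
      have zV: "z \<in> V" unfolding z_def using inV[OF y p] that by simp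
      have bz: "base_pt z = y" "z$3 = p" "z$4 = q" by (simp_all add: vec2_eq_iff z_def)
      have "determining_eq F \<xi> \<eta> z" unfolding z_def using det[OF y p] that by simp
      then have "sym_A \<xi> \<eta> y p + sym_B \<xi> \<eta> y p * q - 3 * pd 2 \<xi> y * q\<^sup>2 + sym_S \<xi> \<eta> y p * q^3
          = (sym_H \<xi> \<eta> y p + sym_R \<xi> \<eta> y p * q) * (3 * q\<^sup>2)"
        by (simp add: determining_eq_def Let_def bz Fd(3)[OF zV] Fd(5)[OF zV] Fd(6)[OF zV])
      then show ?thesis by algebra
    qed
    note c = polynomial4_zero[OF infinite_complex_ball[OF r] eq]
    show "sym_B \<xi> \<eta> y p = 0" "pd 2 \<xi> y + sym_H \<xi> \<eta> y p = 0" "sym_S \<xi> \<eta> y p - 3 * sym_R \<xi> \<eta> y p = 0"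
      using c(2,3,4) by (simp_all only: mult_eq_0_iff) simp_all
  qed
  have pde: "pd 2 \<xi> y = 0" "pd 2 \<eta> y = 3/2 * pd 1 \<xi> y" if y: "y \<in> ?B" for y
  proof -
    have S: "(3 * pd 1 \<xi> y - 2 * pd 2 \<eta> y) + (5 * pd 2 \<xi> y) * p + 0 * p\<^sup>2 + 0 * p^3 + 0 * p^4 = 0"
      if "p \<in> {p. cmod (p - w$3) < r}" for p
      using coeff(3)[OF y, of p] that by (simp add: sym_S_def sym_R_def algebra_simps)
    note s = polynomial4_zero(1,2)[OF infinite_complex_ball[OF r] S]
    show "pd 2 \<xi> y = 0" using s(2) by simp
    show "pd 2 \<eta> y = 3/2 * pd 1 \<xi> y" using s(1) by (simp add: field_simps)
  qed
  have H: "sym_H \<xi> \<eta> y p = 0" if "y \<in> ?B" "cmod (p - w$3) < r" for y p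
    using coeff(2)[OF that] pde(1)[OF that(1)] by simp
  obtain a b e d where \<xi>e: "\<forall>y\<in>?B. \<xi> y = a + b * y$1" and \<eta>e: "\<forall>y\<in>?B. \<eta> y = e + d * y$1 + 3/2 * b * y$2"
    using affine_symmetry_components[OF r h\<xi> h\<eta> pde coeff(1) H] by blast
  show "\<exists>c. \<forall>\<^sub>F y in nhds (base_pt w). X y = canonical3_symmetry c y"
  proof (intro exI[of _ "vector [a, e, b/2, d]"])
    have "base_pt w \<in> ?B" using r by simp
    from eventually_nhds_in_open[OF open_ball this]
    show "\<forall>\<^sub>F y in nhds (base_pt w). X y = canonical3_symmetry (vector [a, e, b/2, d]) y"
    proof eventually_elim
      case (elim y)
      then show ?case using bspec[OF \<xi>e elim] bspec[OF \<eta>e elim] by (simp add: vec2_eq_iff canonical3_symmetry_def \<xi>_def \<eta>_def algebra_simps)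
    qed
  qed
qed


definition canonical2_symmetry :: "complex^4 \<Rightarrow> complex^2 \<Rightarrow> complex^2" where
  "canonical2_symmetry c y = vector [c$1 + c$3 * y$1, c$2 + c$4 * y$1]"

text \<open>
  With \<open>q = t\<^sup>2\<close> the determining equation is a polynomial in \<open>t\<close>
  whose odd part consists of the terms that come from \<open>f = t\<^sup>3\<close> and its
  derivative.
\<close>

lemma canonical2_four_point_symmetries:
  assumes can: "canonical2 F V" and w: "w \<in> V"
  shows "four_point_symmetries_at F w"
proof (rule four_point_symmetriesI[where S = canonical2_symmetry])
  obtain s where "square_root_branch F V s" using canonical2_square_root[OF can] ..
  then have V: "open V" and br: "\<forall>y\<in>V. (s y)\<^sup>2 = y$4" "\<forall>y\<in>V. F y = (s y)^3"
      "\<forall>y\<in>V. \<forall>i. pd i F y = (if i = 4 then 3 * s y / 2 else 0)"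
    unfolding square_root_branch_def by blast+
  note sq = br(1)[rule_format] and F = br(2)[rule_format] and dF = br(3)[rule_format]
  have c1: "(\<lambda>y. canonical2_symmetry c y $ 1) = (\<lambda>y. c$1 + c$3 * y$1)" and c2: "(\<lambda>y. canonical2_symmetry c y $ 2) = (\<lambda>y. c$2 + c$4 * y$1)" for c
    by (simp_all add: canonical2_symmetry_def)
  show "canonical2_symmetry c y = (\<Sum>k\<in>UNIV. c$k *s canonical2_symmetry (axis k 1) y)" for c y
    by (simp add: vec2_eq_iff sum_4 canonical2_symmetry_def axis_def algebra_simps)
  show "point_symmetry_at F w (canonical2_symmetry c)" for c
    unfolding point_symmetry_iff c1 c2
  proof (intro conjI)
    show "\<exists>W. base_pt w \<in> W \<and> holo_on (\<lambda>y. c$1 + c$3 * y$1) W \<and> holo_on (\<lambda>y. c$2 + c$4 * y$1) W"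
      by (rule exI[of _ UNIV]) (simp add: holo_on_iff)
    have d: "pd 1 (\<lambda>y::complex^2. c$1 + c$3 * y$1) = (\<lambda>_. c$3)" "pd 2 (\<lambda>y::complex^2. c$1 + c$3 * y$1) = (\<lambda>_. 0)"
      "pd 1 (\<lambda>y::complex^2. c$2 + c$4 * y$1) = (\<lambda>_. c$4)" "pd 2 (\<lambda>y::complex^2. c$2 + c$4 * y$1) = (\<lambda>_. 0)"
      by (rule ext, simp)+
    show "\<forall>\<^sub>F z in nhds w. determining_eq F (\<lambda>y. c$1 + c$3 * y$1) (\<lambda>y. c$2 + c$4 * y$1) z"
      using eventually_nhds_in_open[OF V w]
    proof eventually_elim
      case (elim z)
      show ?case
        unfolding determining_eq_def Let_def sym_A_def sym_B_def sym_S_def sym_P_def sym_H_def sym_R_def d pd_const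
        by (simp add: F[OF elim] dF[OF elim] sq[OF elim, symmetric] algebra_simps power2_eq_square power3_eq_cube)
    qed
  qed
  show "c = 0" if ev: "\<forall>\<^sub>F y in nhds (base_pt w). canonical2_symmetry c y = 0" for c
  proof -
    have e1: "\<forall>\<^sub>F y in nhds (base_pt w). c$1 + c$3 * y$1 = 0" and e2: "\<forall>\<^sub>F y in nhds (base_pt w). c$2 + c$4 * y$1 = 0"
      using ev by (eventually_elim, simp add: vec2_eq_iff canonical2_symmetry_def)+
    have "c$3 = 0" "c$4 = 0"
      using eventually_zero_derivative(2)[OF e1, of 1] eventually_zero_derivative(2)[OF e2, of 1] by simp_all
    moreover have "c$1 = 0" "c$2 = 0"
      using eventually_zero_derivative(1)[OF e1] eventually_zero_derivative(1)[OF e2] calculation by simp_all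
    ultimately show ?thesis by (simp add: vec_eq_iff forall_4)
  qed
  fix X assume sym: "point_symmetry_at F w X"
  define \<xi> where "\<xi> = (\<lambda>y. X y $ 1)"
  define \<eta> where "\<eta> = (\<lambda>y. X y $ 2)"
  obtain r where r: "r > 0" and h\<xi>: "holo_on \<xi> (ball (base_pt w) r)" and h\<eta>: "holo_on \<eta> (ball (base_pt w) r)"
    and inV: "\<And>y p q. y \<in> ball (base_pt w) r \<Longrightarrow> cmod (p - w$3) < r \<Longrightarrow> cmod (q - w$4) < r \<Longrightarrow> vector [y$1, y$2, p, q] \<in> V"
    and det: "\<And>y p q. y \<in> ball (base_pt w) r \<Longrightarrow> cmod (p - w$3) < r \<Longrightarrow> cmod (q - w$4) < r \<Longrightarrow> determining_eq F \<xi> \<eta> (vector [y$1, y$2, p, q])"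
    using symmetry_local[OF sym V w] unfolding \<xi>_def \<eta>_def by metis
  let ?B = "ball (base_pt w) r"
  have coeff: "pd 2 \<xi> y = 0" "sym_B \<xi> \<eta> y p = 0" "sym_H \<xi> \<eta> y p = 0" "2 * sym_S \<xi> \<eta> y p - 3 * sym_R \<xi> \<eta> y p = 0"
    if y: "y \<in> ?B" and p: "cmod (p - w$3) < r" for y p
  proof -
    define g where "g q = s (vector [y$1, y$2, p, q])" for q
    have gq: "(g q)\<^sup>2 = q" if "cmod (q - w$4) < r" for q
      using sq[OF inV[OF y p that]] by (simp add: g_def)
    have eq: "2 * sym_A \<xi> \<eta> y p + (- 3 * sym_H \<xi> \<eta> y p) * t + (2 * sym_B \<xi> \<eta> y p) * t\<^sup>2
        + (2 * sym_S \<xi> \<eta> y p - 3 * sym_R \<xi> \<eta> y p) * t^3 + (- 6 * pd 2 \<xi> y) * t^4 = 0"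
      if tS: "t \<in> g ` {q. cmod (q - w$4) < r}" for t
    proof -
      obtain q where q: "cmod (q - w$4) < r" and t: "t = g q" using tS by blast
      define z :: "complex^4" where "z = vector [y$1, y$2, p, q]"
      have zV: "z \<in> V" unfolding z_def by (rule inV[OF y p q])
      have bz: "base_pt z = y" "z$3 = p" "z$4 = t\<^sup>2" "s z = t" using gq[OF q] by (simp_all add: vec2_eq_iff z_def t g_def)
      have "determining_eq F \<xi> \<eta> z" unfolding z_def by (rule det[OF y p q])
      then have "sym_A \<xi> \<eta> y p + sym_B \<xi> \<eta> y p * t\<^sup>2 - 3 * pd 2 \<xi> y * (t\<^sup>2)\<^sup>2 + sym_S \<xi> \<eta> y p * t^3
          = (sym_H \<xi> \<eta> y p + sym_R \<xi> \<eta> y p * t\<^sup>2) * (3 * t / 2)"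
        by (simp add: determining_eq_def Let_def bz F[OF zV] dF[OF zV])
      then have "2 * (sym_A \<xi> \<eta> y p + sym_B \<xi> \<eta> y p * t\<^sup>2 - 3 * pd 2 \<xi> y * (t\<^sup>2)\<^sup>2 + sym_S \<xi> \<eta> y p * t^3)
          = (sym_H \<xi> \<eta> y p + sym_R \<xi> \<eta> y p * t\<^sup>2) * (3 * t)" by (simp add: mult.commute mult.left_commute)
      then show ?thesis by algebra
    qed
    note c = polynomial4_zero[OF infinite_branch_values[of r "w$4" "\<lambda>t. t\<^sup>2" g, OF r gq] eq]
    show "pd 2 \<xi> y = 0" "sym_B \<xi> \<eta> y p = 0" "sym_H \<xi> \<eta> y p = 0" "2 * sym_S \<xi> \<eta> y p - 3 * sym_R \<xi> \<eta> y p = 0"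
      using c(2,3,4,5) by (simp_all add: field_simps)
  qed
  have pde: "pd 2 \<xi> y = 0" "pd 2 \<eta> y = 0 * pd 1 \<xi> y" if y: "y \<in> ?B" for y
  proof -
    show u: "pd 2 \<xi> y = 0" using coeff(1)[OF y, of "w$3"] r by simp
    have "2 * sym_S \<xi> \<eta> y (w$3) - 3 * sym_R \<xi> \<eta> y (w$3) = 0" using coeff(4)[OF y, of "w$3"] r by simp
    then show "pd 2 \<eta> y = 0 * pd 1 \<xi> y" using u by (simp add: sym_S_def sym_R_def algebra_simps)
  qed
  obtain a b e d where \<xi>e: "\<forall>y\<in>?B. \<xi> y = a + b * y$1" and \<eta>e: "\<forall>y\<in>?B. \<eta> y = e + d * y$1 + 0 * b * y$2"
    using affine_symmetry_components[OF r h\<xi> h\<eta> pde coeff(2,3)] by blast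
  show "\<exists>c. \<forall>\<^sub>F y in nhds (base_pt w). X y = canonical2_symmetry c y"
  proof (intro exI[of _ "vector [a, e, b, d]"])
    have "base_pt w \<in> ?B" using r by simp
    from eventually_nhds_in_open[OF open_ball this]
    show "\<forall>\<^sub>F y in nhds (base_pt w). X y = canonical2_symmetry (vector [a, e, b, d]) y"
    proof eventually_elim
      case (elim y)
      then show ?case using bspec[OF \<xi>e elim] bspec[OF \<eta>e elim] by (simp add: vec2_eq_iff canonical2_symmetry_def \<xi>_def \<eta>_def)
    qed
  qed
qed

definition canonical1_symmetry :: "complex^4 \<Rightarrow> complex^2 \<Rightarrow> complex^2" where
  "canonical1_symmetry c y = vector [y$1 * (c$3 + c$4 * y$2), c$1 + c$2 * y$2 + c$4 / 2 * (y$2)\<^sup>2]"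

text \<open>
  With \<open>q = p (t\<^sup>2 - 1) / (2 x)\<close> the determining equation is a polynomial of
  degree 4 in the quotient \<open>t\<close> of the roots. Its odd coefficients carry the factor
  \<open>\<alpha>\<close> and give two identities, polynomial in \<open>p\<close>, which already
  force the four-dimensional solution space.
\<close>

lemma canonical1_four_point_symmetries:
  assumes \<alpha>: "\<alpha> \<noteq> 0" and can: "canonical1 \<alpha> F V" and w: "w \<in> V"
  shows "four_point_symmetries_at F w"
proof (rule four_point_symmetriesI[where S = canonical1_symmetry])
  obtain \<rho> where "ratio_branch \<alpha> F V \<rho>" using canonical1_ratio[OF can] ..
  then have V: "open V" and br: "\<forall>y\<in>V. y$1 \<noteq> 0" "\<forall>y\<in>V. y$3 \<noteq> 0" "\<forall>y\<in>V. \<rho> y \<noteq> 0"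
      "\<forall>y\<in>V. (\<rho> y)\<^sup>2 = (2 * y$1 * y$4 + y$3) / y$3" "\<forall>y\<in>V. F y = 3 * (y$4)\<^sup>2 / y$3 + \<alpha> * (\<rho> y)^3 * y$3 / (y$1)\<^sup>2"
      "\<forall>y\<in>V. pd 1 F y = 3 * \<alpha> * \<rho> y * y$4 / (y$1)\<^sup>2 - 2 * \<alpha> * (\<rho> y)^3 * y$3 / (y$1)^3" "\<forall>y\<in>V. pd 2 F y = 0"
      "\<forall>y\<in>V. pd 3 F y = \<alpha> * (3 * \<rho> y - (\<rho> y)^3) / (2 * (y$1)\<^sup>2) - 3 * (y$4)\<^sup>2 / (y$3)\<^sup>2"
      "\<forall>y\<in>V. pd 4 F y = 6 * y$4 / y$3 + 3 * \<alpha> * \<rho> y / y$1"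
    unfolding ratio_branch_def by blast+
  note nz0 = br(1,2,3)[rule_format] and \<rho>2 = br(4)[rule_format] and F = br(5)[rule_format] and dF = br(6-9)[rule_format]
  have q\<rho>: "y$4 = y$3 / (2 * y$1) * ((\<rho> y)\<^sup>2 - 1)" if "y \<in> V" for y
    using \<rho>2[OF that] nz0[OF that] by (simp add: field_simps)
  have c1: "(\<lambda>y. canonical1_symmetry c y $ 1) = (\<lambda>y. y$1 * (c$3 + c$4 * y$2))"
    and c2: "(\<lambda>y. canonical1_symmetry c y $ 2) = (\<lambda>y. c$1 + c$2 * y$2 + c$4 / 2 * (y$2)\<^sup>2)" for c
    by (simp_all add: canonical1_symmetry_def)
  show "canonical1_symmetry c y = (\<Sum>k\<in>UNIV. c$k *s canonical1_symmetry (axis k 1) y)" for c y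
    by (simp add: vec2_eq_iff sum_4 canonical1_symmetry_def axis_def algebra_simps)
  show "point_symmetry_at F w (canonical1_symmetry c)" for c
    unfolding point_symmetry_iff c1 c2
  proof (intro conjI)
    show "\<exists>W. base_pt w \<in> W \<and> holo_on (\<lambda>y. y$1 * (c$3 + c$4 * y$2)) W \<and> holo_on (\<lambda>y. c$1 + c$2 * y$2 + c$4 / 2 * (y$2)\<^sup>2) W"
      by (rule exI[of _ UNIV]) (simp add: holo_on_iff)
    have d: "pd 1 (\<lambda>y::complex^2. y$1 * (c$3 + c$4 * y$2)) = (\<lambda>y. c$3 + c$4 * y$2)"
      "pd 2 (\<lambda>y::complex^2. y$1 * (c$3 + c$4 * y$2)) = (\<lambda>y. c$4 * y$1)"
      "pd 1 (\<lambda>y::complex^2. c$1 + c$2 * y$2 + c$4 / 2 * (y$2)\<^sup>2) = (\<lambda>_. 0)"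
      "pd 2 (\<lambda>y::complex^2. c$1 + c$2 * y$2 + c$4 / 2 * (y$2)\<^sup>2) = (\<lambda>y. c$2 + c$4 * y$2)"
      "pd 1 (\<lambda>y::complex^2. c$3 + c$4 * y$2) = (\<lambda>_. 0)"
      "pd 1 (\<lambda>y::complex^2. c$4 * y$1) = (\<lambda>_. c$4)" "pd 2 (\<lambda>y::complex^2. c$4 * y$1) = (\<lambda>_. 0)"
      "pd 1 (\<lambda>y::complex^2. c$2 + c$4 * y$2) = (\<lambda>_. 0)" "pd 2 (\<lambda>y::complex^2. c$2 + c$4 * y$2) = (\<lambda>_. c$4)"
      "\<And>i k. pd i (\<lambda>_::complex^2. k) = (\<lambda>_. 0)"
      by (rule ext, simp)+
    show "\<forall>\<^sub>F z in nhds w. determining_eq F (\<lambda>y. y$1 * (c$3 + c$4 * y$2)) (\<lambda>y. c$1 + c$2 * y$2 + c$4 / 2 * (y$2)\<^sup>2) z"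
      using eventually_nhds_in_open[OF V w]
    proof eventually_elim
      case (elim z)
      define x p R where "x = z$1" "p = z$3" "R = \<rho> z"
      note xp = this
      have nz: "x \<noteq> 0" "p \<noteq> 0" using nz0[OF elim] by (simp_all add: xp)
      have q: "z$4 = p / (2 * x) * (R\<^sup>2 - 1)" using q\<rho>[OF elim] by (simp add: xp)
      show ?case
        unfolding determining_eq_def Let_def sym_A_def sym_B_def sym_S_def sym_P_def sym_H_def sym_R_def d
          base_pt_nth F[OF elim] dF(1)[OF elim] dF(2)[OF elim] dF(3)[OF elim] dF(4)[OF elim] q xp[symmetric]
        using nz by (simp add: field_simps eval_nat_numeral)
    qed
  qed
  show "c = 0" if ev: "\<forall>\<^sub>F y in nhds (base_pt w). canonical1_symmetry c y = 0" for c
  proof -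
    have e1: "\<forall>\<^sub>F y in nhds (base_pt w). y$1 * (c$3 + c$4 * y$2) = 0" and e2: "\<forall>\<^sub>F y in nhds (base_pt w). c$1 + c$2 * y$2 + c$4 / 2 * (y$2)\<^sup>2 = 0"
      using ev by (eventually_elim, simp add: vec2_eq_iff canonical1_symmetry_def)+
    have "c$4 = 0" using eventually_zero_derivative(2)[OF e1, of 2] nz0(1)[OF w] by simp
    moreover have "c$3 = 0" using eventually_zero_derivative(1)[OF e1] nz0(1)[OF w] calculation by simp
    moreover have "c$2 = 0" using eventually_zero_derivative(2)[OF e2, of 2] calculation by simp
    moreover have "c$1 = 0" using eventually_zero_derivative(1)[OF e2] calculation by simp
    ultimately show ?thesis by (simp add: vec_eq_iff forall_4)
  qed
  fix X assume sym: "point_symmetry_at F w X"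
  define \<xi> where "\<xi> = (\<lambda>y. X y $ 1)"
  define \<eta> where "\<eta> = (\<lambda>y. X y $ 2)"
  obtain r where r: "r > 0" and h\<xi>: "holo_on \<xi> (ball (base_pt w) r)" and h\<eta>: "holo_on \<eta> (ball (base_pt w) r)"
    and inV: "\<And>y p q. y \<in> ball (base_pt w) r \<Longrightarrow> cmod (p - w$3) < r \<Longrightarrow> cmod (q - w$4) < r \<Longrightarrow> vector [y$1, y$2, p, q] \<in> V"
    and det: "\<And>y p q. y \<in> ball (base_pt w) r \<Longrightarrow> cmod (p - w$3) < r \<Longrightarrow> cmod (q - w$4) < r \<Longrightarrow> determining_eq F \<xi> \<eta> (vector [y$1, y$2, p, q])"
    using symmetry_local[OF sym V w] unfolding \<xi>_def \<eta>_def by metis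
  let ?B = "ball (base_pt w) r"
  have x0: "y$1 \<noteq> 0" if "y \<in> ?B" for y
    using nz0(1)[OF inV[OF that, of "w$3" "w$4"]] r by simp
  have coeff: "2 * y$1 * sym_S \<xi> \<eta> y p * p + \<xi> y * p + y$1 * sym_P \<xi> \<eta> y p - 3 * y$1 * sym_R \<xi> \<eta> y p * p = 0"
      "\<xi> y * p - y$1 * sym_P \<xi> \<eta> y p - 2 * (y$1)\<^sup>2 * sym_H \<xi> \<eta> y p + y$1 * sym_R \<xi> \<eta> y p * p = 0"
    if y: "y \<in> ?B" and p: "cmod (p - w$3) < r" for y p
  proof -
    define x where "x = y$1"
    define k where "k = p / (2 * x)"
    define A B S P H R where "A = sym_A \<xi> \<eta> y p" "B = sym_B \<xi> \<eta> y p" "S = sym_S \<xi> \<eta> y p"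
      "P = sym_P \<xi> \<eta> y p" "H = sym_H \<xi> \<eta> y p" "R = sym_R \<xi> \<eta> y p"
    note sdef = this
    have nz: "x \<noteq> 0" "p \<noteq> 0" using x0[OF y] nz0(2)[OF inV[OF y p, of "w$4"]] r by (simp_all add: x_def)
    define g where "g q = \<rho> (vector [y$1, y$2, p, q])" for q
    have gq: "k * ((g q)\<^sup>2 - 1) = q" if "cmod (q - w$4) < r" for q
      using q\<rho>[OF inV[OF y p that]] by (simp add: g_def k_def x_def)
    define a1 a2 where "a1 = B - 6 * H / p" "a2 = - 3 * pd 2 \<xi> y + 3 * S / p + 3 * P / p\<^sup>2 - 6 * R / p"
    note adef = this
    define b0 b1 where "b0 = 3 * \<alpha> * \<xi> y * k / x\<^sup>2 - 3 * \<alpha> * P / (2 * x\<^sup>2) - 3 * \<alpha> * (H - R * k) / x"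
      "b1 = \<alpha> * S * p / x\<^sup>2 - 3 * \<alpha> * \<xi> y * k / x\<^sup>2 + 2 * \<alpha> * \<xi> y * p / x^3 + \<alpha> * P / (2 * x\<^sup>2) - 3 * \<alpha> * R * k / x"
    note bdef = this
    \<comment> \<open>Here \<open>a1\<close> and \<open>a2\<close> are the coefficients of \<open>q\<close>
      and \<open>q\<^sup>2\<close> in the part without \<open>\<alpha>\<close>, expanded with \<open>q = k *
      (t\<^sup>2 - 1)\<close>.\<close>
    have eq: "(A - a1 * k + a2 * k\<^sup>2) + b0 * t + (a1 * k - 2 * a2 * k\<^sup>2) * t\<^sup>2 + b1 * t^3 + (a2 * k\<^sup>2) * t^4 = 0"
      if tS: "t \<in> g ` {q. cmod (q - w$4) < r}" for t
    proof -
      obtain q where q: "cmod (q - w$4) < r" and t: "t = g q" using tS by blast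
      define z :: "complex^4" where "z = vector [y$1, y$2, p, q]"
      have zV: "z \<in> V" unfolding z_def by (rule inV[OF y p q])
      have bz: "base_pt z = y" "z$3 = p" "z$4 = k * (t\<^sup>2 - 1)" "\<rho> z = t" "z$1 = x"
        using gq[OF q] by (simp_all add: vec2_eq_iff z_def t g_def x_def)
      have "determining_eq F \<xi> \<eta> z" unfolding z_def by (rule det[OF y p q])
      then have e: "A + B * (k * (t\<^sup>2 - 1)) - 3 * pd 2 \<xi> y * (k * (t\<^sup>2 - 1))\<^sup>2 + S * (3 * (k * (t\<^sup>2 - 1))\<^sup>2 / p + \<alpha> * t^3 * p / x\<^sup>2)
          = \<xi> y * (3 * \<alpha> * t * (k * (t\<^sup>2 - 1)) / x\<^sup>2 - 2 * \<alpha> * t^3 * p / x^3)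
           + P * (\<alpha> * (3 * t - t^3) / (2 * x\<^sup>2) - 3 * (k * (t\<^sup>2 - 1))\<^sup>2 / p\<^sup>2)
           + (H + R * (k * (t\<^sup>2 - 1))) * (6 * (k * (t\<^sup>2 - 1)) / p + 3 * \<alpha> * t / x)"
        unfolding determining_eq_def Let_def bz F[OF zV] dF(1)[OF zV] dF(2)[OF zV] dF(3)[OF zV] dF(4)[OF zV] sdef by simp
      have "(A - a1 * k + a2 * k\<^sup>2) + b0 * t + (a1 * k - 2 * a2 * k\<^sup>2) * t\<^sup>2 + b1 * t^3 + (a2 * k\<^sup>2) * t^4
        = (A + B * (k * (t\<^sup>2 - 1)) - 3 * pd 2 \<xi> y * (k * (t\<^sup>2 - 1))\<^sup>2 + S * (3 * (k * (t\<^sup>2 - 1))\<^sup>2 / p + \<alpha> * t^3 * p / x\<^sup>2))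
          - (\<xi> y * (3 * \<alpha> * t * (k * (t\<^sup>2 - 1)) / x\<^sup>2 - 2 * \<alpha> * t^3 * p / x^3)
           + P * (\<alpha> * (3 * t - t^3) / (2 * x\<^sup>2) - 3 * (k * (t\<^sup>2 - 1))\<^sup>2 / p\<^sup>2)
           + (H + R * (k * (t\<^sup>2 - 1))) * (6 * (k * (t\<^sup>2 - 1)) / p + 3 * \<alpha> * t / x))"
        unfolding adef bdef using nz by (simp add: field_simps eval_nat_numeral)
      then show ?thesis using e by simp
    qed
    note c = polynomial4_zero[OF infinite_branch_values[of r "w$4" "\<lambda>t. k * (t\<^sup>2 - 1)" g, OF r gq] eq]
    have b10: "b0 = 0" "b1 = 0" using c(2,4) by blast+
    have "2 * x * S * p + \<xi> y * p + x * P - 3 * x * R * p = 2 * x^3 / \<alpha> * b1"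
      unfolding bdef k_def using nz \<alpha> by (simp add: field_simps eval_nat_numeral)
    then show "2 * y$1 * sym_S \<xi> \<eta> y p * p + \<xi> y * p + y$1 * sym_P \<xi> \<eta> y p - 3 * y$1 * sym_R \<xi> \<eta> y p * p = 0"
      unfolding b10 sdef x_def by simp
    have "\<xi> y * p - x * P - 2 * x\<^sup>2 * H + x * R * p = 2 * x^3 / (3 * \<alpha>) * b0"
      unfolding bdef k_def using nz \<alpha> by (simp add: field_simps eval_nat_numeral)
    then show "\<xi> y * p - y$1 * sym_P \<xi> \<eta> y p - 2 * (y$1)\<^sup>2 * sym_H \<xi> \<eta> y p + y$1 * sym_R \<xi> \<eta> y p * p = 0"
      unfolding b10 sdef x_def by simp
  qed
  have pde: "pd 1 \<eta> y = 0" "\<xi> y = y$1 * pd 1 \<xi> y" "y$1 * pd 2 (pd 2 \<eta>) y = 2 * y$1 * pd 1 (pd 2 \<xi>) y - pd 2 \<xi> y" "pd 2 (pd 2 \<xi>) y = 0"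
    if y: "y \<in> ?B" for y
  proof -
    let ?D = "{p. cmod (p - w$3) < r}"
    note inf = infinite_complex_ball[OF r, of "w$3"]
    have E1: "y$1 * pd 1 \<eta> y + (\<xi> y - y$1 * pd 1 \<xi> y) * p + 0 * p\<^sup>2 + 0 * p^3 + 0 * p^4 = 0" if "p \<in> ?D" for p
      using coeff(1)[OF y, of p] that by (simp add: sym_S_def sym_P_def sym_R_def) (simp add: algebra_simps eval_nat_numeral)
    note e1 = polynomial4_zero(1,2)[OF inf E1]
    show "pd 1 \<eta> y = 0" using e1(1) x0[OF y] by simp
    show "\<xi> y = y$1 * pd 1 \<xi> y" using e1(2) by simp
    have E2: "(- y$1 * pd 1 \<eta> y - 2 * (y$1)\<^sup>2 * pd 1 (pd 1 \<eta>) y)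
      + (\<xi> y - y$1 * (pd 2 \<eta> y - pd 1 \<xi> y) - 2 * (y$1)\<^sup>2 * (2 * pd 1 (pd 2 \<eta>) y - pd 1 (pd 1 \<xi>) y) + y$1 * (pd 2 \<eta> y - 2 * pd 1 \<xi> y)) * p
      + (2 * y$1 * (2 * y$1 * pd 1 (pd 2 \<xi>) y - pd 2 \<xi> y - y$1 * pd 2 (pd 2 \<eta>) y)) * p\<^sup>2
      + (2 * (y$1)\<^sup>2 * pd 2 (pd 2 \<xi>) y) * p^3 + 0 * p^4 = 0" if "p \<in> ?D" for p
      using coeff(2)[OF y, of p] that by (simp add: sym_H_def sym_P_def sym_R_def) (simp add: algebra_simps eval_nat_numeral)
    note e2 = polynomial4_zero(3,4)[OF inf E2]
    show "y$1 * pd 2 (pd 2 \<eta>) y = 2 * y$1 * pd 1 (pd 2 \<xi>) y - pd 2 \<xi> y" using e2(1) x0[OF y] by simp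
    show "pd 2 (pd 2 \<xi>) y = 0" using e2(2) x0[OF y] by simp
  qed
  have at: "holo_at \<xi> y" "holo_at \<eta> y" "holo_at (pd i \<xi>) y" "holo_at (pd i \<eta>) y" if "y \<in> ?B" for y i
    using h\<xi> h\<eta> holo_on_pd[OF h\<xi>] holo_on_pd[OF h\<eta>] that by (simp_all add: holo_on_iff)
  have \<xi>u: "pd 2 \<xi> y = y$1 * pd 1 (pd 2 \<xi>) y" if y: "y \<in> ?B" for y
  proof -
    have "pd 2 \<xi> y = pd 2 (\<lambda>y. y$1 * pd 1 \<xi> y) y"
      by (rule derivatives_cong_open(2)[OF open_ball y pde(2)]) (use at[OF y] in auto)
    then show ?thesis using at[OF y] pd_mixed(1)[OF h\<xi> y] by simp
  qed
  have \<eta>uu: "y$1 * pd 2 (pd 2 \<eta>) y = pd 2 \<xi> y" if y: "y \<in> ?B" for y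
    using pde(3)[OF y] \<xi>u[OF y] by simp
  have hq: "holo_on (\<lambda>y. pd 2 \<xi> y / y$1) ?B" "holo_on (\<lambda>y. \<xi> y / y$1) ?B"
    using at x0 by (auto simp: holo_on_iff)
  have "\<exists>k. \<forall>y\<in>?B. pd 2 \<xi> y / y$1 = k + 0 * y$1 + 0 * y$2"
  proof (rule affine_on_ball[OF hq(1)])
    fix y assume y: "y \<in> ?B"
    show "pd 1 (\<lambda>y. pd 2 \<xi> y / y$1) y = 0" using at[OF y] x0[OF y] \<xi>u[OF y] by simp
    show "pd 2 (\<lambda>y. pd 2 \<xi> y / y$1) y = 0" using at[OF y] x0[OF y] pde(4)[OF y] by simp
  qed
  then obtain b where b: "\<And>y. y \<in> ?B \<Longrightarrow> pd 2 \<xi> y / y$1 = b" by auto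
  have "\<exists>k. \<forall>y\<in>?B. \<xi> y / y$1 = k + 0 * y$1 + b * y$2"
  proof (rule affine_on_ball[OF hq(2)])
    fix y assume y: "y \<in> ?B"
    show "pd 1 (\<lambda>y. \<xi> y / y$1) y = 0" using at[OF y] x0[OF y] pde(2)[OF y] by simp
    show "pd 2 (\<lambda>y. \<xi> y / y$1) y = b" using at[OF y] x0[OF y] b[OF y] by (simp add: field_simps power2_eq_square)
  qed
  then obtain a where a: "\<And>y. y \<in> ?B \<Longrightarrow> \<xi> y / y$1 = a + b * y$2" by auto
  have "\<exists>k. \<forall>y\<in>?B. pd 2 \<eta> y = k + 0 * y$1 + b * y$2"
  proof (rule affine_on_ball[OF holo_on_pd[OF h\<eta>]])
    fix y assume y: "y \<in> ?B"
    show "pd 1 (pd 2 \<eta>) y = 0" unfolding pd_mixed(1)[OF h\<eta> y, symmetric] by (rule pd_zero_on_ball[OF pde(1) y])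
    show "pd 2 (pd 2 \<eta>) y = b" using \<eta>uu[OF y] b[OF y] x0[OF y] by (simp add: field_simps)
  qed
  then obtain d where d: "\<And>y. y \<in> ?B \<Longrightarrow> pd 2 \<eta> y = d + b * y$2" by auto
  have h\<eta>': "holo_on (\<lambda>y. \<eta> y - b / 2 * (y$2)\<^sup>2) ?B" using at by (simp add: holo_on_iff)
  have "\<exists>k. \<forall>y\<in>?B. \<eta> y - b / 2 * (y$2)\<^sup>2 = k + 0 * y$1 + d * y$2"
  proof (rule affine_on_ball[OF h\<eta>'])
    fix y assume y: "y \<in> ?B"
    show "pd 1 (\<lambda>y. \<eta> y - b / 2 * (y$2)\<^sup>2) y = 0" using at[OF y] pde(1)[OF y] by simp
    show "pd 2 (\<lambda>y. \<eta> y - b / 2 * (y$2)\<^sup>2) y = d" using at[OF y] d[OF y] by simp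
  qed
  then obtain e where e: "\<And>y. y \<in> ?B \<Longrightarrow> \<eta> y - b / 2 * (y$2)\<^sup>2 = e + 0 * y$1 + d * y$2" by auto
  show "\<exists>c. \<forall>\<^sub>F y in nhds (base_pt w). X y = canonical1_symmetry c y"
  proof (intro exI[of _ "vector [e, d, a, b]"])
    have "base_pt w \<in> ?B" using r by simp
    from eventually_nhds_in_open[OF open_ball this]
    show "\<forall>\<^sub>F y in nhds (base_pt w). X y = canonical1_symmetry (vector [e, d, a, b]) y"
    proof eventually_elim
      case (elim y)
      have "\<xi> y = y$1 * (a + b * y$2)" using a[OF elim] x0[OF elim] by (simp add: field_simps)
      moreover have "\<eta> y = e + d * y$2 + b / 2 * (y$2)\<^sup>2" using e[OF elim] by (simp add: algebra_simps)
      ultimately show ?case by (simp add: vec2_eq_iff canonical1_symmetry_def \<xi>_def \<eta>_def)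
    qed
  qed
qed

section \<open>The classification\<close>

text \<open>
  The three equivalences are instances of the criterion for a family with constant normalized
  structure functions. For the parameter, \<open>T 2 1 2\<close> is read off from
  \<open>structure_radical\<close>.
\<close>

theorem theorem3p3:
  fixes f :: "complex^4 \<Rightarrow> complex" and U :: "(complex^4) set" and z0 :: "complex^4"
  assumes "holo_on f U" and "z0 \<in> U"
  shows "((\<exists>\<alpha>. \<alpha> \<noteq> 0 \<and> equivalent_to (canonical1 \<alpha>) f z0) \<longleftrightarrow>
            invariants_near f z0 \<and>
            (\<exists>\<alpha> T. \<alpha> \<noteq> 0 \<and> canonical_structure (canonical1 \<alpha>) T \<and> constant_structure_near f z0 T)) \<and>
         (equivalent_to canonical2 f z0 \<longleftrightarrow>
            invariants_near f z0 \<and>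
            (\<exists>T. canonical_structure canonical2 T \<and> constant_structure_near f z0 T)) \<and>
         (equivalent_to canonical3 f z0 \<longleftrightarrow>
            invariants_near f z0 \<and>
            (\<exists>T. canonical_structure canonical3 T \<and> constant_structure_near f z0 T)) \<and>
         (\<forall>T. (\<exists>\<alpha>. \<alpha> \<noteq> 0 \<and> equivalent_to (canonical1 \<alpha>) f z0) \<and> constant_structure_near f z0 T \<longrightarrow>
            (\<forall>\<alpha>. \<alpha> \<noteq> 0 \<longrightarrow>
               (equivalent_to (canonical1 \<alpha>) f z0 \<longleftrightarrow> T 2 1 2 = (3 * \<alpha>\<^sup>2 + 4) / (16 * \<alpha>\<^sup>2)))) \<and>
         (\<forall>\<alpha>. \<alpha> \<noteq> 0 \<longrightarrow> has_four_point_symmetries (canonical1 \<alpha>)) \<and>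
         has_four_point_symmetries canonical2 \<and>
         has_four_point_symmetries canonical3"
proof -
  note f = assms
  let ?lam = "\<lambda>\<alpha>::complex. (3 * \<alpha>\<^sup>2 + 4) / (16 * \<alpha>\<^sup>2)"
  have iff1: "equivalent_to (canonical1 \<alpha>) f z0 \<longleftrightarrow> invariants_near f z0 \<and> (\<exists>T. canonical_structure (canonical1 \<alpha>) T \<and> constant_structure_near f z0 T)"
    and str1: "equivalent_to (canonical1 \<alpha>) f z0 \<Longrightarrow> constant_structure_near f z0 (structure_radical (?lam \<alpha>))" if "\<alpha> \<noteq> 0" for \<alpha>
    using equivalent_to_iff_structure[of f U z0 "canonical1 \<alpha>", OF f canonical1_exists normalized_radical, of "?lam \<alpha>"]
      canonical1_coframe[OF that] by blast+
  have iff2: "equivalent_to canonical2 f z0 \<longleftrightarrow> invariants_near f z0 \<and> (\<exists>T. canonical_structure canonical2 T \<and> constant_structure_near f z0 T)"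
    using equivalent_to_iff_structure(1)[of f U z0 canonical2, OF f canonical2_exists normalized_radical, of "3/16"]
      canonical2_coframe by blast
  have iff3: "equivalent_to canonical3 f z0 \<longleftrightarrow> invariants_near f z0 \<and> (\<exists>T. canonical_structure canonical3 T \<and> constant_structure_near f z0 T)"
    using equivalent_to_iff_structure(1)[of f U z0 canonical3, OF f canonical3_exists normalized_cubic]
      canonical3_coframe by blast
  have parameter: "equivalent_to (canonical1 \<alpha>) f z0 \<longleftrightarrow> T 2 1 2 = ?lam \<alpha>"
    if ex: "\<alpha>0 \<noteq> 0" "equivalent_to (canonical1 \<alpha>0) f z0" and T: "constant_structure_near f z0 T" and \<alpha>: "\<alpha> \<noteq> 0" for T \<alpha>0 \<alpha>
  proof -
    have T212: "T 2 1 2 = ?lam \<beta>" if \<beta>: "\<beta> \<noteq> 0" "equivalent_to (canonical1 \<beta>) f z0" for \<beta>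
    proof -
      have "\<forall>\<^sub>F z in nhds z0. I6 f z \<noteq> 0 \<and> I7 f z \<noteq> 0 \<and> structure_functions_at (coframe f) z T
          \<and> structure_functions_at (coframe f) z (structure_radical (?lam \<beta>))"
        using T str1[OF \<beta>] iff1[OF \<beta>(1)] \<beta>(2) unfolding invariants_near_def constant_structure_near_def
        by (simp add: eventually_conj_iff)
      from eventually_open_subset[OF f this] obtain U' where U': "holo_on f U'" "z0 \<in> U'"
        "\<And>z. z \<in> U' \<Longrightarrow> I6 f z \<noteq> 0" "\<And>z. z \<in> U' \<Longrightarrow> I7 f z \<noteq> 0"
        "\<And>z. z \<in> U' \<Longrightarrow> structure_functions_at (coframe f) z T"
        "\<And>z. z \<in> U' \<Longrightarrow> structure_functions_at (coframe f) z (structure_radical (?lam \<beta>))"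
        by metis
      have "T 2 1 2 = structure_radical (?lam \<beta>) 2 1 2"
        by (rule structure_function_12_unique[OF U'(1,2,3,4) U'(5,6)[OF U'(2)]])
      then show ?thesis by (simp add: structure_radical_def)
    qed
    show ?thesis
    proof
      assume "T 2 1 2 = ?lam \<alpha>"
      then have "\<alpha> = \<alpha>0 \<or> \<alpha> = - \<alpha>0" using parameter_injective[OF \<alpha> ex(1)] T212[OF ex] by simp
      then show "equivalent_to (canonical1 \<alpha>) f z0"
      proof
        assume "\<alpha> = - \<alpha>0"
        then have "canonical1 \<alpha>0 F V \<Longrightarrow> canonical1 \<alpha> F V" for F V using canonical1_uminus[of \<alpha> F V] by simp
        then show ?thesis using ex(2) unfolding equivalent_to_def by blast
      qed (use ex in simp)
    qed (rule T212[OF \<alpha>])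
  qed
  have sym: "has_four_point_symmetries (canonical1 \<alpha>)" if "\<alpha> \<noteq> 0" for \<alpha>
    unfolding has_four_point_symmetries_def using canonical1_four_point_symmetries[OF that] by blast
  have sym2: "has_four_point_symmetries canonical2" "has_four_point_symmetries canonical3"
    unfolding has_four_point_symmetries_def
    using canonical2_four_point_symmetries canonical3_four_point_symmetries by blast+
  have "(\<exists>\<alpha>. \<alpha> \<noteq> 0 \<and> equivalent_to (canonical1 \<alpha>) f z0) \<longleftrightarrow>
            invariants_near f z0 \<and>
            (\<exists>\<alpha> T. \<alpha> \<noteq> 0 \<and> canonical_structure (canonical1 \<alpha>) T \<and> constant_structure_near f z0 T)"
    using iff1 by blast
  then show ?thesis using iff2 iff3 parameter sym sym2 by blast
qed

end
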